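(* For almost all $\mathbf{t}\in\mathbb{T}^2$, there is $(x_1,x_2)\in\Delta_2=\{(x_1,x_2)\in\mathbb{R}^2:0\le x_1\le x_2\le1\}$ such that the $S$-adic shift $(X_{\boldsymbol{\sigma}},\Sigma)$ with $\boldsymbol{\sigma}=\Phi(x_1,x_2)$ is measurably conjugate to the translation by $\mathbf{t}$ on $\mathbb{T}^2$. Moreover, the words in $X_{\boldsymbol{\sigma}}$ form natural codings of the translation by $\mathbf{t}$.
   Context: $\mathcal{A}=\{1,2,3\}$, $\mathbb{N}=\{0,1,2,\ldots\}$, $\mathbb{T}^2=\mathbb{R}^2/\mathbb{Z}^2$ with Lebesgue measure. Brun's map $T_{\rm Brun}:\Delta_2\to\Delta_2$ is given by $(x_1,x_2)\mapsto\big(\frac{x_1}{1-x_2},\frac{x_2}{1-x_2}\big)$ on $B(1)=\{x_2\le\frac12\}$, $(x_1,x_2)\mapsto\big(\frac{x_1}{x_2},\frac{1-x_2}{x_2}\big)$ on $B(2)=\{\frac12\le x_2\le1-x_1\}$, $(x_1,x_2)\mapsto\big(\frac{1-x_2}{x_2},\frac{x_1}{x_2}\big)$ on $B(3)=\{1-x_1\le x_2\le1\}$. The Brun substitutions are $\beta_1:1\mapsto1,2\mapsto23,3\mapsto3$; $\beta_2:1\mapsto1,2\mapsto3,3\mapsto23$; $\beta_3:1\mapsto3,2\mapsto1,3\mapsto23$; $S=\{\beta_1,\beta_2,\beta_3\}$. The map $\Phi$, defined for almost all $(x_1,x_2)\in\Delta_2$, is $\Phi(x_1,x_2)=(\sigma_n)_{n\in\mathbb{N}}\in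 S^{\mathbb{N}}$ with $\sigma_n=\beta_i$ if $T_{\rm Brun}^n(x_1,x_2)\in B(i)$. For $\boldsymbol{\sigma}=(\sigma_n)$, $X_{\boldsymbol{\sigma}}$ is the set of infinite words in $\mathcal{A}^{\mathbb{N}}$ each of whose factors is a factor of $\sigma_0\sigma_1\cdots\sigma_{n-1}(i)$ for some $i\in\mathcal{A}$, $n\in\mathbb{N}$; $\Sigma$ is the shift, and $(X_{\boldsymbol{\sigma}},\Sigma)$ is equipped with its (for almost all $(x_1,x_2)$) unique shift invariant probability measure. Natural coding: for a full-rank lattice $\Lambda$ in a Euclidean space, a translation $T_{\mathbf{t}}$ on the quotient torus, a fundamental domain $R$ with induced map $\tilde T_{\mathbf{t}}:R\to R$, and a partition (up to measure zero) $R=R_1\cup\cdots\cup R_k$ such that each $\tilde T_{\mathbf{t}}|_{R_i}$ is a translation $\mathbf{x}\mapsto\mathbf{x}+\mathbf{t}_i$, a coding of (the orbit of) a point of $R$ with respect to this partition is called a natural coding of $T_{\mathbf{t}}$; here one fixed partition serves for all words of $X_{\boldsymbol{\sigma}}$. *)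

theory Defs
  imports "HOL-Probability.Probability" "HOL-Library.Sublist" "HOL-Library.Set_Algebras"
begin

section \<open>Words, substitutions and S-adic shifts\<close>

datatype letter = L1 | L2 | L3

lemma UNIV_letter: "UNIV = {L1, L2, L3}"
  using letter.exhaust by blast

instance letter :: finite
  by standard (simp add: UNIV_letter)

definition subst_word :: "('a \<Rightarrow> 'a list) \<Rightarrow> 'a list \<Rightarrow> 'a list" where
  "subst_word s w = concat (map s w)"

text \<open>\<open>subst_prefix \<sigma> n w\<close> is \<open>\<sigma>\<^sub>0 \<sigma>\<^sub>1 \<dots> \<sigma>\<^bsub>n-1\<^esub> (w)\<close>.\<close>

primrec subst_prefix :: "(nat \<Rightarrow> 'a \<Rightarrow> 'a list) \<Rightarrow> nat \<Rightarrow> 'a list \<Rightarrow> 'a list" where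
  "subst_prefix \<sigma> 0 w = w"
| "subst_prefix \<sigma> (Suc n) w = subst_prefix \<sigma> n (subst_word (\<sigma> n) w)"

definition sadic_words :: "(nat \<Rightarrow> 'a \<Rightarrow> 'a list) \<Rightarrow> (nat \<Rightarrow> 'a) set" where
  "sadic_words \<sigma> =
     {w. \<forall>k l. \<exists>i n. sublist (map w [k..<l]) (subst_prefix \<sigma> n [i])}"

definition word_shift :: "(nat \<Rightarrow> 'a) \<Rightarrow> nat \<Rightarrow> 'a" where
  "word_shift w = (\<lambda>n. w (Suc n))"

section \<open>Brun's algorithm\<close>

definition Delta2 :: "(real \<times> real) set" where
  "Delta2 = {(x1, x2). 0 \<le> x1 \<and> x1 \<le> x2 \<and> x2 \<le> 1}"

fun brun_region :: "letter \<Rightarrow> (real \<times> real) set" where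
  "brun_region L1 = {(x1, x2) \<in> Delta2. x2 \<le> 1/2}"
| "brun_region L2 = {(x1, x2) \<in> Delta2. 1/2 \<le> x2 \<and> x2 \<le> 1 - x1}"
| "brun_region L3 = {(x1, x2) \<in> Delta2. 1 - x1 \<le> x2 \<and> x2 \<le> 1}"

fun brun_branch :: "letter \<Rightarrow> real \<times> real \<Rightarrow> real \<times> real" where
  "brun_branch L1 (x1, x2) = (x1 / (1 - x2), x2 / (1 - x2))"
| "brun_branch L2 (x1, x2) = (x1 / x2, (1 - x2) / x2)"
| "brun_branch L3 (x1, x2) = ((1 - x2) / x2, x1 / x2)"

text \<open>The regions overlap on their boundaries, where the branches agree
  (lemma \<open>brun_map_eq\<close>); the order of the tests is therefore irrelevant. The value
  outside \<^const>\<open>Delta2\<close> is never used.\<close>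

definition brun_map :: "real \<times> real \<Rightarrow> real \<times> real" where
  "brun_map x =
     (if x \<in> brun_region L1 then brun_branch L1 x
      else if x \<in> brun_region L2 then brun_branch L2 x
      else brun_branch L3 x)"

lemma brun_map_eq:
  assumes "x \<in> brun_region i"
  shows "brun_map x = brun_branch i x"
proof (cases x)
  case (Pair x1 x2)
  show ?thesis
  proof (cases i)
    case L1
    then show ?thesis using assms by (simp add: brun_map_def)
  next
    case L2
    then have *: "x \<in> brun_region L2" using assms by simp
    show ?thesis
    proof (cases "x \<in> brun_region L1")
      case True
      then have "x2 = 1/2" using * Pair by simp
      with Pair have "x = (x1, 1/2)" by (simp only:)
      then show ?thesis using L2 True by (simp add: brun_map_def)
    next
      case False
      then show ?thesis using L2 * by (simp add: brun_map_def)
    qed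
  next
    case L3
    then have *: "0 \<le> x1" "x1 \<le> x2" "x2 \<le> 1" "1 - x1 \<le> x2"
      using assms Pair by (auto simp: Delta2_def)
    consider "x2 \<le> 1/2" | "x2 > 1/2" "x2 \<le> 1 - x1" | "x2 > 1/2" "x2 > 1 - x1"
      by linarith
    then show ?thesis
    proof cases
      case 1
      then have "x1 = 1/2" "x2 = 1/2" using * by linarith+
      with Pair have "x = (1/2, 1/2)" by (simp only:)
      then show ?thesis using L3 by (simp add: brun_map_def Delta2_def)
    next
      case 2
      then have "x1 = 1 - x2" using * by linarith
      then show ?thesis using L3 Pair 2 by (simp add: brun_map_def)
    next
      case 3
      then show ?thesis using L3 Pair by (simp add: brun_map_def)
    qed
  qed
qed

fun brun_subst :: "letter \<Rightarrow> letter \<Rightarrow> letter list" where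
  "brun_subst L1 L1 = [L1]"
| "brun_subst L1 L2 = [L2, L3]"
| "brun_subst L1 L3 = [L3]"
| "brun_subst L2 L1 = [L1]"
| "brun_subst L2 L2 = [L3]"
| "brun_subst L2 L3 = [L2, L3]"
| "brun_subst L3 L1 = [L3]"
| "brun_subst L3 L2 = [L1]"
| "brun_subst L3 L3 = [L2, L3]"

text \<open>The map \<open>\<Phi>\<close> is defined on the points whose orbit avoids the overlaps of the regions.\<close>

definition Phi_domain :: "(real \<times> real) set" where
  "Phi_domain = {x \<in> Delta2. \<forall>n. \<exists>!i. (brun_map ^^ n) x \<in> brun_region i}"

definition Phi :: "real \<times> real \<Rightarrow> nat \<Rightarrow> letter \<Rightarrow> letter list" where
  "Phi x n = brun_subst (THE i. (brun_map ^^ n) x \<in> brun_region i)"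

section \<open>Invariant measures and measurable conjugacy\<close>

definition measure_preserving :: "'a measure \<Rightarrow> 'b measure \<Rightarrow> ('a \<Rightarrow> 'b) \<Rightarrow> bool" where
  "measure_preserving M N f \<longleftrightarrow> f \<in> measurable M N \<and> distr M N f = N"

definition invariant_prob :: "(nat \<Rightarrow> 'a) set \<Rightarrow> (nat \<Rightarrow> 'a) measure \<Rightarrow> bool" where
  "invariant_prob X \<mu> \<longleftrightarrow>
     prob_space \<mu> \<and>
     sets \<mu> = sets (restrict_space (\<Pi>\<^sub>M n\<in>UNIV. count_space UNIV) X) \<and>
     measure_preserving \<mu> \<mu> word_shift"

definition unique_invariant_prob :: "(nat \<Rightarrow> 'a) set \<Rightarrow> (nat \<Rightarrow> 'a) measure \<Rightarrow> bool" where
  "unique_invariant_prob X \<mu> \<longleftrightarrow>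
     invariant_prob X \<mu> \<and> (\<forall>\<nu>. invariant_prob X \<nu> \<longrightarrow> \<nu> = \<mu>)"

text \<open>\<open>A\<close> and \<open>B\<close> are forward invariant sets of full measure, and \<open>f\<close> is an invertible
  (bimeasurable) measure preserving equivariant map between them.\<close>

definition measurably_conjugate ::
    "'a measure \<Rightarrow> ('a \<Rightarrow> 'a) \<Rightarrow> 'b measure \<Rightarrow> ('b \<Rightarrow> 'b) \<Rightarrow> bool" where
  "measurably_conjugate M S N T \<longleftrightarrow>
     (\<exists>A B f. A \<in> sets M \<and> B \<in> sets N \<and>
        (AE x in M. x \<in> A) \<and> (AE y in N. y \<in> B) \<and>
        S ` A \<subseteq> A \<and> T ` B \<subseteq> B \<and>
        bij_betw f A B \<and>
        measure_preserving (restrict_space M A) (restrict_space N B) f \<and>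
        measure_preserving (restrict_space N B) (restrict_space M A) (the_inv_into A f) \<and>
        (\<forall>x\<in>A. f (S x) = T (f x)))"

section \<open>Tori and natural codings\<close>

definition full_rank_lattice :: "'a::euclidean_space set \<Rightarrow> bool" where
  "full_rank_lattice \<Lambda> \<longleftrightarrow>
     (\<exists>B. independent B \<and> span B = UNIV \<and>
          \<Lambda> = range (\<lambda>c :: 'a \<Rightarrow> int. \<Sum>b\<in>B. of_int (c b) *\<^sub>R b))"

text \<open>Points of the quotient by \<open>\<Lambda>\<close> are the cosets of \<open>\<Lambda>\<close>. The sum of two cosets is their
  Minkowski sum, so that the translation by \<open>t\<close> is \<open>\<lambda>c. t + c\<close>.\<close>

definition lattice_coset :: "'a::euclidean_space set \<Rightarrow> 'a \<Rightarrow> 'a set" where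
  "lattice_coset \<Lambda> x = {y. y - x \<in> \<Lambda>}"

definition torus_points :: "'a::euclidean_space set \<Rightarrow> 'a set set" where
  "torus_points \<Lambda> = range (lattice_coset \<Lambda>)"

definition torus_borel :: "'a::euclidean_space set \<Rightarrow> 'a set measure" where
  "torus_borel \<Lambda> =
     sigma (torus_points \<Lambda>)
       {A. A \<subseteq> torus_points \<Lambda> \<and> lattice_coset \<Lambda> -` A \<in> sets borel}"

definition Z2 :: "(real \<times> real) set" where
  "Z2 = \<int> \<times> \<int>"

definition torus2 :: "(real \<times> real) set measure" where
  "torus2 =
     distr (restrict_space lborel ({0..<1} \<times> {0..<1})) (torus_borel Z2) (lattice_coset Z2)"

text \<open>A fundamental domain is understood up to measure zero.\<close>

definition fundamental_domain :: "'a::euclidean_space set \<Rightarrow> 'a set \<Rightarrow> bool" where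
  "fundamental_domain \<Lambda> R \<longleftrightarrow>
     R \<in> sets borel \<and> (AE x in lborel. \<exists>!y. y \<in> R \<and> lattice_coset \<Lambda> y = lattice_coset \<Lambda> x)"

text \<open>The last condition says that the map induced on \<open>R\<close> by the translation by the coset \<open>t\<close> is
  the translation by the vector \<open>\<tau> i\<close> on \<open>P i\<close>. The pieces may overlap in null sets, and a point
  in an overlap may have several codings. Compactness is what makes this meaningful: with arbitrary
  measurable pieces, one could enlarge the pieces by null sets so as to turn unrelated sequences
  into codings.\<close>

definition natural_partition ::
    "'a::euclidean_space set \<Rightarrow> 'a set \<Rightarrow> 'a set \<Rightarrow> ('i::finite \<Rightarrow> 'a set) \<Rightarrow> ('i \<Rightarrow> 'a) \<Rightarrow> bool"
  where
  "natural_partition \<Lambda> t R P \<tau> \<longleftrightarrow>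
     full_rank_lattice \<Lambda> \<and> t \<in> torus_points \<Lambda> \<and>
     compact R \<and> fundamental_domain \<Lambda> R \<and>
     (\<forall>i. compact (P i) \<and> P i \<subseteq> R) \<and>
     R - (\<Union>i. P i) \<in> null_sets lborel \<and>
     (\<forall>i j. i \<noteq> j \<longrightarrow> P i \<inter> P j \<in> null_sets lborel) \<and>
     (\<forall>i. \<forall>x\<in>P i. x + \<tau> i \<in> R \<and> lattice_coset \<Lambda> (x + \<tau> i) = t + lattice_coset \<Lambda> x)"

definition coding_of ::
    "('i \<Rightarrow> 'a::euclidean_space set) \<Rightarrow> ('i \<Rightarrow> 'a) \<Rightarrow> 'a \<Rightarrow> (nat \<Rightarrow> 'i) \<Rightarrow> bool" where
  "coding_of P \<tau> x w \<longleftrightarrow>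
     (\<exists>y. y 0 = x \<and> (\<forall>n. y n \<in> P (w n) \<and> y (Suc n) = y n + \<tau> (w n)))"

end

theory Submission
  imports Defs "HOL-Analysis.Kronecker_Approximation_Theorem"
begin

text \<open>
  Let \<open>f\<close> be the vector of letter frequencies of the \<open>S\<close>-adic shift. The abelianised prefixes of a
  limit word, projected along \<open>f\<close>, form a walk in the plane whose steps are all congruent to the
  translation vector modulo the lattice. If the walk is bounded, the closures \<open>R\<^sub>i\<close> of the positions
  followed by the letter \<open>i\<close> cover the torus, because the translation is minimal. If moreover the
  areas of the \<open>R\<^sub>i\<close> add up to at most one, then almost every point is covered exactly once. This
  alone yields the natural coding, the conjugacy (a coding point of a word is unique, since two of
  them would make \<open>\<Union>R\<^sub>i\<close> invariant under a translation) and the unique ergodicity (the push-forward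
  of an invariant measure is invariant under a dense group of translations).

  Both conditions come from the accelerated algorithm, in which runs of \<open>\<beta>\<^sub>1\<close> are grouped. The
  projected columns of the products of incidence matrices never grow in the maximum norm, and the
  digit block \<open>W\<^sub>K = (K, \<beta>\<^sub>2) (0, \<beta>\<^sub>3) (K, \<beta>\<^sub>2)\<close> contracts them by \<open>3/(K+1)\<close>. Just before such a block
  the algorithm is almost degenerate: up to errors of order \<open>1/K\<close> times the size of the remaining
  walk, the piece of the letter 3 is the parallelogram of the first two columns, while the pieces of
  the letters 1 and 2 are negligible. So the total area is at most one as soon as arbitrarily large
  \<open>K\<close> occur, followed by a tail whose size is small compared to \<open>K\<close>.

  For almost every \<open>f\<close> this happens. In frequency coordinates the cylinders are triangles of area
  \<open>1 / (2 h\<^sub>3 (h\<^sub>2 + h\<^sub>3) (h\<^sub>1 + h\<^sub>2 + h\<^sub>3))\<close>, where \<open>h\<close> are the column sums of the matrix product, and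
  accelerated products satisfy \<open>h\<^sub>1, h\<^sub>2 \<le> h\<^sub>3\<close>. Hence the conditional probability of \<open>W\<^sub>K\<close> is at least
  \<open>1 / (6 (K+2)\<^sup>6)\<close>, whatever happened before, and the probability that \<open>n\<close> consecutive trials fail
  decays exponentially in \<open>n\<close>. Finally, almost every point of the torus is, up to sign and a
  permutation, given by such a sorted frequency vector.
\<close>

section \<open>Integer translates in the plane\<close>

text \<open>Boundedness of the walk only yields a covering of finite multiplicity; the area bound is
  the hard point. It is proved in the form \<open>1 + 6 * eta + 12 * eta\<^sup>2\<close>, where
  \<open>eta\<close> compares the size of the tail after a block \<open>W\<^sub>K\<close> with
  \<open>K\<close>. A regular tail of stage \<open>m\<close> has size \<open>6 * (m + 1)\<close>, so
  \<open>K = m\<^sup>2\<close> makes \<open>eta\<close> of order \<open>1 / m\<close>.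

  The block works because its two long runs sweep two independent directions, while the digit
  between them exchanges the axes. In the tails the parameter 5 is taken because
  \<open>3 / (5 + 1) = 1 / 2\<close>: such a block halves all projected weights. The windows in
  which one of them must occur grow linearly, slowly enough for the weights to be summable and fast
  enough for the failure probabilities to be summable.

  The number of trials granted to \<open>K = m\<^sup>2\<close> is polynomial in \<open>m\<close>,
  while an irregular tail at a given place is exponentially unlikely. A union bound over all places
  thus replaces conditioning on a stopping time. Infinitely many successful stages suffice, so it is
  enough that the failure probabilities tend to zero.\<close>

abbreviation unit_sq :: "(real \<times> real) set" where
  "unit_sq \<equiv> {0..<1} \<times> {0..<1}"

lemma Z2_iff: "z \<in> Z2 \<longleftrightarrow> fst z \<in> \<int> \<and> snd z \<in> \<int>"
  by (cases z) (auto simp: Z2_def)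

lemma Z2_0 [simp]: "0 \<in> Z2"
  by (simp add: Z2_iff)

lemma Z2_add: "a \<in> Z2 \<Longrightarrow> b \<in> Z2 \<Longrightarrow> a + b \<in> Z2"
  by (simp add: Z2_iff)

lemma Z2_diff: "a \<in> Z2 \<Longrightarrow> b \<in> Z2 \<Longrightarrow> a - b \<in> Z2"
  by (simp add: Z2_iff)

lemma Z2_uminus: "a \<in> Z2 \<Longrightarrow> - a \<in> Z2"
  by (simp add: Z2_iff)

lemma Z2_add_iff: "b \<in> Z2 \<Longrightarrow> a + b \<in> Z2 \<longleftrightarrow> a \<in> Z2"
  using Z2_add[of a b] Z2_diff[of "a + b" b] by auto

lemma Z2_sum: "(\<And>i. i \<in> A \<Longrightarrow> f i \<in> Z2) \<Longrightarrow> sum f A \<in> Z2"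
  by (induction A rule: infinite_finite_induct) (auto intro: Z2_add)

lemma countable_Z2 [simp]: "countable Z2"
  unfolding Z2_def by (intro countable_SIGMA) (auto simp: countable_int Ints_def)

lemma borel_Z2_translate [measurable]: "(\<lambda>z::real\<times>real. z + g) \<in> borel_measurable borel"
  by (rule borel_measurable_continuous_onI) (intro continuous_intros)

lemma unit_sq_borel [measurable]: "unit_sq \<in> sets borel"
  by (intro borel_Times) auto

lemma unit_sq_unique: 
  assumes "g \<in> Z2" "h \<in> Z2" "z + g \<in> unit_sq" "z + h \<in> unit_sq"
  shows "g = h"
proof -
  have *: "a = b" if "a \<in> \<int>" "b \<in> \<int>" "0 \<le> x + a" "x + a < 1" "0 \<le> x + b" "x + b < 1" for a b x :: real
  proof -
    have "a - b \<in> \<int>" "\<bar>a - b\<bar> < 1" using that by auto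
    then show ?thesis using Ints_eq_abs_less1[of a b] that by auto
  qed
  have "fst g = fst h" by (rule *[of _ _ "fst z"]) (use assms in \<open>auto simp: Z2_iff mem_Times_iff\<close>)
  moreover have "snd g = snd h" by (rule *[of _ _ "snd z"]) (use assms in \<open>auto simp: Z2_iff mem_Times_iff\<close>)
  ultimately show ?thesis by (simp add: prod_eq_iff)
qed

lemma unit_sq_ex: "\<exists>g\<in>Z2. z + g \<in> unit_sq"
proof (intro bexI)
  let ?g = "(- of_int \<lfloor>fst z\<rfloor>, - of_int \<lfloor>snd z\<rfloor>) :: real \<times> real"
  show "?g \<in> Z2" by (simp add: Z2_iff)
  show "z + ?g \<in> unit_sq"
    by (cases z) (auto, linarith+)
qed

lemma unit_sq_ex1: "\<exists>!g. g \<in> Z2 \<and> z + g \<in> unit_sq"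
  proof -
  obtain g where g: "g \<in> Z2" "z + g \<in> unit_sq" using unit_sq_ex[of z] by (rule bexE)
  show ?thesis
  proof (rule ex1I[of _ g])
    show "h = g" if "h \<in> Z2 \<and> z + h \<in> unit_sq" for h
      by (rule unit_sq_unique[of h g z]) (use that g in simp_all)
  qed (use g in simp)
qed

lemma nn_integral_count_ex1:
  assumes "\<exists>!g. g \<in> G \<and> P g"
  shows "(\<integral>\<^sup>+g. indicator {g. P g} g \<partial>count_space G) = (1::ennreal)"
proof -
  obtain g where g: "g \<in> G" "P g" "\<And>h. h \<in> G \<Longrightarrow> P h \<Longrightarrow> h = g" using assms by blast
  have "(\<integral>\<^sup>+h. indicator {g. P g} h \<partial>count_space G) = (\<integral>\<^sup>+h. indicator {g} h \<partial>count_space G)"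
  proof (rule nn_integral_cong)
    fix h assume "h \<in> space (count_space G)"
    then have "P h \<longleftrightarrow> h = g" using g(2) g(3)[of h] by auto
    then show "indicator {g. P g} h = (indicator {g} h :: ennreal)" by (simp add: indicator_def)
  qed
  also have "\<dots> = 1" using g(1) by simp
  finally show ?thesis .
qed

lemma lborel_translate:
  fixes f :: "'a::euclidean_space \<Rightarrow> ennreal"
  assumes [measurable]: "f \<in> borel_measurable borel"
  shows "(\<integral>\<^sup>+x. f (x + c) \<partial>lborel) = (\<integral>\<^sup>+x. f x \<partial>lborel)"
proof -
  have "(\<integral>\<^sup>+x. f x \<partial>lborel) = (\<integral>\<^sup>+x. f x \<partial>distr lborel borel ((+) c))"
    by (simp add: lborel_distr_plus)
  also have "\<dots> = (\<integral>\<^sup>+x. f (c + x) \<partial>lborel)"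
    by (subst nn_integral_distr) auto
  finally show ?thesis by (simp add: add.commute)
qed

text \<open>Insert the factor one in the form of the number of \<open>g\<close> with
  \<open>x + g\<close> in the unit square, exchange sum and integral, translate each summand by
  \<open>g\<close>, and replace \<open>g\<close> by its negative.\<close>

lemma nn_integral_unfold_Z2:
  fixes f :: "real \<times> real \<Rightarrow> ennreal"
  assumes [measurable]: "f \<in> borel_measurable borel"
  shows "(\<integral>\<^sup>+x. f x \<partial>lborel) = (\<integral>\<^sup>+x. indicator unit_sq x * (\<integral>\<^sup>+g. f (x + g) \<partial>count_space Z2) \<partial>lborel)"
proof -
  have [measurable]: "unit_sq \<in> sets borel" by (rule unit_sq_borel)
  have "(\<integral>\<^sup>+x. f x \<partial>lborel) = (\<integral>\<^sup>+x. (\<integral>\<^sup>+g. indicator {g. x + g \<in> unit_sq} g \<partial>count_space Z2) * f x \<partial>lborel)"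
    by (intro nn_integral_cong, subst nn_integral_count_ex1[OF unit_sq_ex1]) simp
  also have "\<dots> = (\<integral>\<^sup>+x. (\<integral>\<^sup>+g. indicator unit_sq (x + g) * f x \<partial>count_space Z2) \<partial>lborel)"
    by (intro nn_integral_cong, subst nn_integral_multc[symmetric])
       (auto intro!: nn_integral_cong split: split_indicator)
  also have "\<dots> = (\<integral>\<^sup>+g. (\<integral>\<^sup>+x. indicator unit_sq (x + g) * f x \<partial>lborel) \<partial>count_space Z2)"
    by (intro nn_integral_count_space_nn_integral) auto
  also have "\<dots> = (\<integral>\<^sup>+g. (\<integral>\<^sup>+x. indicator unit_sq x * f (x + - g) \<partial>lborel) \<partial>count_space Z2)"
  proof (rule nn_integral_cong)
    fix g :: "real \<times> real"
    show "(\<integral>\<^sup>+x. indicator unit_sq (x + g) * f x \<partial>lborel) = (\<integral>\<^sup>+x. indicator unit_sq x * f (x + - g) \<partial>lborel)"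
      using lborel_translate[of "\<lambda>x. indicator unit_sq x * f (x + - g)" g] by simp
  qed
  also have "\<dots> = (\<integral>\<^sup>+g. (\<integral>\<^sup>+x. indicator unit_sq x * f (x + g) \<partial>lborel) \<partial>count_space Z2)"
    by (rule nn_integral_bij_count_space[where g = uminus])
       (auto intro!: bij_betwI[where g = uminus] simp: Z2_uminus simp del: uminus_Pair)
  also have "\<dots> = (\<integral>\<^sup>+x. (\<integral>\<^sup>+g. indicator unit_sq x * f (x + g) \<partial>count_space Z2) \<partial>lborel)"
    by (intro nn_integral_count_space_nn_integral[symmetric]) auto
  also have "\<dots> = (\<integral>\<^sup>+x. indicator unit_sq x * (\<integral>\<^sup>+g. f (x + g) \<partial>count_space Z2) \<partial>lborel)"
    by (intro nn_integral_cong) (auto simp: nn_integral_cmult)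
  finally show ?thesis .
qed

lemma AE_lborel_translate:
  fixes c :: "'a::euclidean_space"
  assumes "AE x in lborel. P x"
  shows "AE x in lborel. P (x + c)"
proof -
  have "AE x in distr lborel borel ((+) c). P x"
    using assms by (subst lborel_distr_plus)
  then have "AE x in lborel. P (c + x)"
    by (rule AE_distrD[rotated]) simp
  then show ?thesis by (simp add: add.commute)
qed

lemma emeasure_translate_image:
  fixes E :: "'a::euclidean_space set"
  assumes "E \<in> sets borel"
  shows "emeasure lborel ((+) c ` E) = emeasure lborel E"
proof -
  have "(+) (- c) -` E = (+) c ` E" by (force simp: image_iff)
  then have "emeasure lborel ((+) c ` E) = emeasure (distr lborel borel ((+) (- c))) E"
    using assms by (subst emeasure_distr) simp_all
  then show ?thesis by (simp add: lborel_distr_plus)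
qed

text \<open>Every failure is a lattice translate of a failure inside the unit square, and countably
  many translates of a null set are null.\<close>

lemma AE_periodic:
  assumes per: "\<And>z g. g \<in> Z2 \<Longrightarrow> P (z + g) \<longleftrightarrow> P z"
    and ae: "AE x in lborel. x \<in> unit_sq \<longrightarrow> P x"
  shows "AE x in lborel. P x"
proof -
  have "AE x in lborel. \<forall>g\<in>Z2. x + g \<in> unit_sq \<longrightarrow> P (x + g)"
    using AE_lborel_translate[OF ae] by (subst AE_ball_countable) auto
  then show ?thesis
  proof (rule eventually_mono)
    fix x assume *: "\<forall>g\<in>Z2. x + g \<in> unit_sq \<longrightarrow> P (x + g)"
    obtain g where "g \<in> Z2" "x + g \<in> unit_sq" using unit_sq_ex[of x] by (rule bexE)
    then show "P x" using * per[of g x] by simp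
  qed
qed

lemma borel_translate_pred [measurable]:
  fixes E :: "(real\<times>real) set"
  assumes "E \<in> sets borel"
  shows "Measurable.pred borel (\<lambda>y. y + c \<in> E)"
  using assms by measurable

lemma emeasure_unit_sq: "emeasure lborel unit_sq = 1"
  using lborel.emeasure_pair_measure_Times[of "{0..<1::real}" lborel "{0..<1::real}"]
  by (simp add: lborel_prod)

section \<open>Multiplicity of a planar set modulo the integer lattice\<close>

definition mult_Z2 :: "(real \<times> real) set \<Rightarrow> real \<times> real \<Rightarrow> ennreal" where
  "mult_Z2 E y = (\<integral>\<^sup>+g. indicator E (y + g) \<partial>count_space Z2)"

lemma infinite_Z2: "infinite Z2"
proof
  assume "finite Z2"
  moreover have "inj (\<lambda>n::nat. (real n, 0::real))" by (auto simp: inj_on_def)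
  moreover have "range (\<lambda>n::nat. (real n, 0::real)) \<subseteq> Z2" by (auto simp: Z2_def)
  ultimately show False using finite_subset range_inj_infinite by blast
qed

lemma mult_Z2_suminf: "mult_Z2 E y = (\<Sum>n. indicator E (y + from_nat_into Z2 n))"
  unfolding mult_Z2_def nn_integral_count_space_nat[symmetric]
  using bij_betw_from_nat_into[OF countable_Z2 infinite_Z2]
  by (rule nn_integral_bij_count_space[symmetric])

lemma borel_measurable_mult_Z2 [measurable]:
  assumes [measurable]: "E \<in> sets borel"
  shows "mult_Z2 E \<in> borel_measurable borel"
  unfolding mult_Z2_suminf[abs_def] by measurable

lemma nn_integral_mult_Z2:
  assumes [measurable]: "E \<in> sets borel"
  shows "(\<integral>\<^sup>+y. indicator unit_sq y * mult_Z2 E y \<partial>lborel) = emeasure lborel E"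
proof -
  have "emeasure lborel E = (\<integral>\<^sup>+y. indicator E y \<partial>lborel)" by simp
  also have "\<dots> = (\<integral>\<^sup>+y. indicator unit_sq y * mult_Z2 E y \<partial>lborel)"
    unfolding mult_Z2_def by (rule nn_integral_unfold_Z2) simp
  finally show ?thesis ..
qed

lemma mult_Z2_ge:
  assumes "finite A" "A \<subseteq> Z2" "\<And>g. g \<in> A \<Longrightarrow> y + g \<in> E"
  shows "of_nat (card A) \<le> mult_Z2 E y"
proof -
  have "of_nat (card A) = (\<integral>\<^sup>+g. indicator A g \<partial>count_space Z2)"
    using assms(1,2) by simp
  also have "\<dots> \<le> mult_Z2 E y"
    unfolding mult_Z2_def by (intro nn_integral_mono) (use assms in \<open>auto split: split_indicator\<close>)
  finally show ?thesis .
qed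

text \<open>The total multiplicity of the pieces is everywhere at least one, while its mean is
  the total area, which is at most one.\<close>

lemma AE_exactly_one:
  fixes E :: "'i::finite \<Rightarrow> (real \<times> real) set"
  assumes [measurable]: "\<And>i. E i \<in> sets borel"
    and area: "(\<Sum>i\<in>UNIV. emeasure lborel (E i)) \<le> 1"
    and cover: "\<And>y. \<exists>i. \<exists>g\<in>Z2. y + g \<in> E i"
  shows "AE y in lborel. \<forall>i j. \<forall>g\<in>Z2. \<forall>h\<in>Z2. y + g \<in> E i \<and> y + h \<in> E j \<longrightarrow> i = j \<and> g = h"
    (is "AE y in lborel. ?P y")
proof (rule AE_periodic)
  fix z g :: "real \<times> real" assume g: "g \<in> Z2"
  have *: "?P (z + g)" if "?P z" "g \<in> Z2" for z g
  proof (intro allI ballI impI)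
    fix i j g' h' assume "g' \<in> Z2" "h' \<in> Z2" "z + g + g' \<in> E i \<and> z + g + h' \<in> E j"
    then have "i = j \<and> g + g' = g + h'"
      using that by (metis Z2_add add.assoc)
    then show "i = j \<and> g' = h'" by simp
  qed
  show "?P (z + g) = ?P z"
  proof
    assume "?P (z + g)"
    then have "?P (z + g + - g)" by (rule *) (rule Z2_uminus[OF g])
    then show "?P z" by (simp only: add.assoc right_minus add_0_right)
  next
    assume "?P z"
    then show "?P (z + g)" by (rule *) (rule g)
  qed
next
  define F where "F y = (\<Sum>i\<in>UNIV. mult_Z2 (E i) y)" for y
  have [measurable]: "F \<in> borel_measurable borel" unfolding F_def by measurable
  have ge1: "1 \<le> F y" for y
  proof -
    obtain i g where "g \<in> Z2" "y + g \<in> E i" using cover[of y] by blast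
    then have "1 \<le> mult_Z2 (E i) y" using mult_Z2_ge[of "{g}" y "E i"] by simp
    also have "\<dots> \<le> F y" unfolding F_def by (rule member_le_sum) auto
    finally show ?thesis .
  qed
  have "(\<integral>\<^sup>+y. indicator unit_sq y * F y \<partial>lborel) = (\<Sum>i\<in>UNIV. emeasure lborel (E i))"
    unfolding F_def sum_distrib_left
    by (subst nn_integral_sum) (auto simp: nn_integral_mult_Z2)
  with area have int: "(\<integral>\<^sup>+y. indicator unit_sq y * F y \<partial>lborel) \<le> 1" by simp
  also have "\<dots> < \<top>" by simp
  finally have fin: "(\<integral>\<^sup>+y. indicator unit_sq y * F y \<partial>lborel) < \<top>" .
  have "(\<integral>\<^sup>+y. (indicator unit_sq y * F y - indicator unit_sq y) \<partial>lborel)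
      = (\<integral>\<^sup>+y. indicator unit_sq y * F y \<partial>lborel) - (\<integral>\<^sup>+y. indicator unit_sq y \<partial>lborel)"
    using ge1 fin emeasure_unit_sq by (intro nn_integral_diff) (auto split: split_indicator)
  also have "\<dots> = 0" using int fin by (simp add: diff_eq_0_iff_ennreal emeasure_unit_sq)
  finally have "AE y in lborel. indicator unit_sq y * F y - indicator unit_sq y = 0"
    by (subst (asm) nn_integral_0_iff_AE) auto
  then show "AE y in lborel. y \<in> unit_sq \<longrightarrow> ?P y"
  proof (rule eventually_mono, intro impI allI ballI)
    fix y i j g h
    assume "indicator unit_sq y * F y - indicator unit_sq y = 0" "y \<in> unit_sq"
    \<comment> \<open>Subtraction in \<open>ennreal\<close> is truncated, so the vanishing
      difference only says that the multiplicity is at most one; this is the half that is needed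
      here.\<close>
    then have F: "F y \<le> 1" by (simp add: diff_eq_0_iff_ennreal)
    assume *: "g \<in> Z2" "h \<in> Z2" "y + g \<in> E i \<and> y + h \<in> E j"
    have two: "\<not> (2::ennreal) \<le> 1" by simp
    show "i = j \<and> g = h"
    proof (rule ccontr)
      assume neq: "\<not> (i = j \<and> g = h)"
      show False
      proof (cases "i = j")
        case True
        then have "2 \<le> mult_Z2 (E i) y" 
          using mult_Z2_ge[of "{g, h}" y "E i"] * neq by auto
        also have "\<dots> \<le> F y" unfolding F_def by (rule member_le_sum) auto
        finally show False using F two order_trans by blast
      next
        case False
        have "2 = (1::ennreal) + 1" by simp
        also have "\<dots> \<le> mult_Z2 (E i) y + mult_Z2 (E j) y"
          using mult_Z2_ge[of "{g}" y "E i"] mult_Z2_ge[of "{h}" y "E j"] * by (intro add_mono) auto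
        also have "\<dots> = (\<Sum>k\<in>{i, j}. mult_Z2 (E k) y)" using False by simp
        also have "\<dots> \<le> F y" unfolding F_def by (rule sum_mono2) auto
        finally show False using F two order_trans by blast
      qed
    qed
  qed
qed

lemma emeasure_ge_1_if_cover:
  assumes [measurable]: "Q \<in> sets borel" and cover: "\<And>y. \<exists>g\<in>Z2. y + g \<in> Q"
  shows "1 \<le> emeasure lborel Q"
proof -
  have "1 = (\<integral>\<^sup>+y. indicator unit_sq y \<partial>lborel)" by (simp add: emeasure_unit_sq)
  also have "\<dots> \<le> (\<integral>\<^sup>+y. indicator unit_sq y * mult_Z2 Q y \<partial>lborel)"
  proof (intro nn_integral_mono)
    fix y
    obtain g where "g \<in> Z2" "y + g \<in> Q" using cover by blast
    then have "1 \<le> mult_Z2 Q y" using mult_Z2_ge[of "{g}" y Q] by simp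
    then show "indicator unit_sq y \<le> indicator unit_sq y * mult_Z2 Q y"
      by (simp split: split_indicator)
  qed
  also have "\<dots> = emeasure lborel Q" by (rule nn_integral_mult_Z2) simp
  finally show ?thesis .
qed

text \<open>Iterating the hypothesis, almost every point of \<open>R\<close> would carry a whole
  arithmetic progression with step \<open>d\<close> inside \<open>R\<close>, which boundedness
  forbids.\<close>

lemma bounded_translate_invariant_null:
  fixes R :: "'a::euclidean_space set"
  assumes "bounded R" "R \<in> sets borel" "d \<noteq> 0" "AE z in lborel. z \<in> R \<longrightarrow> z + d \<in> R"
  shows "emeasure lborel R = 0"
proof -
  have "AE z in lborel. z \<in> R \<longrightarrow> z + of_nat k *\<^sub>R d \<in> R" for k
  proof (induction k)
    case (Suc k)
    from AE_lborel_translate[OF assms(4), of "of_nat k *\<^sub>R d"] Suc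
    show ?case by eventually_elim (simp add: algebra_simps)
  qed simp
  then have "AE z in lborel. \<forall>k. z \<in> R \<longrightarrow> z + of_nat k *\<^sub>R d \<in> R"
    by (subst AE_all_countable) blast
  then have "AE z in lborel. z \<notin> R"
  proof (rule eventually_mono)
    fix z assume *: "\<forall>k. z \<in> R \<longrightarrow> z + of_nat k *\<^sub>R d \<in> R"
    obtain B where B: "\<And>x. x \<in> R \<Longrightarrow> norm x \<le> B" using assms(1) bounded_iff by blast
    obtain k :: nat where k: "(B + norm z) / norm d < k" using reals_Archimedean2 by blast
    have "norm (of_nat k *\<^sub>R d) \<le> norm (z + of_nat k *\<^sub>R d) + norm z"
      by (metis add.commute add_diff_cancel_left' norm_triangle_ineq4)
    moreover have "norm (of_nat k *\<^sub>R d) > B + norm z"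
      using k assms(3) by (simp add: field_simps)
    ultimately show "z \<notin> R" using * B[of "z + of_nat k *\<^sub>R d"] by fastforce
  qed
  then show ?thesis using assms(2) by (subst (asm) AE_iff_null_sets[symmetric]) auto
qed

section \<open>Natural codings from bounded walks\<close>

lemma finite_Z2_bounded: "finite {g \<in> Z2. norm g \<le> B}"
proof (rule finite_subset)
  let ?I = "{- \<lceil>B\<rceil>..\<lceil>B\<rceil>}"
  show "{g \<in> Z2. norm g \<le> B} \<subseteq> (\<lambda>(a, b). (of_int a, of_int b)) ` (?I \<times> ?I)"
  proof
    fix g assume g: "g \<in> {g \<in> Z2. norm g \<le> B}"
    then obtain a b where ab: "g = (of_int a, of_int b)"
      by (cases g) (auto simp: Z2_def Ints_def)
    have "\<bar>real_of_int a\<bar> \<le> B" "\<bar>real_of_int b\<bar> \<le> B"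
      using g norm_fst_le[of "of_int a :: real" "of_int b :: real"] norm_snd_le[of "of_int b :: real" "of_int a :: real"]
      by (auto simp: ab)
    then have "a \<in> ?I" "b \<in> ?I" by (auto simp: le_ceiling_iff abs_le_iff) linarith+
    then show "g \<in> (\<lambda>(a, b). (of_int a, of_int b)) ` (?I \<times> ?I)" by (auto simp: ab)
  qed
qed simp

lemma lattice_coset_eq_iff: "lattice_coset Z2 x = lattice_coset Z2 y \<longleftrightarrow> x - y \<in> Z2"
proof
  assume *: "lattice_coset Z2 x = lattice_coset Z2 y"
  have "x \<in> lattice_coset Z2 x" by (simp add: lattice_coset_def)
  then show "x - y \<in> Z2" unfolding * by (simp add: lattice_coset_def)
next
  assume *: "x - y \<in> Z2"
  have "z - x \<in> Z2 \<longleftrightarrow> z - y \<in> Z2" for z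
    using Z2_add_iff[OF *, of "z - x"] by simp
  then show "lattice_coset Z2 x = lattice_coset Z2 y" by (simp add: lattice_coset_def)
qed

lemma lattice_coset_add: "lattice_coset Z2 x + lattice_coset Z2 y = lattice_coset Z2 (x + y)"
proof (intro equalityI subsetI)
  fix z assume "z \<in> lattice_coset Z2 x + lattice_coset Z2 y"
  then obtain a b where "z = a + b" "a - x \<in> Z2" "b - y \<in> Z2"
    by (auto simp: set_plus_def lattice_coset_def)
  then show "z \<in> lattice_coset Z2 (x + y)"
    using Z2_add[of "a - x" "b - y"] by (simp add: lattice_coset_def algebra_simps)
next
  fix z assume "z \<in> lattice_coset Z2 (x + y)"
  then have "z = x + (z - x)" "z - x \<in> lattice_coset Z2 y" by (auto simp: lattice_coset_def algebra_simps)
  moreover have "x \<in> lattice_coset Z2 x" by (simp add: lattice_coset_def)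
  ultimately show "z \<in> lattice_coset Z2 x + lattice_coset Z2 y" by (metis set_plus_intro)
qed

lemma full_rank_lattice_Z2: "full_rank_lattice Z2"
  unfolding full_rank_lattice_def
proof (intro exI conjI)
  show "independent (Basis :: (real \<times> real) set)" by (rule independent_Basis)
  show "span (Basis :: (real \<times> real) set) = UNIV" by (rule span_Basis)
  have B: "(Basis :: (real \<times> real) set) = {(1, 0), (0, 1)}" by (auto simp: Basis_prod_def)
  show "Z2 = range (\<lambda>c :: real \<times> real \<Rightarrow> int. \<Sum>b\<in>Basis. of_int (c b) *\<^sub>R b)"
  proof (intro equalityI subsetI)
    fix z assume "z \<in> Z2"
    then obtain a b where z: "z = (of_int a, of_int b)" by (cases z) (auto simp: Z2_def Ints_def)
    show "z \<in> range (\<lambda>c :: real \<times> real \<Rightarrow> int. \<Sum>b\<in>Basis. of_int (c b) *\<^sub>R b)"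
      by (rule range_eqI[of _ _ "\<lambda>x. if x = (1, 0) then a else b"]) (simp add: B z)
  qed (auto simp: B Z2_def)
qed

text \<open>This interface separates the dynamics from Brun's algorithm: \<open>u\<close> is one
  reference word, \<open>dense\<close> expresses minimality of the translation, and
  \<open>bdd\<close> and \<open>area\<close> are the two facts that the arithmetic has to
  deliver.\<close>

locale toral_coding =
  fixes u :: "nat \<Rightarrow> 'i::finite" and \<tau> :: "'i \<Rightarrow> real \<times> real" and t0 :: "real \<times> real"
  assumes tau: "\<And>i. \<tau> i - t0 \<in> Z2"
    and bdd: "bounded (range (\<lambda>k. \<Sum>m<k. \<tau> (u m)))"
    and dense: "\<And>z e. e > 0 \<Longrightarrow> \<exists>n. \<exists>g\<in>Z2. norm (of_nat n *\<^sub>R t0 + g - z) < e"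
    and area: "(\<Sum>i\<in>UNIV. emeasure lborel (closure {\<Sum>m<k. \<tau> (u m) |k. u k = i})) \<le> 1"
begin

definition pos :: "(nat \<Rightarrow> 'i) \<Rightarrow> nat \<Rightarrow> real \<times> real" where
  "pos w k = (\<Sum>m<k. \<tau> (w m))"

definition piece :: "'i \<Rightarrow> (real \<times> real) set" where
  "piece i = closure {pos u k |k. u k = i}"

definition region :: "(real \<times> real) set" where
  "region = closure (range (pos u))"

text \<open>The one-sided orbit closure of \<open>u\<close>, phrased through finite windows so that
  it can be compared with \<open>sadic_words\<close>.\<close>

definition X :: "(nat \<Rightarrow> 'i) set" where
  "X = {w. \<forall>k l. \<exists>m. \<forall>j<l. w (k + j) = u (m + j)}"

definition coding :: "real \<times> real \<Rightarrow> (nat \<Rightarrow> 'i) \<Rightarrow> bool" where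
  "coding x w \<longleftrightarrow> (\<forall>n. x + pos w n \<in> piece (w n))"

lemma pos_0 [simp]: "pos w 0 = 0" and pos_Suc: "pos w (Suc k) = pos w k + \<tau> (w k)"
  by (simp_all add: pos_def)

lemma pos_congr: "pos w k - of_nat k *\<^sub>R t0 \<in> Z2"
proof -
  have "pos w k - of_nat k *\<^sub>R t0 = (\<Sum>m<k. \<tau> (w m) - t0)"
    by (simp add: pos_def sum_subtractf scaleR_conv_of_real sum_constant_scaleR)
  also have "\<dots> \<in> Z2" by (intro Z2_sum tau)
  finally show ?thesis .
qed

lemma pos_agree: "(\<And>j. j < l \<Longrightarrow> w j = u (m + j)) \<Longrightarrow> pos u (m + l) = pos u m + pos w l"
  by (induction l) (simp_all add: pos_Suc)

lemma bounded_pos: "bounded (range (pos u))"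
  using bdd by (simp add: pos_def[abs_def])

lemma compact_region [simp]: "compact region"
  unfolding region_def using bounded_pos by (simp add: compact_closure)

lemma piece_subset: "piece i \<subseteq> region"
  unfolding piece_def region_def by (intro closure_mono) auto

lemma closed_piece [simp]: "closed (piece i)"
  by (simp add: piece_def)

lemma compact_piece [simp]: "compact (piece i)"
  using compact_region closed_piece piece_subset
  by (metis compact_Int_closed inf.absorb_iff2)

lemma region_borel [measurable]: "region \<in> sets borel"
  by (rule borel_compact) simp

lemma piece_borel [measurable]: "piece i \<in> sets borel"
  by (rule borel_closed) simp

lemma pos_in_piece: "pos u k \<in> piece (u k)"
  unfolding piece_def by (rule subsetD[OF closure_subset]) auto

lemma region_eq: "region = (\<Union>i. piece i)"
proof -
  have "closed (\<Union>i. piece i)" by (intro closed_UN) auto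
  moreover have "range (pos u) \<subseteq> (\<Union>i. piece i)" using pos_in_piece by blast
  ultimately have "region \<subseteq> (\<Union>i. piece i)" unfolding region_def by (rule closure_minimal[rotated])
  then show ?thesis using piece_subset by blast
qed

lemma piece_step: "x \<in> piece i \<Longrightarrow> x + \<tau> i \<in> region"
proof -
  have "closed ((\<lambda>x. x + \<tau> i) -` region)"
    by (rule closed_vimage) (auto simp: compact_imp_closed intro!: continuous_intros)
  moreover have "{pos u k |k. u k = i} \<subseteq> (\<lambda>x. x + \<tau> i) -` region"
  proof
    fix x assume "x \<in> {pos u k |k. u k = i}"
    then obtain k where "x = pos u k" "u k = i" by blast
    then have "x + \<tau> i = pos u (Suc k)" by (simp add: pos_Suc)
    also have "\<dots> \<in> region" using pos_in_piece piece_subset by blast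
    finally show "x \<in> (\<lambda>x. x + \<tau> i) -` region" by simp
  qed
  ultimately have "piece i \<subseteq> (\<lambda>x. x + \<tau> i) -` region"
    unfolding piece_def by (rule closure_minimal[rotated])
  then show "x \<in> piece i \<Longrightarrow> x + \<tau> i \<in> region" by blast
qed

text \<open>Since \<open>s\<close> is bounded, only finitely many lattice translates of
  \<open>y\<close> can come near it. If all of them missed the closure, there would be a uniform
  gap, contradicting density of the multiples of \<open>t0\<close>. The lemma is stated for a
  general \<open>s\<close> because it serves both the walk of \<open>u\<close> and the walk of any
  coded word.\<close>

lemma cover_orbit:
  fixes s :: "nat \<Rightarrow> real \<times> real"
  assumes "bounded (range s)" and s: "\<And>n. s n - of_nat n *\<^sub>R t0 \<in> Z2"
  shows "\<exists>g\<in>Z2. y + g \<in> closure (range s)"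
proof (rule ccontr)
  assume no: "\<not> (\<exists>g\<in>Z2. y + g \<in> closure (range s))"
  obtain B where B: "\<And>n. norm (s n) \<le> B" using assms(1) bounded_iff by (metis rangeI)
  define G where "G = {g \<in> Z2. norm g \<le> B + 1 + norm y}"
  have "finite G" unfolding G_def by (rule finite_Z2_bounded)
  have "\<exists>e>0. \<forall>n. e \<le> dist (s n) (y + g)" if "g \<in> G" for g
    using no that unfolding closure_approachable G_def
    by (auto simp: not_less)
  then obtain e where e: "\<And>g. g \<in> G \<Longrightarrow> e g > 0 \<and> (\<forall>n. e g \<le> dist (s n) (y + g))" by metis
  \<comment> \<open>Bounding \<open>d\<close> by 1 ensures that the translate found below has norm
    at most \<open>B + 1 + norm y\<close> and so belongs to \<open>G\<close>.\<close>
  define d where "d = Min (insert 1 (e ` G))"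
  have d: "d > 0" "d \<le> 1" "\<And>g. g \<in> G \<Longrightarrow> d \<le> e g"
    unfolding d_def using \<open>finite G\<close> e by (auto simp: Min_gr_iff)
  obtain n g where g: "g \<in> Z2" "norm (of_nat n *\<^sub>R t0 + g - y) < d" using dense[OF d(1)] by blast
  define h where "h = s n - of_nat n *\<^sub>R t0 - g"
  have h: "h \<in> Z2" unfolding h_def using s g(1) by (rule Z2_diff)
  have "s n - (y + h) = of_nat n *\<^sub>R t0 + g - y" unfolding h_def by (simp add: algebra_simps)
  then have dh: "dist (s n) (y + h) < d" using g(2) by (simp only: dist_norm)
  have "norm h \<le> norm (s n) + norm (s n - (y + h)) + norm y"
  proof -
    have "h = s n - (s n - (y + h)) - y" by simp
    then have "norm h = norm (s n - (s n - (y + h)) - y)" by (rule arg_cong)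
    then show ?thesis
      using norm_triangle_ineq4[of "s n - (s n - (y + h))" y] norm_triangle_ineq4[of "s n" "s n - (y + h)"]
      by linarith
  qed
  also have "\<dots> \<le> B + 1 + norm y" using B[of n] dh d(2) by (simp add: dist_norm)
  finally have "h \<in> G" unfolding G_def using h by simp
  then have "d \<le> e h" "e h \<le> dist (s n) (y + h)" using d(3)[of h] e[of h] by simp_all
  then show False using dh by linarith
qed

lemma cover_region: "\<exists>g\<in>Z2. y + g \<in> region"
  unfolding region_def by (rule cover_orbit[OF bounded_pos pos_congr])

lemma coding_region: "coding x w \<Longrightarrow> x + pos w n \<in> region"
  using piece_subset by (auto simp only: coding_def)

lemma coding_bounded: "coding x w \<Longrightarrow> bounded (range (pos w))"
proof -
  assume "coding x w"
  then have "range (\<lambda>n. x + pos w n) \<subseteq> region"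
    using coding_region by (intro image_subsetI)
  then have "bounded (range (\<lambda>n. x + pos w n))"
    using bounded_subset compact_imp_bounded compact_region by blast
  then have "bounded ((\<lambda>z. - x + z) ` range (\<lambda>n. x + pos w n))" by (rule bounded_translation)
  then show ?thesis by (simp add: image_image)
qed

lemma emeasure_region: "emeasure lborel region \<le> 1"
proof -
  have "emeasure lborel region \<le> (\<Sum>i\<in>UNIV. emeasure lborel (piece i))"
    unfolding region_eq by (rule emeasure_subadditive_finite) auto
  also have "\<dots> \<le> 1" using area by (simp add: piece_def pos_def)
  finally show ?thesis .
qed

text \<open>The closed walk of the single word \<open>w\<close>, started at \<open>x\<close>,
  already covers the torus; having area at least one inside a region of area at most one, it fills
  the region up to a null set. The same walk started at \<open>x'\<close> also stays in the region,
  so translation by \<open>x' - x\<close> maps almost all of the bounded region into itself.\<close>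

lemma coding_unique:
  assumes "coding x w" "coding x' w"
  shows "x = x'"
proof (rule ccontr)
  assume "x \<noteq> x'"
  define Q where "Q = closure (range (pos w))"
  define Q' where "Q' = (+) x ` Q"
  have sub: "c + q \<in> region" if "coding c w" "q \<in> Q" for c q
  proof -
    have "closed ((\<lambda>z. c + z) -` region)"
      by (rule closed_vimage) (auto simp: compact_imp_closed intro!: continuous_intros)
    moreover have "range (pos w) \<subseteq> (\<lambda>z. c + z) -` region"
      using coding_region[OF that(1)] by (intro image_subsetI) (simp only: vimage_eq)
    ultimately have "Q \<subseteq> (\<lambda>z. c + z) -` region" unfolding Q_def by (rule closure_minimal[rotated])
    then show ?thesis using that(2) by blast
  qed
  have "compact Q" unfolding Q_def using coding_bounded[OF assms(1)] by (simp add: compact_closure)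
  then have Q'c: "compact Q'" unfolding Q'_def by (rule compact_translation)
  then have [measurable]: "Q' \<in> sets borel" by (rule borel_compact)
  have sub': "Q' \<subseteq> region" unfolding Q'_def using sub[OF assms(1)] by auto
  have "1 \<le> emeasure lborel Q'"
  proof (rule emeasure_ge_1_if_cover)
    fix y
    obtain g where "g \<in> Z2" "(y - x) + g \<in> Q"
      using cover_orbit[OF coding_bounded[OF assms(1)] pos_congr, of "y - x"] unfolding Q_def by blast
    then show "\<exists>g\<in>Z2. y + g \<in> Q'"
      unfolding Q'_def by (intro bexI[of _ g]) (auto simp: image_iff algebra_simps intro!: bexI[of _ "y - x + g"])
  qed simp
  moreover have "emeasure lborel Q' \<le> 1" using emeasure_mono[OF sub', of lborel] emeasure_region by simp
  ultimately have Q1: "emeasure lborel Q' = 1" by (rule antisym[rotated])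
  have "1 \<le> emeasure lborel region" using emeasure_mono[OF sub', of lborel] Q1 by simp
  then have region1: "emeasure lborel region = 1" using emeasure_region by (rule antisym[rotated])
  have "emeasure lborel (region - Q') = emeasure lborel region - emeasure lborel Q'"
    by (rule emeasure_Diff) (use sub' Q1 in simp_all)
  then have "emeasure lborel (region - Q') = 0" by (simp add: Q1 region1 diff_eq_0_iff_ennreal)
  then have "AE z in lborel. z \<notin> region - Q'"
    by (intro AE_not_in) (simp add: null_sets_def)
  then have "AE z in lborel. z \<in> region \<longrightarrow> z + (x' - x) \<in> region"
  proof (rule eventually_mono, intro impI)
    fix z assume "z \<notin> region - Q'" "z \<in> region"
    then obtain q where "q \<in> Q" "z = x + q" unfolding Q'_def by blast
    then show "z + (x' - x) \<in> region" using sub[OF assms(2), of q] by (simp add: algebra_simps)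
  qed
  then have "emeasure lborel region = 0"
    using \<open>x \<noteq> x'\<close> by (intro bounded_translate_invariant_null[of _ "x' - x"]) (auto simp: compact_imp_bounded)
  moreover have "1 \<le> emeasure lborel region" by (rule emeasure_ge_1_if_cover) (auto intro: cover_region)
  ultimately show False by simp
qed

text \<open>Longer and longer prefixes of \<open>w\<close> occur in \<open>u\<close>; any limit of
  the positions of these occurrences is a coding point, because the pieces are closed.\<close>

lemma coding_exists:
  assumes "w \<in> X"
  shows "\<exists>x. coding x w"
proof -
  have "\<forall>l. \<exists>m. \<forall>j<l. w j = u (m + j)" using assms unfolding X_def by (auto dest: spec[of _ 0])
  then obtain m where m: "\<And>l j. j < l \<Longrightarrow> w j = u (m l + j)" by metis
  have "\<forall>l. pos u (m l) \<in> region" using pos_in_piece piece_subset by blast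
  then obtain x r where r: "strict_mono (r :: nat \<Rightarrow> nat)" "((\<lambda>l. pos u (m l)) \<circ> r) \<longlonglongrightarrow> x"
    using compact_region unfolding compact_def by metis
  have "x + pos w n \<in> piece (w n)" for n
  proof (rule Lim_in_closed_set[OF closed_piece _ sequentially_bot])
    show "(\<lambda>l. pos u (m (r l)) + pos w n) \<longlonglongrightarrow> x + pos w n"
      using r(2) by (intro tendsto_add tendsto_const) (simp add: o_def)
    show "\<forall>\<^sub>F l in sequentially. pos u (m (r l)) + pos w n \<in> piece (w n)"
      using eventually_gt_at_top[of n]
    proof eventually_elim
      case (elim l)
      then have l: "n < r l" using seq_suble[OF r(1), of l] by simp
      have "pos u (m (r l)) + pos w n = pos u (m (r l) + n)"
        by (rule pos_agree[symmetric]) (use m[of _ "r l"] l in simp)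
      moreover have "w n = u (m (r l) + n)" using m l by simp
      ultimately show ?case using pos_in_piece by simp
    qed
  qed
  then show ?thesis unfolding coding_def by blast
qed

end

section \<open>Invariant measures of a dense toral translation\<close>

lemma nn_integral_periodic_translate:
  fixes f :: "real \<times> real \<Rightarrow> ennreal"
  assumes [measurable]: "f \<in> borel_measurable borel"
    and per: "\<And>x g. g \<in> Z2 \<Longrightarrow> f (x + g) = f x"
  shows "(\<integral>\<^sup>+x. indicator unit_sq x * f (x + y) \<partial>lborel) = (\<integral>\<^sup>+x. indicator unit_sq x * f x \<partial>lborel)"
proof -
  have [measurable]: "unit_sq \<in> sets borel" by (rule unit_sq_borel)
  have "(\<integral>\<^sup>+x. indicator unit_sq x * f (x + y) \<partial>lborel) = (\<integral>\<^sup>+x. indicator unit_sq (x + - y) * f x \<partial>lborel)"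
    using lborel_translate[of "\<lambda>x. indicator unit_sq (x + - y) * f x" y] by simp
  also have "\<dots> = (\<integral>\<^sup>+x. indicator unit_sq x *
      (\<integral>\<^sup>+g. indicator unit_sq (x + g + - y) * f (x + g) \<partial>count_space Z2) \<partial>lborel)"
    by (rule nn_integral_unfold_Z2) measurable
  also have "\<dots> = (\<integral>\<^sup>+x. indicator unit_sq x * f x \<partial>lborel)"
  proof (rule nn_integral_cong)
    fix x
    have "(\<integral>\<^sup>+g. indicator unit_sq (x + g + - y) * f (x + g) \<partial>count_space Z2)
        = (\<integral>\<^sup>+g. indicator {g. x + - y + g \<in> unit_sq} g * f x \<partial>count_space Z2)"
    proof (rule nn_integral_cong)
      fix g :: "real \<times> real" assume "g \<in> space (count_space Z2)"
      then have g: "f (x + g) = f x" using per by simp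
      have *: "x + g + - y = x + - y + g" by (simp add: algebra_simps)
      show "indicator unit_sq (x + g + - y) * f (x + g) = indicator {g. x + - y + g \<in> unit_sq} g * f x"
        unfolding * g by (simp only: indicator_def mem_Collect_eq)
    qed
    also have "\<dots> = f x"
      by (subst nn_integral_multc) (simp_all add: nn_integral_count_ex1[OF unit_sq_ex1])
    finally show "indicator unit_sq x * (\<integral>\<^sup>+g. indicator unit_sq (x + g + - y) * f (x + g) \<partial>count_space Z2)
        = indicator unit_sq x * f x" by simp
  qed
  finally show ?thesis .
qed

lemma open_translate_vimage: "open O1 \<Longrightarrow> open {y::'a::real_normed_vector. y + s \<in> O1}"
  by (rule open_vimage[unfolded vimage_def]) (auto intro!: continuous_intros)

text \<open>Density extends the invariance to all translations, and averaging over these identifies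
  the measure. Only open periodic sets are treated along the way: their indicators are lower
  semicontinuous, which suits Fatou's lemma, and the open sets generate the Borel sets.\<close>

lemma translation_invariant_unit_sq:
  fixes N :: "(real \<times> real) measure" and t0 :: "real \<times> real"
  assumes "prob_space N" and sets_N [measurable_cong]: "sets N = sets borel"
    and inv: "\<And>E. open E \<Longrightarrow> (\<And>y g. g \<in> Z2 \<Longrightarrow> y + g \<in> E \<longleftrightarrow> y \<in> E) \<Longrightarrow>
        emeasure N {y. y + t0 \<in> E} = emeasure N E"
    and N_sq: "AE y in N. y \<in> unit_sq"
    and dense: "\<And>z e. e > 0 \<Longrightarrow> \<exists>n. \<exists>g\<in>Z2. norm (of_nat n *\<^sub>R t0 + g - z) < e"
  shows "N = density lborel (indicator unit_sq)"
proof -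
  interpret prob_space N by fact
  have [measurable]: "unit_sq \<in> sets borel" by (rule unit_sq_borel)
  have space_N: "space N = UNIV" using sets_eq_imp_space_eq[OF sets_N] by simp
  define per where "per E \<longleftrightarrow> (\<forall>y. \<forall>g\<in>Z2. y + g \<in> E \<longleftrightarrow> y \<in> E)" for E :: "(real \<times> real) set"
  have per_shift: "per {y. y + s \<in> E}" if "per E" for E s
    unfolding per_def
  proof (intro allI ballI)
    fix y g assume "g \<in> Z2"
    moreover have "y + g + s = y + s + g" by (simp add: algebra_simps)
    ultimately show "y + g \<in> {y. y + s \<in> E} \<longleftrightarrow> y \<in> {y. y + s \<in> E}"
      using that by (simp only: per_def mem_Collect_eq)
  qed
  have shift_int: "emeasure N {y. y + s \<in> E} = (\<integral>\<^sup>+y. indicator E (y + s) \<partial>N)" if [measurable]: "E \<in> sets borel" for E s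
  proof -
    have "{y. y + s \<in> E} \<in> sets borel" by measurable
    moreover have "(\<lambda>y. indicator E (y + s)) = (indicator {y. y + s \<in> E} :: _ \<Rightarrow> ennreal)"
      by (simp only: indicator_def mem_Collect_eq fun_eq_iff simp_thms)
    ultimately show ?thesis by (simp add: sets_N)
  qed
  have inv_nat: "emeasure N {y. y + of_nat n *\<^sub>R t0 \<in> E} = emeasure N E" if "open E" "per E" for E n
    using that
  proof (induction n arbitrary: E)
    case (Suc n)
    let ?E = "{y. y + t0 \<in> E}"
    have "emeasure N {y. y + of_nat n *\<^sub>R t0 \<in> ?E} = emeasure N ?E"
      using Suc by (intro Suc.IH open_translate_vimage per_shift)
    also have "\<dots> = emeasure N E" using Suc.prems by (intro inv) (auto simp: per_def)
    finally show ?case by (simp add: algebra_simps)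
  qed simp
  \<comment> \<open>Approximate \<open>s\<close> by lattice translates of multiples of
    \<open>t0\<close>, for which equality is known, and apply Fatou's lemma. Applying the inequality
    to \<open>- s\<close> gives the converse.\<close>
  have le: "emeasure N {y. y + s \<in> E} \<le> emeasure N E" if E: "open E" "per E" for E s
  proof -
    have [measurable]: "E \<in> sets borel" using E by (rule_tac borel_open)
    have "\<forall>k. \<exists>n. \<exists>g\<in>Z2. norm (of_nat n *\<^sub>R t0 + g - s) < 1 / Suc k" using dense by simp
    then obtain n g where ng: "\<And>k. g k \<in> Z2" "\<And>k. norm (of_nat (n k) *\<^sub>R t0 + g k - s) < 1 / Suc k" by metis
    define s' where "s' k = of_nat (n k) *\<^sub>R t0 + g k" for k
    have "(\<lambda>k. s' k - s) \<longlonglongrightarrow> 0"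
      by (rule LIMSEQ_norm_0) (use ng(2) in \<open>simp only: s'_def\<close>)
    then have lim: "s' \<longlonglongrightarrow> s" by (rule LIM_zero_cancel)
    have eqk: "emeasure N {y. y + s' k \<in> E} = emeasure N E" for k
    proof -
      have "{y. y + s' k \<in> E} = {y. y + of_nat (n k) *\<^sub>R t0 \<in> E}"
        using E(2) ng(1)[of k] unfolding per_def s'_def by (simp only: add.assoc[symmetric])
      then show ?thesis using inv_nat[OF E] by simp
    qed
    have "emeasure N {y. y + s \<in> E} = (\<integral>\<^sup>+y. indicator E (y + s) \<partial>N)"
      by (rule shift_int) measurable
    also have "\<dots> \<le> (\<integral>\<^sup>+y. liminf (\<lambda>k. indicator E (y + s' k)) \<partial>N)"
    proof (intro nn_integral_mono)
      fix y
      show "indicator E (y + s) \<le> liminf (\<lambda>k. indicator E (y + s' k) :: ennreal)"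
      proof (cases "y + s \<in> E")
        case True
        have "(\<lambda>k. y + s' k) \<longlonglongrightarrow> y + s" by (intro tendsto_intros lim)
        then have "eventually (\<lambda>k. y + s' k \<in> E) sequentially"
          using E(1) True by (rule topological_tendstoD)
        then show ?thesis using True
          by (intro Liminf_bounded) (auto elim!: eventually_mono)
      qed simp
    qed
    also have "\<dots> \<le> liminf (\<lambda>k. \<integral>\<^sup>+y. indicator E (y + s' k) \<partial>N)"
      by (rule nn_integral_liminf) measurable
    also have "(\<lambda>k. \<integral>\<^sup>+y. indicator E (y + s' k) \<partial>N) = (\<lambda>k. emeasure N {y. y + s' k \<in> E})"
      by (intro ext shift_int[symmetric]) measurable
    also have "liminf \<dots> = emeasure N E" by (simp add: eqk Liminf_const)
    finally show ?thesis .
  qed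
  have eq: "emeasure N {y. y + s \<in> E} = emeasure N E" if E: "open E" "per E" for E s
  proof (rule antisym)
    let ?E = "{y. y + s \<in> E}"
    have "emeasure N {y. y + - s \<in> ?E} \<le> emeasure N ?E"
      using E by (intro le open_translate_vimage per_shift)
    then show "emeasure N E \<le> emeasure N ?E" by (simp add: algebra_simps)
  qed (rule le[OF E])
  \<comment> \<open>Integrate the invariance over \<open>s\<close> in the unit square and exchange
    the integrals: for every fixed \<open>y\<close> the inner integral is the Lebesgue measure of
    one period of \<open>E\<close>.\<close>
  have periodic: "emeasure N E = emeasure lborel (unit_sq \<inter> E)" if E: "open E" "per E" for E
  proof -
    have [measurable]: "E \<in> sets borel" using E by (rule_tac borel_open)
    interpret pair_sigma_finite lborel N ..
    have "emeasure N E = (\<integral>\<^sup>+s. indicator unit_sq s * emeasure N E \<partial>lborel)"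
      by (subst nn_integral_multc) (auto simp: emeasure_unit_sq)
    also have "\<dots> = (\<integral>\<^sup>+s. \<integral>\<^sup>+y. indicator unit_sq s * indicator E (y + s) \<partial>N \<partial>lborel)"
    proof (intro nn_integral_cong)
      fix s
      have "emeasure N E = (\<integral>\<^sup>+y. indicator E (y + s) \<partial>N)"
        unfolding eq[OF E, of s, symmetric]
        by (rule shift_int) measurable
      then show "indicator unit_sq s * emeasure N E = (\<integral>\<^sup>+y. indicator unit_sq s * indicator E (y + s) \<partial>N)"
        by (simp add: nn_integral_cmult)
    qed
    also have "\<dots> = (\<integral>\<^sup>+y. \<integral>\<^sup>+s. indicator unit_sq s * indicator E (y + s) \<partial>lborel \<partial>N)"
      by (rule Fubini'[symmetric]) measurable
    also have "\<dots> = (\<integral>\<^sup>+y. emeasure lborel (unit_sq \<inter> E) \<partial>N)"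
    proof (intro nn_integral_cong)
      fix y
      have "(\<integral>\<^sup>+s. indicator unit_sq s * indicator E (s + y) \<partial>lborel) = (\<integral>\<^sup>+s. indicator unit_sq s * indicator E s \<partial>lborel)"
        by (rule nn_integral_periodic_translate) (use E(2) in \<open>auto simp: per_def indicator_def\<close>)
      also have "\<dots> = emeasure lborel (unit_sq \<inter> E)"
        unfolding indicator_inter_arith[symmetric] by (rule nn_integral_indicator) simp
      finally show "(\<integral>\<^sup>+s. indicator unit_sq s * indicator E (y + s) \<partial>lborel) = emeasure lborel (unit_sq \<inter> E)"
        by (simp add: add.commute)
    qed
    also have "\<dots> = emeasure lborel (unit_sq \<inter> E)" by (simp add: emeasure_space_1)
    finally show ?thesis .
  qed
  let ?V = "{0<..<1} \<times> {0<..<1} :: (real \<times> real) set"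
  \<comment> \<open>The union of all lattice translates of the trace of \<open>E\<close> on the open
    square is open and periodic, and it meets the unit square in exactly this trace. The open square
    is used because the half-open one would not give an open set.\<close>
  have inner: "emeasure N (E \<inter> ?V) = emeasure lborel (E \<inter> ?V)" if E: "open E" for E
  proof -
    have [measurable]: "E \<inter> ?V \<in> sets borel" using E by (intro borel_open open_Int open_Times) auto
    define F where "F = (\<Union>g\<in>Z2. {y. y + g \<in> E \<inter> ?V})"
    have oF: "open F" unfolding F_def using E
      by (intro open_UN ballI open_translate_vimage open_Int open_Times) auto
    then have [measurable]: "F \<in> sets borel" by (rule borel_open)
    have "per F" unfolding per_def F_def
    proof (intro allI ballI)
      fix y h assume h: "h \<in> Z2"
      have "(\<exists>g\<in>Z2. y + h + g \<in> E \<inter> ?V) \<longleftrightarrow> (\<exists>g\<in>Z2. y + g \<in> E \<inter> ?V)"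
      proof
        assume "\<exists>g\<in>Z2. y + h + g \<in> E \<inter> ?V"
        then obtain g where "g \<in> Z2" "y + h + g \<in> E \<inter> ?V" by (rule bexE)
        then show "\<exists>g\<in>Z2. y + g \<in> E \<inter> ?V"
          using h by (intro bexI[of _ "h + g"] Z2_add) (simp_all only: add.assoc)
      next
        assume "\<exists>g\<in>Z2. y + g \<in> E \<inter> ?V"
        then obtain g where "g \<in> Z2" "y + g \<in> E \<inter> ?V" by (rule bexE)
        moreover have "y + h + (g - h) = y + g" by simp
        ultimately show "\<exists>g\<in>Z2. y + h + g \<in> E \<inter> ?V"
          using h by (intro bexI[of _ "g - h"] Z2_diff) (simp_all only:)
      qed
      then show "(y + h \<in> (\<Union>g\<in>Z2. {y. y + g \<in> E \<inter> ?V})) = (y \<in> (\<Union>g\<in>Z2. {y. y + g \<in> E \<inter> ?V}))"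
        by (simp only: UN_iff mem_Collect_eq)
    qed
    have V_sub: "?V \<subseteq> unit_sq" by auto
    have Fsq: "unit_sq \<inter> F = E \<inter> ?V"
    proof (intro equalityI subsetI)
      fix y assume y: "y \<in> unit_sq \<inter> F"
      then obtain g where g: "g \<in> Z2" "y + g \<in> E \<inter> ?V" unfolding F_def by (simp only: UN_iff mem_Collect_eq Int_iff) metis
      have "y + g \<in> unit_sq" by (rule subsetD[OF V_sub]) (use g(2) in \<open>simp only: Int_iff\<close>)
      then have "g = 0" using unit_sq_unique[of g 0 y] g(1) y by simp
      then show "y \<in> E \<inter> ?V" using g by simp
    next
      fix y assume y: "y \<in> E \<inter> ?V"
      then have "y \<in> F" unfolding F_def by (intro UN_I[of 0]) simp_all
      then show "y \<in> unit_sq \<inter> F" using y V_sub by blast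
    qed
    have "emeasure N (E \<inter> ?V) = emeasure N F"
    proof (rule emeasure_eq_AE)
      show "AE x in N. x \<in> E \<inter> ?V \<longleftrightarrow> x \<in> F"
        using N_sq unfolding Fsq[symmetric] by eventually_elim blast
    qed (auto simp: sets_N)
    also have "\<dots> = emeasure lborel (E \<inter> ?V)" unfolding Fsq[symmetric] by (rule periodic[OF oF \<open>per F\<close>])
    finally show ?thesis .
  qed
  have [measurable]: "?V \<in> sets borel" by (intro borel_open open_Times) auto
  have V1: "emeasure lborel ?V = 1"
    using lborel.emeasure_pair_measure_Times[of "{0<..<1::real}" lborel "{0<..<1::real}"]
    by (simp add: lborel_prod)
  \<comment> \<open>The case of the whole plane shows that \<open>N\<close> does not charge the
    boundary of the square.\<close>
  then have "emeasure N ?V = 1" using inner[of UNIV] by simp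
  then have aeV: "AE x in N. x \<in> ?V" by (intro AE_prob_1) (simp add: measure_def)
  have V_sub: "?V \<subseteq> unit_sq" by (intro Sigma_mono) auto
  then have "emeasure lborel (unit_sq - ?V) = 0"
    using emeasure_Diff[of lborel ?V unit_sq] V1 emeasure_unit_sq by simp
  then have "AE x in lborel. x \<notin> unit_sq - ?V" by (intro AE_not_in) (simp add: null_sets_def)
  then have aeL: "AE x in lborel. x \<in> unit_sq \<longleftrightarrow> x \<in> ?V" by eventually_elim (use V_sub in blast)
  have opens: "emeasure N E = emeasure (density lborel (indicator unit_sq)) E" if E: "open E" for E
  proof -
    have [measurable]: "E \<in> sets borel" using E by (rule borel_open)
    have "emeasure N E = emeasure N (E \<inter> ?V)"
      by (rule emeasure_eq_AE) (use aeV in \<open>auto simp: sets_N\<close>)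
    also have "\<dots> = emeasure lborel (E \<inter> ?V)" by (rule inner[OF E])
    also have "\<dots> = emeasure lborel (unit_sq \<inter> E)"
      by (rule emeasure_eq_AE) (use aeL in \<open>auto elim!: eventually_mono\<close>)
    also have "\<dots> = emeasure (density lborel (indicator unit_sq)) E"
      by (rule emeasure_restricted[symmetric]) auto
    finally show ?thesis .
  qed
  show ?thesis
  proof (rule measure_eqI_generator_eq[where E = "{S. open S}" and \<Omega> = UNIV and A = "\<lambda>_. UNIV"])
    show "Int_stable {S :: (real \<times> real) set. open S}" by (auto simp: Int_stable_def)
    show "emeasure N UNIV \<noteq> \<infinity>" by simp
  qed (auto simp: opens sets_N borel_def)
qed

section \<open>The torus as a measure space, with the unit square as a section\<close>

lemma sets_torus_borel:
  "sets (torus_borel Z2) = {A. A \<subseteq> torus_points Z2 \<and> lattice_coset Z2 -` A \<in> sets borel}"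
proof -
  let ?S = "{A. A \<subseteq> torus_points Z2 \<and> lattice_coset Z2 -` A \<in> sets borel}"
  have "sigma_algebra (torus_points Z2) ?S"
    unfolding sigma_algebra_iff2
  proof (intro conjI ballI allI impI)
    fix A assume A: "A \<in> ?S"
    have "lattice_coset Z2 -` (torus_points Z2 - A) = UNIV - lattice_coset Z2 -` A"
      by (auto simp: torus_points_def)
    also have "\<dots> \<in> sets borel" using A by (intro sets.Diff) auto
    finally show "torus_points Z2 - A \<in> ?S" by auto
  next
    fix A :: "nat \<Rightarrow> _" assume A: "range A \<subseteq> ?S"
    have "lattice_coset Z2 -` (\<Union>i. A i) = (\<Union>i. lattice_coset Z2 -` A i)" by auto
    also have "\<dots> \<in> sets borel" using A by (intro sets.countable_UN) auto
    finally show "(\<Union>i. A i) \<in> ?S" using A by auto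
  qed auto
  then show ?thesis
    unfolding torus_borel_def by (subst sets_measure_of) (auto simp: sigma_algebra.sigma_sets_eq)
qed

lemma space_torus_borel [simp]: "space (torus_borel Z2) = torus_points Z2"
  unfolding torus_borel_def by (rule space_measure_of) auto

lemma coset_in_points [simp]: "lattice_coset Z2 y \<in> torus_points Z2"
  by (simp add: torus_points_def)

lemma measurable_lattice_coset [measurable]: "lattice_coset Z2 \<in> borel \<rightarrow>\<^sub>M torus_borel Z2"
  by (rule measurableI) (auto simp: sets_torus_borel)

lemma lattice_coset_period: "g \<in> Z2 \<Longrightarrow> lattice_coset Z2 (y + g) = lattice_coset Z2 y"
  by (simp add: lattice_coset_eq_iff)

lemma measurable_torus_translate [measurable]:
  "(\<lambda>c. lattice_coset Z2 t0 + c) \<in> torus_borel Z2 \<rightarrow>\<^sub>M torus_borel Z2"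
proof (rule measurableI)
  fix c assume "c \<in> space (torus_borel Z2)"
  then show "lattice_coset Z2 t0 + c \<in> space (torus_borel Z2)"
    by (auto simp: torus_points_def lattice_coset_add)
next
  fix A assume A: "A \<in> sets (torus_borel Z2)"
  have "lattice_coset Z2 -` ((\<lambda>c. lattice_coset Z2 t0 + c) -` A \<inter> torus_points Z2)
      = {y. y + t0 \<in> lattice_coset Z2 -` A}"
    by (simp add: vimage_def lattice_coset_add add.commute)
  also have "\<dots> \<in> sets borel"
  proof -
    have [measurable]: "lattice_coset Z2 -` A \<in> sets borel" using A by (simp add: sets_torus_borel)
    show ?thesis by measurable
  qed
  finally show "(\<lambda>c. lattice_coset Z2 t0 + c) -` A \<inter> space (torus_borel Z2) \<in> sets (torus_borel Z2)"
    by (simp add: sets_torus_borel)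
qed

lemma torus2_eq: "torus2 = distr (density lborel (indicator unit_sq)) (torus_borel Z2) (lattice_coset Z2)"
proof (rule measure_eqI)
  fix A assume "A \<in> sets torus2"
  then have A [measurable]: "A \<in> sets (torus_borel Z2)" by (simp add: torus2_def)
  then have [measurable]: "lattice_coset Z2 -` A \<in> sets borel" by (simp add: sets_torus_borel)
  have [measurable]: "lattice_coset Z2 \<in> restrict_space lborel unit_sq \<rightarrow>\<^sub>M torus_borel Z2"
    by (rule measurable_restrict_space1) simp
  have "emeasure torus2 A = emeasure lborel (lattice_coset Z2 -` A \<inter> unit_sq)"
    unfolding torus2_def
    by (subst emeasure_distr) (auto simp: space_restrict_space emeasure_restrict_space)
  also have "\<dots> = emeasure (distr (density lborel (indicator unit_sq)) (torus_borel Z2) (lattice_coset Z2)) A"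
    by (subst emeasure_distr) (auto simp: emeasure_restricted Int_commute)
  finally show "emeasure torus2 A = emeasure (distr (density lborel (indicator unit_sq)) (torus_borel Z2) (lattice_coset Z2)) A" .
qed (simp add: torus2_def)

lemma sets_torus2 [simp, measurable_cong]: "sets torus2 = sets (torus_borel Z2)"
  by (simp add: torus2_def)

lemma space_torus2 [simp]: "space torus2 = torus_points Z2"
  by (simp add: torus2_def)

lemma emeasure_torus2:
  "A \<in> sets (torus_borel Z2) \<Longrightarrow> emeasure torus2 A = emeasure lborel (unit_sq \<inter> lattice_coset Z2 -` A)"
  unfolding torus2_eq by (subst emeasure_distr) (auto simp: emeasure_restricted sets_torus_borel)

lemma prob_space_torus2: "prob_space torus2"
proof
  have "torus_points Z2 \<in> sets (torus_borel Z2)" using sets.top[of "torus_borel Z2"] by simp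
  then have "emeasure torus2 (torus_points Z2) = emeasure lborel (unit_sq \<inter> lattice_coset Z2 -` torus_points Z2)"
    by (rule emeasure_torus2)
  also have "unit_sq \<inter> lattice_coset Z2 -` torus_points Z2 = unit_sq" by auto
  finally show "emeasure torus2 (space torus2) = 1" by (simp add: emeasure_unit_sq)
qed

lemma torus2_translation_invariant: "distr torus2 torus2 (\<lambda>c. lattice_coset Z2 t0 + c) = torus2"
proof (rule measure_eqI)
  fix A assume "A \<in> sets (distr torus2 torus2 (\<lambda>c. lattice_coset Z2 t0 + c))"
  then have A [measurable]: "A \<in> sets (torus_borel Z2)" by simp
  define E where "E = lattice_coset Z2 -` A"
  have E [measurable]: "E \<in> sets borel" using A by (simp add: sets_torus_borel E_def)
  have B: "(\<lambda>c. lattice_coset Z2 t0 + c) -` A \<inter> torus_points Z2 \<in> sets (torus_borel Z2)"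
    using measurable_sets[OF measurable_torus_translate A] by simp
  have "emeasure (distr torus2 torus2 (\<lambda>c. lattice_coset Z2 t0 + c)) A
      = emeasure torus2 ((\<lambda>c. lattice_coset Z2 t0 + c) -` A \<inter> torus_points Z2)"
    by (subst emeasure_distr) auto
  also have "\<dots> = emeasure lborel (unit_sq \<inter> {y. y + t0 \<in> E})"
    unfolding emeasure_torus2[OF B] by (simp add: vimage_def lattice_coset_add add.commute E_def)
  also have "\<dots> = (\<integral>\<^sup>+y. indicator (unit_sq \<inter> {y. y + t0 \<in> E}) y \<partial>lborel)"
    by (rule nn_integral_indicator[symmetric]) measurable
  also have "\<dots> = (\<integral>\<^sup>+y. indicator unit_sq y * indicator E (y + t0) \<partial>lborel)"
    by (simp add: indicator_inter_arith) (simp add: indicator_def)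
  also have "\<dots> = (\<integral>\<^sup>+y. indicator unit_sq y * indicator E y \<partial>lborel)"
    by (rule nn_integral_periodic_translate) (simp_all add: E_def indicator_def lattice_coset_period)
  also have "\<dots> = emeasure lborel (unit_sq \<inter> E)"
    unfolding indicator_inter_arith[symmetric] by (rule nn_integral_indicator) simp
  also have "\<dots> = emeasure torus2 A" by (simp add: emeasure_torus2[OF A] E_def)
  finally show "emeasure (distr torus2 torus2 (\<lambda>c. lattice_coset Z2 t0 + c)) A = emeasure torus2 A" .
qed simp

definition sec :: "(real \<times> real) set \<Rightarrow> real \<times> real" where
  "sec c = (THE y. y \<in> unit_sq \<and> lattice_coset Z2 y = c)"

lemma sec_coset: "g \<in> Z2 \<Longrightarrow> y + g \<in> unit_sq \<Longrightarrow> sec (lattice_coset Z2 y) = y + g"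
  unfolding sec_def
proof (rule the_equality)
  fix z assume g: "g \<in> Z2" "y + g \<in> unit_sq" and z: "z \<in> unit_sq \<and> lattice_coset Z2 z = lattice_coset Z2 y"
  then have "z - y \<in> Z2" by (simp add: lattice_coset_eq_iff)
  then have "g = z - y" using g z by (intro unit_sq_unique[of _ _ y]) simp_all
  then show "z = y + g" by simp
qed (simp add: lattice_coset_period)

lemma sec_cosetE:
  obtains g where "g \<in> Z2" "y + g \<in> unit_sq" "sec (lattice_coset Z2 y) = y + g"
proof -
  obtain g where "g \<in> Z2" "y + g \<in> unit_sq" using unit_sq_ex[of y] by (rule bexE)
  then show ?thesis using that sec_coset by simp
qed

lemma sec_in: "c \<in> torus_points Z2 \<Longrightarrow> sec c \<in> unit_sq"
proof -
  assume "c \<in> torus_points Z2"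
  then obtain y where y: "c = lattice_coset Z2 y" by (auto simp: torus_points_def)
  obtain g where "g \<in> Z2" "y + g \<in> unit_sq" "sec (lattice_coset Z2 y) = y + g" by (rule sec_cosetE)
  then show ?thesis by (simp only: y)
qed

lemma coset_sec: "c \<in> torus_points Z2 \<Longrightarrow> lattice_coset Z2 (sec c) = c"
proof -
  assume "c \<in> torus_points Z2"
  then obtain y where y: "c = lattice_coset Z2 y" by (auto simp: torus_points_def)
  obtain g where "g \<in> Z2" "y + g \<in> unit_sq" "sec (lattice_coset Z2 y) = y + g" by (rule sec_cosetE)
  then show ?thesis by (simp only: y lattice_coset_period)
qed

lemma measurable_sec [measurable]: "sec \<in> torus_borel Z2 \<rightarrow>\<^sub>M borel"
proof (rule measurableI)
  fix E :: "(real \<times> real) set" assume [measurable]: "E \<in> sets borel"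
  have "lattice_coset Z2 -` (sec -` E \<inter> torus_points Z2) = (\<Union>g\<in>Z2. {y. y + g \<in> unit_sq \<inter> E})"
  proof (intro equalityI subsetI)
    fix y assume y: "y \<in> lattice_coset Z2 -` (sec -` E \<inter> torus_points Z2)"
    obtain g where "g \<in> Z2" "y + g \<in> unit_sq" "sec (lattice_coset Z2 y) = y + g" by (rule sec_cosetE)
    then show "y \<in> (\<Union>g\<in>Z2. {y. y + g \<in> unit_sq \<inter> E})" using y by (intro UN_I[of g]) simp_all
  next
    fix y assume "y \<in> (\<Union>g\<in>Z2. {y. y + g \<in> unit_sq \<inter> E})"
    then obtain g where "g \<in> Z2" "y + g \<in> unit_sq \<inter> E" by (rule UN_E) (rule that, simp_all)
    then show "y \<in> lattice_coset Z2 -` (sec -` E \<inter> torus_points Z2)" using sec_coset[of g y] by simp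
  qed
  also have "\<dots> \<in> sets borel"
    by (intro sets.countable_UN'[OF countable_Z2] borel_translate_pred[unfolded pred_def, simplified] sets.Int) auto
  finally show "sec -` E \<inter> space (torus_borel Z2) \<in> sets (torus_borel Z2)"
    by (simp add: sets_torus_borel)
qed simp

text \<open>The section \<open>sec\<close> transports the question to the unit square. It does not
  commute with the translation, but the defect lies in the lattice, hence is invisible to periodic
  sets.\<close>

lemma translation_invariant_torus2:
  assumes "prob_space N" and sets_N [measurable_cong]: "sets N = sets (torus_borel Z2)"
    and inv: "distr N N (\<lambda>c. lattice_coset Z2 t0 + c) = N"
    and dense: "\<And>z e. e > 0 \<Longrightarrow> \<exists>n. \<exists>g\<in>Z2. norm (of_nat n *\<^sub>R t0 + g - z) < e"
  shows "N = torus2"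
proof -
  interpret prob_space N by fact
  have space_N: "space N = torus_points Z2" using sets_eq_imp_space_eq[OF sets_N] by simp
  define N' where "N' = distr N borel sec"
  have "N' = density lborel (indicator unit_sq)"
  proof (rule translation_invariant_unit_sq[OF _ _ _ _ dense])
    show "prob_space N'" unfolding N'_def by (rule prob_space_distr) measurable
    show "sets N' = sets borel" by (simp add: N'_def)
    show "AE y in N'. y \<in> unit_sq"
      unfolding N'_def by (subst AE_distr_iff) (use space_N sec_in in \<open>auto intro!: AE_I2\<close>)
    fix E :: "(real \<times> real) set" assume E: "open E" and per: "\<And>y g. g \<in> Z2 \<Longrightarrow> y + g \<in> E \<longleftrightarrow> y \<in> E"
    have [measurable]: "E \<in> sets borel" using E by (rule borel_open)
    have eq: "sec c + t0 \<in> E \<longleftrightarrow> sec (lattice_coset Z2 t0 + c) \<in> E" if "c \<in> torus_points Z2" for c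
    proof -
      have "lattice_coset Z2 t0 + c = lattice_coset Z2 (sec c + t0)"
        using coset_sec[OF that] lattice_coset_add[of t0 "sec c"] by (simp add: add.commute)
      moreover obtain g where "g \<in> Z2" "sec (lattice_coset Z2 (sec c + t0)) = sec c + t0 + g" by (rule sec_cosetE)
      ultimately show ?thesis using per by simp
    qed
    have "emeasure N' {y. y + t0 \<in> E} = emeasure N {c \<in> torus_points Z2. sec c + t0 \<in> E}"
      unfolding N'_def by (subst emeasure_distr) (auto simp: space_N intro!: arg_cong[where f = "emeasure N"])
    also have "{c \<in> torus_points Z2. sec c + t0 \<in> E}
        = (\<lambda>c. lattice_coset Z2 t0 + c) -` (sec -` E \<inter> torus_points Z2) \<inter> torus_points Z2"
      using eq measurable_space[OF measurable_torus_translate, of _ t0] by auto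
    also have "emeasure N \<dots> = emeasure (distr N N (\<lambda>c. lattice_coset Z2 t0 + c)) (sec -` E \<inter> torus_points Z2)"
      using measurable_sets[OF measurable_sec \<open>E \<in> sets borel\<close>]
      by (subst emeasure_distr) (auto simp: space_N sets_N)
    also have "\<dots> = emeasure N (sec -` E \<inter> space N)" by (simp add: inv space_N)
    also have "\<dots> = emeasure N' E" unfolding N'_def by (subst emeasure_distr) auto
    finally show "emeasure N' {y. y + t0 \<in> E} = emeasure N' E" .
  qed
  then have "torus2 = distr N' (torus_borel Z2) (lattice_coset Z2)" by (simp add: torus2_eq)
  also have "\<dots> = distr N (torus_borel Z2) (lattice_coset Z2 \<circ> sec)"
    unfolding N'_def by (rule distr_distr) measurable
  also have "\<dots> = distr N (torus_borel Z2) (\<lambda>c. c)"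
    by (rule distr_cong) (auto simp: space_N coset_sec)
  also have "\<dots> = N" using sets_N by (intro distr_id2) simp
  finally show ?thesis ..
qed

text \<open>The predicate need not be measurable. Its failures form a periodic set in the plane, so
  together with \<open>N\<close> they lie in the intersection of all lattice translates of
  \<open>N\<close>, and this Borel set descends to the torus.\<close>

lemma AE_torus2I:
  assumes "AE y in lborel. P (lattice_coset Z2 y)"
  shows "AE c in torus2. P c"
proof -
  from assms obtain N where N: "{y. \<not> P (lattice_coset Z2 y)} \<subseteq> N" "emeasure lborel N = 0" "N \<in> sets borel"
    by (auto elim!: AE_E)
  have [measurable]: "N \<in> sets borel" by fact
  define C where "C = {c \<in> torus_points Z2. \<forall>g\<in>Z2. sec c + g \<in> N}"
  have "C = sec -` (\<Inter>g\<in>Z2. {y. y + g \<in> N}) \<inter> space (torus_borel Z2)"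
    by (simp only: C_def vimage_def INT_iff mem_Collect_eq space_torus_borel Int_def) (simp only: conj_commute)
  also have "\<dots> \<in> sets (torus_borel Z2)"
    by (intro measurable_sets[OF measurable_sec] sets.countable_INT'[OF countable_Z2]
        borel_translate_pred[unfolded pred_def, simplified]) (auto intro: Z2_0)
  finally have C: "C \<in> sets (torus_borel Z2)" .
  have "unit_sq \<inter> lattice_coset Z2 -` C \<subseteq> N"
  proof
    fix y assume y: "y \<in> unit_sq \<inter> lattice_coset Z2 -` C"
    then have "sec (lattice_coset Z2 y) = y" using sec_coset[of 0 y] by simp
    then show "y \<in> N" using y unfolding C_def by (auto dest: bspec[of _ _ 0])
  qed
  then have "emeasure torus2 C \<le> 0" unfolding emeasure_torus2[OF C] N(2)[symmetric] by (rule emeasure_mono) simp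
  then have "C \<in> null_sets torus2" using C by auto
  moreover have "{c \<in> space torus2. \<not> P c} \<subseteq> C"
  proof
    fix c assume c: "c \<in> {c \<in> space torus2. \<not> P c}"
    then have "lattice_coset Z2 (sec c) = c" by (simp add: coset_sec)
    then have "sec c + g \<in> N" if "g \<in> Z2" for g
      using N(1) c that by (auto simp: lattice_coset_period subset_iff simp del: split_paired_All)
    then show "c \<in> C" using c unfolding C_def by simp
  qed
  ultimately show ?thesis by (rule AE_I')
qed

section \<open>The measurable conjugacy\<close>

text \<open>The second map \<open>g\<close> only has to agree with \<open>f\<close> on
  \<open>A\<close>. This is tailored to \<open>the_inv_into\<close>, which is meaningful only on the
  good set and is compared there with a globally measurable map.\<close>

lemma measure_preserving_restrict:
  assumes "measure_preserving M N f" "A \<in> sets M" "B \<in> sets N" "AE x in M. x \<in> A"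
    and "\<And>x. x \<in> A \<Longrightarrow> f x \<in> B" and fg: "\<And>x. x \<in> A \<Longrightarrow> f x = g x"
  shows "measure_preserving (restrict_space M A) (restrict_space N B) g"
proof -
  have f [measurable]: "f \<in> M \<rightarrow>\<^sub>M N" and d: "distr M N f = N"
    using assms(1) by (auto simp: measure_preserving_def)
  have [simp]: "A \<inter> space M = A" "B \<inter> space N = B"
    using assms(2,3) sets.sets_into_space by blast+
  have "f \<in> restrict_space M A \<rightarrow>\<^sub>M restrict_space N B"
    by (rule measurable_restrict_space2) (use assms in \<open>auto simp: space_restrict_space intro: measurable_restrict_space1\<close>)
  then have g: "g \<in> restrict_space M A \<rightarrow>\<^sub>M restrict_space N B"
    by (rule measurable_cong[THEN iffD1, rotated]) (use fg in \<open>simp add: space_restrict_space\<close>)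
  have "distr (restrict_space M A) (restrict_space N B) g = restrict_space N B"
  proof (rule measure_eqI)
    fix E assume "E \<in> sets (distr (restrict_space M A) (restrict_space N B) g)"
    then have E': "E \<in> sets (restrict_space N B)" by simp
    then have E: "E \<in> sets N" "E \<subseteq> B"
      using assms(3) by (auto simp: sets_restrict_space_iff)
    have "emeasure (distr (restrict_space M A) (restrict_space N B) g) E = emeasure (restrict_space M A) (g -` E \<inter> A)"
      using g E' by (subst emeasure_distr) (auto simp: space_restrict_space)
    also have "g -` E \<inter> A = f -` E \<inter> A" using fg by auto
    also have "emeasure (restrict_space M A) \<dots> = emeasure M (f -` E \<inter> A)"
      using assms(2) by (subst emeasure_restrict_space) auto
    also have "\<dots> = emeasure M (f -` E \<inter> space M)"
    proof (rule emeasure_eq_AE)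
      show "AE x in M. x \<in> f -` E \<inter> A \<longleftrightarrow> x \<in> f -` E \<inter> space M"
        using assms(4) by eventually_elim (use sets.sets_into_space[OF assms(2)] in auto)
      have "f -` E \<inter> A = (f -` E \<inter> space M) \<inter> A" using sets.sets_into_space[OF assms(2)] by auto
      then show "f -` E \<inter> A \<in> sets M" using measurable_sets[OF f E(1)] assms(2) by simp
    qed (use measurable_sets[OF f E(1)] in simp)
    also have "\<dots> = emeasure (distr M N f) E" using E(1) by (simp add: emeasure_distr)
    also have "\<dots> = emeasure (restrict_space N B) E"
      using E assms(3) by (simp add: d emeasure_restrict_space)
    finally show "emeasure (distr (restrict_space M A) (restrict_space N B) g) E = emeasure (restrict_space N B) E" .
  qed simp
  then show ?thesis using g by (simp add: measure_preserving_def)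
qed

abbreviation seq_space :: "(nat \<Rightarrow> 'a) measure" where
  "seq_space \<equiv> \<Pi>\<^sub>M n\<in>UNIV. count_space UNIV"

lemma sets_seq_space_prefix:
  "{w :: nat \<Rightarrow> 'a::finite. Q (map w [0..<n])} \<in> sets seq_space"
proof -
  have cyl: "{w :: nat \<Rightarrow> 'a. map w [0..<n] = l} \<in> sets seq_space" if "length l = n" for l
  proof -
    have "{w :: nat \<Rightarrow> 'a. map w [0..<n] = l} = (\<Inter>k\<in>{..<n}. {w \<in> space seq_space. w k = l ! k}) \<inter> space seq_space"
      using that by (auto simp: list_eq_iff_nth_eq space_PiM)
    also have "\<dots> \<in> sets seq_space"
    proof (cases "n = 0")
      case False
      have "{w \<in> space seq_space. w k = l ! k} \<in> sets (seq_space :: (nat \<Rightarrow> 'a) measure)" for k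
      proof -
        have "(\<lambda>w. w k) \<in> (seq_space :: (nat \<Rightarrow> 'a) measure) \<rightarrow>\<^sub>M count_space UNIV"
          by (rule measurable_component_singleton) simp
        from measurable_sets[OF this, of "{l ! k}"] show ?thesis by (simp add: vimage_def Int_def conj_commute)
      qed
      then show ?thesis using False by (intro sets.Int sets.finite_INT) auto
    qed simp
    finally show ?thesis .
  qed
  have "{w :: nat \<Rightarrow> 'a. Q (map w [0..<n])} = (\<Union>l\<in>{l. length l = n \<and> Q l}. {w. map w [0..<n] = l})" by auto
  also have "\<dots> \<in> sets seq_space" using cyl by (intro sets.countable_UN'') auto
  finally show ?thesis .
qed

section \<open>Itineraries of points that are covered exactly once\<close>

context toral_coding
begin

definition uniq :: "real \<times> real \<Rightarrow> bool" where
  "uniq y \<longleftrightarrow> (\<forall>i j. \<forall>g\<in>Z2. \<forall>h\<in>Z2. y + g \<in> piece i \<and> y + h \<in> piece j \<longrightarrow> i = j \<and> g = h)"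

text \<open>The condition is imposed along the forward orbit, which makes it stable under the
  translation; it remains a property of full measure because there are countably many times.\<close>

definition good :: "real \<times> real \<Rightarrow> bool" where
  "good y \<longleftrightarrow> (\<forall>n. uniq (y + of_nat n *\<^sub>R t0))"

definition code :: "real \<times> real \<Rightarrow> nat \<Rightarrow> 'i" where
  "code y n = (THE i. \<exists>g\<in>Z2. y + of_nat n *\<^sub>R t0 + g \<in> piece i)"

definition pt :: "(nat \<Rightarrow> 'i) \<Rightarrow> real \<times> real" where
  "pt w = (THE x. coding x w)"

lemma cover_piece: "\<exists>i. \<exists>g\<in>Z2. y + g \<in> piece i"
  using cover_region[of y] by (auto simp only: region_eq)

lemma AE_uniq: "AE y in lborel. uniq y"
  unfolding uniq_def
  by (rule AE_exactly_one) (use area cover_piece in \<open>simp_all add: piece_def pos_def\<close>)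

lemma AE_good: "AE y in lborel. good y"
  unfolding good_def AE_all_countable by (intro allI AE_lborel_translate AE_uniq)

lemma uniqD: "uniq y \<Longrightarrow> g \<in> Z2 \<Longrightarrow> h \<in> Z2 \<Longrightarrow> y + g \<in> piece i \<Longrightarrow> y + h \<in> piece j \<Longrightarrow> i = j \<and> g = h"
  unfolding uniq_def by blast

lemma uniq_period: 
  assumes "g \<in> Z2" "uniq y" shows "uniq (y + g)"
  unfolding uniq_def
proof (intro allI ballI impI)
  fix i j a b assume "a \<in> Z2" "b \<in> Z2" "y + g + a \<in> piece i \<and> y + g + b \<in> piece j"
  then have "i = j \<and> g + a = g + b"
    using assms by (intro uniqD[of y]) (simp_all add: Z2_add add.assoc)
  then show "i = j \<and> a = b" by simp
qed

lemma good_period: "g \<in> Z2 \<Longrightarrow> good y \<Longrightarrow> good (y + g)"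
  unfolding good_def
proof
  fix n assume "g \<in> Z2" "\<forall>n. uniq (y + of_nat n *\<^sub>R t0)"
  then have "uniq (y + of_nat n *\<^sub>R t0 + g)" using uniq_period by blast
  then show "uniq (y + g + of_nat n *\<^sub>R t0)" by (simp add: algebra_simps)
qed

lemma good_step: "good y \<Longrightarrow> good (y + t0)"
  unfolding good_def
proof
  fix n assume "\<forall>n. uniq (y + of_nat n *\<^sub>R t0)"
  then have "uniq (y + of_nat (Suc n) *\<^sub>R t0)" by blast
  then show "uniq (y + t0 + of_nat n *\<^sub>R t0)" by (simp add: algebra_simps)
qed

lemma code_eq:
  assumes "good y" "g \<in> Z2" "y + of_nat n *\<^sub>R t0 + g \<in> piece i"
  shows "code y n = i"
  unfolding code_def
proof (rule the_equality)
  show "\<exists>g\<in>Z2. y + of_nat n *\<^sub>R t0 + g \<in> piece i" using assms by blast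
  fix j assume "\<exists>g\<in>Z2. y + of_nat n *\<^sub>R t0 + g \<in> piece j"
  then obtain h where "h \<in> Z2" "y + of_nat n *\<^sub>R t0 + h \<in> piece j" by (rule bexE)
  then show "j = i" using uniqD[of "y + of_nat n *\<^sub>R t0" h g j i] assms by (simp add: good_def)
qed

lemma code_ex:
  assumes "good y"
  shows "\<exists>g\<in>Z2. y + of_nat n *\<^sub>R t0 + g \<in> piece (code y n)"
proof -
  obtain i g where "g \<in> Z2" "y + of_nat n *\<^sub>R t0 + g \<in> piece i"
    using cover_piece[of "y + of_nat n *\<^sub>R t0"] by (elim exE bexE)
  then show ?thesis using code_eq[OF assms] by blast
qed

lemma code_period:
  assumes "g \<in> Z2" "good y" shows "code (y + g) = code y"
proof
  fix n
  obtain h where h: "h \<in> Z2" "y + g + of_nat n *\<^sub>R t0 + h \<in> piece (code (y + g) n)"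
    using code_ex[OF good_period[OF assms]] by (rule bexE)
  then have "y + of_nat n *\<^sub>R t0 + (g + h) \<in> piece (code (y + g) n)" by (simp add: algebra_simps)
  then show "code (y + g) n = code y n"
    using code_eq[OF assms(2) Z2_add[OF assms(1) h(1)]] by simp
qed

lemma code_Suc:
  assumes "good y" shows "code y (Suc n) = code (y + t0) n"
proof -
  obtain h where h: "h \<in> Z2" "y + t0 + of_nat n *\<^sub>R t0 + h \<in> piece (code (y + t0) n)"
    using code_ex[OF good_step[OF assms]] by (rule bexE)
  then have "y + of_nat (Suc n) *\<^sub>R t0 + h \<in> piece (code (y + t0) n)" by (simp add: algebra_simps)
  then show ?thesis by (rule code_eq[OF assms h(1)])
qed

lemma coding_code:
  assumes "good y" "coding y w" shows "code y = w"
proof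
  fix n
  have "y + of_nat n *\<^sub>R t0 + (pos w n - of_nat n *\<^sub>R t0) \<in> piece (w n)"
    using assms(2) by (simp add: coding_def)
  then show "code y n = w n" by (rule code_eq[OF assms(1) pos_congr])
qed

text \<open>A point of the region lies in some piece, by uniqueness in the piece named by
  \<open>code\<close>, and the step attached to this piece leads back into the region. Thus the walk
  always picks the lattice representative lying in the region.\<close>

lemma code_coding:
  assumes "good y" "y \<in> region"
  shows "coding y (code y)"
proof -
  have *: "y + pos (code y) n \<in> region" for n
  proof (induction n)
    case (Suc n)
    then obtain i where i: "y + pos (code y) n \<in> piece i" by (auto simp only: region_eq)
    then have "y + of_nat n *\<^sub>R t0 + (pos (code y) n - of_nat n *\<^sub>R t0) \<in> piece i" by simp
    then have "code y n = i" by (rule code_eq[OF assms(1) pos_congr])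
    then have "y + pos (code y) n + \<tau> (code y n) \<in> region" using piece_step i by blast
    then show ?case by (simp add: pos_Suc add.assoc)
  qed (simp add: assms)
  show ?thesis
    unfolding coding_def
  proof
    fix n
    obtain i where i: "y + pos (code y) n \<in> piece i" using *[of n] by (auto simp only: region_eq)
    then have "y + of_nat n *\<^sub>R t0 + (pos (code y) n - of_nat n *\<^sub>R t0) \<in> piece i" by simp
    then have "code y n = i" by (rule code_eq[OF assms(1) pos_congr])
    then show "y + pos (code y) n \<in> piece (code y n)" using i by simp
  qed
qed

text \<open>At a good point the pieces of all other letters are closed sets missing the current
  position, hence at positive distance. For a finite window there is a common distance, and a
  position of the reference walk within it reads the same letters.\<close>

lemma code_in_X_region:
  assumes "good y" "y \<in> region"
  shows "code y \<in> X"
  unfolding X_def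
proof (intro CollectI allI)
  fix k l
  let ?z = "\<lambda>j. y + pos (code y) (k + j)"
  have c: "coding y (code y)" using assms by (rule code_coding)
  have "\<exists>e>0. \<forall>i x. dist x (?z j) < e \<longrightarrow> x \<in> piece i \<longrightarrow> i = code y (k + j)" for j
  proof -
    have "closed (\<Union>i\<in>-{code y (k + j)}. piece i)" by (intro closed_UN) auto
    moreover have "?z j \<notin> (\<Union>i\<in>-{code y (k + j)}. piece i)"
    proof
      assume "?z j \<in> (\<Union>i\<in>-{code y (k + j)}. piece i)"
      then obtain i where i: "i \<noteq> code y (k + j)" "?z j \<in> piece i" by blast
      have "y + of_nat (k + j) *\<^sub>R t0 + (pos (code y) (k + j) - of_nat (k + j) *\<^sub>R t0) \<in> piece i"
        using i(2) by simp
      then have "code y (k + j) = i" by (rule code_eq[OF assms(1) pos_congr])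
      then show False using i by simp
    qed
    ultimately have "open (- (\<Union>i\<in>-{code y (k + j)}. piece i))" "?z j \<in> - (\<Union>i\<in>-{code y (k + j)}. piece i)"
      by (simp_all only: open_Compl Compl_iff simp_thms)
    then obtain e where e: "e > 0" "\<And>x. dist x (?z j) < e \<Longrightarrow> x \<in> - (\<Union>i\<in>-{code y (k + j)}. piece i)"
      unfolding open_dist by metis
    show ?thesis
    proof (intro exI[of _ e] conjI allI impI e(1))
      fix i x assume "dist x (?z j) < e" "x \<in> piece i"
      then show "i = code y (k + j)" using e(2)[of x] by blast
    qed
  qed
  then obtain e where e: "\<And>j. e j > 0" "\<And>j i x. dist x (?z j) < e j \<Longrightarrow> x \<in> piece i \<Longrightarrow> i = code y (k + j)"
    by metis
  define d where "d = Min (insert 1 (e ` {..<l}))"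
  have d: "d > 0" "\<And>j. j < l \<Longrightarrow> d \<le> e j" unfolding d_def using e(1) by (auto simp: Min_gr_iff)
  have "?z 0 \<in> closure (range (pos u))" using coding_region[OF c, of k] by (simp add: region_def)
  then obtain m where m: "dist (pos u m) (?z 0) < d"
    using d(1) unfolding closure_approachable by blast
  have "code y (k + j) = u (m + j)" if "j < l" for j
    using that
  proof (induction j rule: less_induct)
    \<comment> \<open>The letters before \<open>j\<close> already agree, so both walks have made the
      same displacement and their distance is unchanged.\<close>
    case (less j)
    have 1: "pos u (m + j) = pos u m + pos (\<lambda>i. code y (k + i)) j"
      by (rule pos_agree) (use less in simp)
    have "pos (code y) (k + j) = pos (code y) k + pos (\<lambda>i. code y (k + i)) j" for j
      by (induction j) (simp_all add: pos_Suc)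
    then have "dist (pos u (m + j)) (?z j) = dist (pos u m) (?z 0)"
      unfolding 1 by (simp add: dist_norm algebra_simps)
    then show ?case using e(2)[of "pos u (m + j)" j "u (m + j)"] m d(2)[OF less.prems] pos_in_piece by simp
  qed
  then show "\<exists>m. \<forall>j<l. code y (k + j) = u (m + j)" by blast
qed

lemma region_rep:
  obtains g where "g \<in> Z2" "y + g \<in> region"
  using cover_region[of y] by (rule bexE)

lemma code_in_X: "good y \<Longrightarrow> code y \<in> X"
  by (metis code_in_X_region code_period good_period region_rep)

lemma pt_eq: "coding x w \<Longrightarrow> pt w = x"
  unfolding pt_def by (rule the_equality) (simp_all add: coding_unique)

lemma pt_coding: "w \<in> X \<Longrightarrow> coding (pt w) w"
  using coding_exists pt_eq by blast

lemma shift_X: "w \<in> X \<Longrightarrow> word_shift w \<in> X"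
  unfolding X_def word_shift_def
proof (intro CollectI allI)
  fix k l assume "w \<in> {w. \<forall>k l. \<exists>m. \<forall>j<l. w (k + j) = u (m + j)}"
  then have "\<exists>m. \<forall>j<l. w (Suc k + j) = u (m + j)" by blast
  then show "\<exists>m. \<forall>j<l. w (Suc (k + j)) = u (m + j)" by simp
qed

lemma pt_shift:
  assumes "w \<in> X" shows "pt (word_shift w) = pt w + \<tau> (w 0)"
proof (rule pt_eq)
  have "pos w (Suc n) = \<tau> (w 0) + pos (word_shift w) n" for n
    by (induction n) (simp_all add: pos_Suc word_shift_def add.assoc)
  then show "coding (pt w + \<tau> (w 0)) (word_shift w)"
    using pt_coding[OF assms] unfolding coding_def by (metis add.assoc word_shift_def)
qed

lemma natural_partition_pieces: "natural_partition Z2 (lattice_coset Z2 t0) region piece \<tau>"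
  unfolding natural_partition_def
proof (intro conjI allI impI ballI)
  show "fundamental_domain Z2 region"
    unfolding fundamental_domain_def
  proof
    show "AE x in lborel. \<exists>!y. y \<in> region \<and> lattice_coset Z2 y = lattice_coset Z2 x"
      using AE_uniq
    proof eventually_elim
      case (elim x)
      obtain g where g: "g \<in> Z2" "x + g \<in> region" by (rule region_rep)
      show ?case
      proof (rule ex1I)
        show "x + g \<in> region \<and> lattice_coset Z2 (x + g) = lattice_coset Z2 x"
          using g by (simp add: lattice_coset_period)
        fix y assume y: "y \<in> region \<and> lattice_coset Z2 y = lattice_coset Z2 x"
        then have h: "y - x \<in> Z2" "x + (y - x) \<in> region" by (simp_all add: lattice_coset_eq_iff)
        obtain i j where "x + g \<in> piece i" "x + (y - x) \<in> piece j"
          using g(2) h(2) unfolding region_eq by (elim UN_E)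
        then have "g = y - x" using uniqD[OF elim g(1) h(1)] by blast
        then show "y = x + g" by simp
      qed
    qed
  qed simp
  fix i j :: 'i assume "i \<noteq> j"
  have "AE x in lborel. x \<notin> piece i \<inter> piece j"
    using AE_uniq
  proof eventually_elim
    case (elim x)
    then show ?case using uniqD[of x 0 0 i j] \<open>i \<noteq> j\<close> by auto
  qed
  then show "piece i \<inter> piece j \<in> null_sets lborel"
    by (subst AE_iff_null_sets) auto
next
  fix i x assume "x \<in> piece i"
  then show "x + \<tau> i \<in> region" by (rule piece_step)
  have "x + \<tau> i - (t0 + x) \<in> Z2" using tau[of i] by (simp add: algebra_simps)
  then show "lattice_coset Z2 (x + \<tau> i) = lattice_coset Z2 t0 + lattice_coset Z2 x"
    by (simp add: lattice_coset_add lattice_coset_eq_iff)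
qed (use piece_subset full_rank_lattice_Z2 region_eq in auto)

lemma coding_of_exists: "w \<in> X \<Longrightarrow> \<exists>x\<in>region. coding_of piece \<tau> x w"
proof -
  assume w: "w \<in> X"
  have c: "coding (pt w) w" using w by (rule pt_coding)
  show ?thesis
  proof (intro bexI)
    show "pt w \<in> region" using coding_region[OF c, of 0] by simp
    show "coding_of piece \<tau> (pt w) w"
      unfolding coding_of_def using c
      by (intro exI[of _ "\<lambda>n. pt w + pos w n"]) (simp add: coding_def pos_Suc add.assoc)
  qed
qed

end

section \<open>The invariant measure, its uniqueness and the conjugacy\<close>

context toral_coding
begin

abbreviation "X_space \<equiv> restrict_space seq_space X"

lemma space_X [simp]: "space X_space = X"
  by (simp add: space_restrict_space space_PiM)

lemma measurable_good [measurable]: "Measurable.pred borel good"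
proof -
  have [measurable]: "Measurable.pred borel uniq"
    unfolding uniq_def by (intro pred_intros_countable pred_intros_countable_bounded countable_Z2) measurable
  show ?thesis unfolding good_def
  proof (intro pred_intros_countable)
    fix n
    have "(\<lambda>y. y + of_nat n *\<^sub>R t0) \<in> borel \<rightarrow>\<^sub>M borel" by measurable
    from measurable_compose[OF this, of uniq] show "Measurable.pred borel (\<lambda>y. uniq (y + of_nat n *\<^sub>R t0))"
      by measurable
  qed
qed

text \<open>By compactness, \<open>pt w\<close> belongs to a closed set \<open>C\<close> if and only
  if, for every \<open>n\<close>, some point of \<open>C\<close> is compatible with the first
  \<open>n\<close> letters. Each of these conditions depends on a finite prefix only.\<close>

lemma measurable_pt [measurable]: "pt \<in> X_space \<rightarrow>\<^sub>M borel"
proof -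
  have closed: "{w \<in> X. pt w \<in> C} \<in> sets X_space" if C: "closed C" for C
  proof -
    define Q where "Q n l \<longleftrightarrow> (\<exists>z\<in>C. \<forall>k<n. z + (\<Sum>m<k. \<tau> (l ! m)) \<in> piece (l ! k))" for n and l :: "'i list"
    have Q: "Q n (map w [0..<n]) \<longleftrightarrow> (\<exists>z\<in>C. \<forall>k<n. z + pos w k \<in> piece (w k))" for n w
    proof -
      have "(\<Sum>m<k. \<tau> (map w [0..<n] ! m)) = pos w k" if "k < n" for k
        unfolding pos_def by (rule sum.cong) (use that in auto)
      then show ?thesis unfolding Q_def by (intro bex_cong refl all_cong1 imp_cong) simp_all
    qed
    have "pt w \<in> C \<longleftrightarrow> (\<forall>n. Q n (map w [0..<n]))" if w: "w \<in> X" for w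
    proof
      assume "pt w \<in> C"
      then show "\<forall>n. Q n (map w [0..<n])"
        using pt_coding[OF w] unfolding Q coding_def by blast
    next
      assume "\<forall>n. Q n (map w [0..<n])"
      then have "\<forall>n. \<exists>z\<in>C. \<forall>k<n. z + pos w k \<in> piece (w k)" by (simp add: Q)
      then obtain z where z: "\<And>n. z n \<in> C" "\<And>n k. k < n \<Longrightarrow> z n + pos w k \<in> piece (w k)" by metis
      \<comment> \<open>The shift to \<open>Suc n\<close> guarantees that the condition at time 0 is
        present; it places the point in the compact region.\<close>
      have "\<forall>n. z (Suc n) \<in> region" using z(2)[of 0 "Suc _"] piece_subset by auto
      then obtain x r where r: "strict_mono (r :: nat \<Rightarrow> nat)" "((\<lambda>n. z (Suc n)) \<circ> r) \<longlonglongrightarrow> x"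
        using compact_region unfolding compact_def by metis
      have lim: "(\<lambda>n. z (Suc (r n))) \<longlonglongrightarrow> x" using r(2) by (simp add: o_def)
      have "x \<in> C" by (rule Lim_in_closed_set[OF C _ sequentially_bot lim]) (simp add: z(1))
      have "x + pos w k \<in> piece (w k)" for k
      proof (rule Lim_in_closed_set[OF closed_piece _ sequentially_bot])
        show "(\<lambda>n. z (Suc (r n)) + pos w k) \<longlonglongrightarrow> x + pos w k"
          by (intro tendsto_add tendsto_const lim)
        show "\<forall>\<^sub>F n in sequentially. z (Suc (r n)) + pos w k \<in> piece (w k)"
          using eventually_ge_at_top[of k]
        proof eventually_elim
          case (elim n)
          then show ?case using seq_suble[OF r(1), of n] by (intro z(2)) simp
        qed
      qed
      then have "pt w = x" by (intro pt_eq) (simp add: coding_def)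
      then show "pt w \<in> C" using \<open>x \<in> C\<close> by simp
    qed
    then have "{w \<in> X. pt w \<in> C} = (\<Inter>n. {w. Q n (map w [0..<n])}) \<inter> X" by auto
    also have "\<dots> \<in> sets X_space"
    proof -
      have U: "UNIV \<in> sets (seq_space :: (nat \<Rightarrow> 'i) measure)"
        using sets.top[of "seq_space :: (nat \<Rightarrow> 'i) measure"] by (simp add: space_PiM)
      show ?thesis
      unfolding sets_restrict_space
      by (rule image_eqI[of _ _ "\<Inter>n. {w. Q n (map w [0..<n])}"])
         (auto intro!: sets.countable_INT'' sets_seq_space_prefix U)
    qed
    finally show ?thesis .
  qed
  show ?thesis
  proof (rule borel_measurableI)
    fix S :: "(real \<times> real) set" assume "open S"
    then have "space X_space - {w \<in> X. pt w \<in> - S} \<in> sets X_space"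
      by (intro sets.compl_sets closed) (simp add: closed_Compl)
    also have "space X_space - {w \<in> X. pt w \<in> - S} = pt -` S \<inter> space X_space" by auto
    finally show "pt -` S \<inter> space X_space \<in> sets X_space" .
  qed
qed

text \<open>A default value for \<open>itinerary\<close> off the good points, chosen in
  \<open>X\<close> so that \<open>itinerary\<close> takes its values in \<open>X\<close>
  everywhere.\<close>

definition ref_word :: "nat \<Rightarrow> 'i" where
  "ref_word = (SOME w. w \<in> X)"

definition itinerary :: "(real \<times> real) set \<Rightarrow> nat \<Rightarrow> 'i" where
  "itinerary c = (if good (sec c) then code (sec c) else ref_word)"

lemma ref_word_in: "ref_word \<in> X"
proof -
  have "\<exists>y. good y"
    by (rule eventually_happens'[OF _ AE_good]) (simp add: ae_filter_eq_bot_iff)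
  then show ?thesis unfolding ref_word_def using code_in_X by (metis someI)
qed

lemma itinerary_in: "itinerary c \<in> X"
  by (simp add: itinerary_def code_in_X ref_word_in)

lemma measurable_itinerary [measurable]: "itinerary \<in> torus_borel Z2 \<rightarrow>\<^sub>M X_space"
proof (rule measurable_restrict_space2)
  define K where "K y = (if good y then code y else ref_word)" for y
  have "K \<in> borel \<rightarrow>\<^sub>M seq_space"
  proof (rule measurable_PiM_single')
    fix n :: nat
    have "K y n = i \<longleftrightarrow> (good y \<and> (\<exists>g\<in>Z2. y + of_nat n *\<^sub>R t0 + g \<in> piece i)) \<or> (\<not> good y \<and> ref_word n = i)" for y i
      using code_ex[of y n] code_eq[of y _ n i] unfolding K_def by (cases "good y") auto
    moreover have "Measurable.pred borel (\<lambda>y. (good y \<and> (\<exists>g\<in>Z2. y + of_nat n *\<^sub>R t0 + g \<in> piece i)) \<or> (\<not> good y \<and> ref_word n = i))" for i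
    proof -
      have "Measurable.pred borel (\<lambda>y. \<exists>g\<in>Z2. y + of_nat n *\<^sub>R t0 + g \<in> piece i)"
      proof -
        have "{y. y + (of_nat n *\<^sub>R t0 + g) \<in> piece i} \<in> sets borel" for g
          using borel_translate_pred[OF piece_borel] by (simp add: pred_def)
        then have "(\<Union>g\<in>Z2. {y. y + (of_nat n *\<^sub>R t0 + g) \<in> piece i}) \<in> sets borel"
          by (intro sets.countable_UN'[OF countable_Z2]) auto
        also have "(\<Union>g\<in>Z2. {y. y + (of_nat n *\<^sub>R t0 + g) \<in> piece i})
            = {y. \<exists>g\<in>Z2. y + of_nat n *\<^sub>R t0 + g \<in> piece i}"
          by (intro set_eqI) (simp only: UN_iff mem_Collect_eq add.assoc)
        finally show ?thesis by (simp add: pred_def)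
      qed
      then show ?thesis by measurable
    qed
    ultimately have "Measurable.pred borel (\<lambda>y. K y n = i)" for i by simp
    then show "(\<lambda>y. K y n) \<in> borel \<rightarrow>\<^sub>M count_space UNIV"
      by (intro measurable_count_space_eq2[THEN iffD2]) (auto simp: pred_def vimage_def)
  qed (simp add: space_PiM)
  then have "K \<circ> sec \<in> torus_borel Z2 \<rightarrow>\<^sub>M seq_space" by (intro measurable_comp) measurable
  moreover have "K \<circ> sec = itinerary" by (auto simp: K_def itinerary_def)
  ultimately show "itinerary \<in> torus_borel Z2 \<rightarrow>\<^sub>M seq_space" by simp
qed (simp add: itinerary_in)

lemma measurable_word_shift: "word_shift \<in> X_space \<rightarrow>\<^sub>M X_space"
proof (rule measurable_restrict_space2)
  have "word_shift \<in> (seq_space :: (nat \<Rightarrow> 'i) measure) \<rightarrow>\<^sub>M seq_space"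
  proof (rule measurable_PiM_single')
    fix n
    have "(\<lambda>w. w (Suc n)) \<in> (seq_space :: (nat \<Rightarrow> 'i) measure) \<rightarrow>\<^sub>M count_space UNIV"
      by (rule measurable_component_singleton) simp
    then show "(\<lambda>w. word_shift w n) \<in> (seq_space :: (nat \<Rightarrow> 'i) measure) \<rightarrow>\<^sub>M count_space UNIV"
      by (simp add: word_shift_def)
  qed (simp add: space_PiM)
  then show "word_shift \<in> X_space \<rightarrow>\<^sub>M seq_space" by (rule measurable_restrict_space1)
qed (simp add: shift_X)

definition good_words :: "(nat \<Rightarrow> 'i) set" where
  "good_words = {w \<in> X. good (pt w)}"

definition good_points :: "(real \<times> real) set set" where
  "good_points = {c \<in> torus_points Z2. good (sec c)}"

lemma good_words_sets: "good_words \<in> sets X_space"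
proof -
  have "Measurable.pred X_space (\<lambda>w. good (pt w))" by measurable
  then show ?thesis by (simp add: good_words_def pred_def)
qed

lemma good_points_sets: "good_points \<in> sets (torus_borel Z2)"
proof -
  have "Measurable.pred (torus_borel Z2) (\<lambda>c. good (sec c))" by measurable
  then show ?thesis by (simp add: good_points_def pred_def)
qed

lemma good_sec_coset: "good (sec (lattice_coset Z2 y)) \<longleftrightarrow> good y"
proof -
  obtain g where g: "g \<in> Z2" "sec (lattice_coset Z2 y) = y + g" by (rule sec_cosetE)
  then show ?thesis using good_period[of g y] good_period[of "- g" "y + g"] Z2_uminus[OF g(1)] by auto
qed

lemma code_sec_coset: "good y \<Longrightarrow> code (sec (lattice_coset Z2 y)) = code y"
proof -
  assume y: "good y"
  obtain g where g: "g \<in> Z2" "sec (lattice_coset Z2 y) = y + g" by (rule sec_cosetE)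
  then show ?thesis using code_period[OF g(1) y] by simp
qed

definition point :: "(nat \<Rightarrow> 'i) \<Rightarrow> (real \<times> real) set" where
  "point w = lattice_coset Z2 (pt w)"

lemma measurable_point [measurable]: "point \<in> X_space \<rightarrow>\<^sub>M torus_borel Z2"
  unfolding point_def[abs_def] by measurable

lemma point_good: "w \<in> X \<Longrightarrow> point w \<in> good_points \<longleftrightarrow> w \<in> good_words"
  by (simp add: point_def good_points_def good_words_def good_sec_coset)

lemma itinerary_point: "w \<in> good_words \<Longrightarrow> itinerary (point w) = w"
  unfolding itinerary_def point_def good_words_def
  by (simp add: good_sec_coset code_sec_coset coding_code pt_coding)

lemma point_itinerary: "c \<in> good_points \<Longrightarrow> point (itinerary c) = c"
proof -
  assume c: "c \<in> good_points"
  then have s: "good (sec c)" "c \<in> torus_points Z2" by (auto simp: good_points_def)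
  obtain g where g: "g \<in> Z2" "sec c + g \<in> region" by (rule region_rep)
  have "coding (sec c + g) (code (sec c + g))" using good_period[OF g(1) s(1)] g(2) by (rule code_coding)
  then have "pt (code (sec c)) = sec c + g" by (simp add: code_period[OF g(1) s(1)] pt_eq)
  then show ?thesis using s g by (simp add: point_def itinerary_def lattice_coset_period coset_sec)
qed

lemma itinerary_good: "c \<in> good_points \<Longrightarrow> itinerary c \<in> good_words"
  using point_good[OF itinerary_in, of c] point_itinerary by simp

lemma point_shift: "w \<in> X \<Longrightarrow> point (word_shift w) = lattice_coset Z2 t0 + point w"
  unfolding point_def by (simp add: pt_shift lattice_coset_add lattice_coset_eq_iff tau algebra_simps)

lemma good_points_translate: "c \<in> good_points \<Longrightarrow> lattice_coset Z2 t0 + c \<in> good_points"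
proof -
  assume c: "c \<in> good_points"
  then have s: "good (sec c)" "c = lattice_coset Z2 (sec c)" by (auto simp: good_points_def coset_sec)
  have "lattice_coset Z2 t0 + c = lattice_coset Z2 (sec c + t0)"
    by (subst s(2)) (simp add: lattice_coset_add add.commute)
  then show ?thesis using good_step[OF s(1)] by (simp add: good_points_def good_sec_coset)
qed

lemma itinerary_translate: "c \<in> good_points \<Longrightarrow> itinerary (lattice_coset Z2 t0 + c) = word_shift (itinerary c)"
proof -
  assume c: "c \<in> good_points"
  then have s: "good (sec c)" "c = lattice_coset Z2 (sec c)" by (auto simp: good_points_def coset_sec)
  have *: "lattice_coset Z2 t0 + c = lattice_coset Z2 (sec c + t0)"
    by (subst s(2)) (simp add: lattice_coset_add add.commute)
  show ?thesis
    unfolding * using good_step[OF s(1)] s(1)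
    by (auto simp: itinerary_def good_sec_coset code_sec_coset word_shift_def code_Suc)
qed

lemma AE_good_points: "AE c in torus2. c \<in> good_points"
  by (rule AE_torus2I) (use AE_good in \<open>simp add: good_points_def good_sec_coset\<close>)

definition mu :: "(nat \<Rightarrow> 'i) measure" where
  "mu = distr torus2 X_space itinerary"

lemma sets_mu [simp, measurable_cong]: "sets mu = sets X_space"
  by (simp add: mu_def)

lemma invariant_mu: "invariant_prob X mu"
  unfolding invariant_prob_def
proof (intro conjI)
  interpret T: prob_space torus2 by (rule prob_space_torus2)
  have [measurable]: "itinerary \<in> torus2 \<rightarrow>\<^sub>M X_space" by measurable
  show "prob_space mu" unfolding mu_def by (rule T.prob_space_distr) measurable
  have [measurable]: "word_shift \<in> X_space \<rightarrow>\<^sub>M X_space" by (rule measurable_word_shift)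
  have "distr mu mu word_shift = distr mu X_space word_shift" by (rule distr_cong) simp_all
  also have "\<dots> = distr torus2 X_space (word_shift \<circ> itinerary)"
    unfolding mu_def by (rule distr_distr) measurable
  also have "\<dots> = distr torus2 X_space (itinerary \<circ> (\<lambda>c. lattice_coset Z2 t0 + c))"
  proof (rule distr_cong_AE)
    show "AE c in torus2. (word_shift \<circ> itinerary) c = (itinerary \<circ> (\<lambda>c. lattice_coset Z2 t0 + c)) c"
      using AE_good_points by eventually_elim (simp add: itinerary_translate)
  qed measurable
  also have "\<dots> = distr (distr torus2 torus2 (\<lambda>c. lattice_coset Z2 t0 + c)) X_space itinerary"
    by (rule distr_distr[symmetric]) measurable
  also have "\<dots> = mu" by (simp add: torus2_translation_invariant mu_def)
  finally show "measure_preserving mu mu word_shift"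
    unfolding measure_preserving_def by simp
qed simp

text \<open>\<open>point\<close> intertwines the shift with the translation on all of
  \<open>X\<close>, not just almost everywhere, so the image of any invariant measure is translation
  invariant.\<close>

lemma distr_point:
  assumes "invariant_prob X \<nu>"
  shows "distr \<nu> (torus_borel Z2) point = torus2"
proof (rule translation_invariant_torus2[OF _ _ _ dense])
  interpret prob_space \<nu> using assms by (simp add: invariant_prob_def)
  have sets_nu [measurable_cong]: "sets \<nu> = sets X_space" and inv: "distr \<nu> \<nu> word_shift = \<nu>"
    using assms by (simp_all add: invariant_prob_def measure_preserving_def)
  have space_nu: "space \<nu> = X" using sets_eq_imp_space_eq[OF sets_nu] by simp
  have [measurable]: "word_shift \<in> X_space \<rightarrow>\<^sub>M X_space" by (rule measurable_word_shift)
  show "prob_space (distr \<nu> (torus_borel Z2) point)" by (rule prob_space_distr) measurable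
  let ?N = "distr \<nu> (torus_borel Z2) point"
  have "distr ?N ?N (\<lambda>c. lattice_coset Z2 t0 + c) = distr ?N (torus_borel Z2) (\<lambda>c. lattice_coset Z2 t0 + c)"
    by (rule distr_cong) simp_all
  also have "\<dots> = distr \<nu> (torus_borel Z2) ((\<lambda>c. lattice_coset Z2 t0 + c) \<circ> point)"
    by (rule distr_distr) measurable
  also have "\<dots> = distr \<nu> (torus_borel Z2) (point \<circ> word_shift)"
    by (rule distr_cong) (simp_all add: space_nu point_shift)
  also have "\<dots> = distr (distr \<nu> \<nu> word_shift) (torus_borel Z2) point"
    by (rule distr_distr[symmetric]) measurable
  also have "\<dots> = ?N" by (simp add: inv)
  finally show "distr ?N ?N (\<lambda>c. lattice_coset Z2 t0 + c) = ?N" .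
qed simp

lemma AE_good_words:
  assumes "invariant_prob X \<nu>"
  shows "AE w in \<nu>. w \<in> good_words"
proof -
  have sets_nu [measurable_cong]: "sets \<nu> = sets X_space"
    using assms by (simp_all add: invariant_prob_def measure_preserving_def)
  have space_nu: "space \<nu> = X" using sets_eq_imp_space_eq[OF sets_nu] by simp
  have "AE c in distr \<nu> (torus_borel Z2) point. c \<in> good_points"
    unfolding distr_point[OF assms] by (rule AE_good_points)
  then have "AE w in \<nu>. point w \<in> good_points" by (rule AE_distrD[rotated]) measurable
  with AE_space show ?thesis by eventually_elim (use point_good space_nu in simp)
qed

text \<open>As the image of \<open>\<nu>\<close> under \<open>point\<close> is
  \<open>torus2\<close>, almost every word for \<open>\<nu>\<close> is good. There
  \<open>itinerary\<close> undoes \<open>point\<close>, so \<open>\<nu>\<close> is recovered from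
  \<open>torus2\<close>.\<close>

lemma unique_mu: "unique_invariant_prob X mu"
  unfolding unique_invariant_prob_def
proof (intro conjI allI impI invariant_mu)
  fix \<nu> assume nu: "invariant_prob X \<nu>"
  then have sets_nu [measurable_cong]: "sets \<nu> = sets X_space"
    by (simp_all add: invariant_prob_def)
  have "mu = distr (distr \<nu> (torus_borel Z2) point) X_space itinerary"
    by (simp add: mu_def distr_point[OF nu])
  also have "\<dots> = distr \<nu> X_space (itinerary \<circ> point)" by (rule distr_distr) measurable
  also have "\<dots> = distr \<nu> X_space (\<lambda>w. w)"
  proof (rule distr_cong_AE)
    show "AE w in \<nu>. (itinerary \<circ> point) w = w"
      using AE_good_words[OF nu] by eventually_elim (simp add: itinerary_point)
  qed measurable
  also have "\<dots> = \<nu>" using sets_nu by (intro distr_id2) simp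
  finally show "\<nu> = mu" ..
qed

lemma conjugate_mu: "measurably_conjugate mu word_shift torus2 (\<lambda>c. lattice_coset Z2 t0 + c)"
proof -
  have bij: "bij_betw point good_words good_points"
    by (rule bij_betwI[where g = itinerary]) (use itinerary_point point_itinerary itinerary_good point_good in \<open>auto simp: good_words_def\<close>)
  have inv: "the_inv_into good_words point c = itinerary c" if "c \<in> good_points" for c
    using bij that by (intro the_inv_into_f_eq) (auto simp: bij_betw_def point_itinerary itinerary_good)
  have mu: "AE w in mu. w \<in> good_words" by (rule AE_good_words[OF invariant_mu])
  have point: "measure_preserving mu torus2 point"
    unfolding measure_preserving_def
  proof
    show "distr mu torus2 point = torus2"
      using distr_point[OF invariant_mu] by (metis distr_cong sets_torus2)
  qed measurable
  have itinerary: "measure_preserving torus2 mu itinerary"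
    unfolding measure_preserving_def
  proof
    show "distr torus2 mu itinerary = mu" unfolding mu_def by (rule distr_cong) simp_all
  qed measurable
  have im: "point w \<in> good_points" if "w \<in> good_words" for w
    using that point_good[of w] by (simp add: good_words_def)
  show ?thesis
    unfolding measurably_conjugate_def
  proof (rule exI[of _ good_words], rule exI[of _ good_points], rule exI[of _ point], intro conjI)
    show "word_shift ` good_words \<subseteq> good_words"
    proof (rule image_subsetI)
      fix w assume w: "w \<in> good_words"
      then have "w \<in> X" by (simp add: good_words_def)
      then show "word_shift w \<in> good_words"
        using good_points_translate[OF im[OF w]] point_good[OF shift_X] point_shift by simp
    qed
    show "(\<lambda>c. lattice_coset Z2 t0 + c) ` good_points \<subseteq> good_points" using good_points_translate by blast
    show "measure_preserving (restrict_space mu good_words) (restrict_space torus2 good_points) point"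
      by (rule measure_preserving_restrict[OF point]) (use good_words_sets good_points_sets mu im in auto)
    show "measure_preserving (restrict_space torus2 good_points) (restrict_space mu good_words) (the_inv_into good_words point)"
      by (rule measure_preserving_restrict[OF itinerary]) (use good_words_sets good_points_sets AE_good_points itinerary_good inv in auto)
    show "\<forall>w\<in>good_words. point (word_shift w) = lattice_coset Z2 t0 + point w"
      by (simp add: good_words_def point_shift)
  qed (use good_words_sets good_points_sets mu AE_good_points bij in simp_all)
qed

theorem natural_coding:
  "(\<exists>\<mu>. unique_invariant_prob X \<mu> \<and> measurably_conjugate \<mu> word_shift torus2 (\<lambda>c. lattice_coset Z2 t0 + c)) \<and>
   (\<exists>R P \<tau>. natural_partition Z2 (lattice_coset Z2 t0) R P \<tau> \<and> (\<forall>w\<in>X. \<exists>x\<in>R. coding_of P \<tau> x w))"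
  using unique_mu conjugate_mu natural_partition_pieces coding_of_exists by blast

end

section \<open>Words and weights\<close>

lemma subst_word_Nil [simp]: "subst_word s [] = []"
  and subst_word_Cons [simp]: "subst_word s (a # w) = s a @ subst_word s w"
  and subst_word_append [simp]: "subst_word s (v @ w) = subst_word s v @ subst_word s w"
  by (simp_all add: subst_word_def)

lemma subst_prefix_Nil [simp]: "subst_prefix \<sigma> n [] = []"
  by (induction n) simp_all

lemma subst_prefix_append [simp]: "subst_prefix \<sigma> n (v @ w) = subst_prefix \<sigma> n v @ subst_prefix \<sigma> n w"
  by (induction n arbitrary: v w) simp_all

lemma subst_prefix_conv_subst_word: "subst_prefix \<sigma> n w = subst_word (\<lambda>j. subst_prefix \<sigma> n [j]) w"
proof (induction w)
  case (Cons a w)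
  have "subst_prefix \<sigma> n (a # w) = subst_prefix \<sigma> n ([a] @ w)" by simp
  then show ?case by (simp only: subst_prefix_append subst_word_Cons Cons.IH)
qed simp

lemma subst_prefix_add: "subst_prefix \<sigma> (m + n) w = subst_prefix \<sigma> m (subst_prefix (\<lambda>k. \<sigma> (m + k)) n w)"
  by (induction n arbitrary: w) simp_all

text \<open>Desubstitution: \<open>j'\<close> is the letter of \<open>w\<close> whose image contains
  the marked letter \<open>j\<close>, and \<open>r''\<close> is what precedes \<open>j\<close>
  inside that image.\<close>

lemma prefix_subst_word:
  assumes "prefix (r @ [j]) (subst_word s w)"
  shows "\<exists>r' j' r''. prefix (r' @ [j']) w \<and> prefix (r'' @ [j]) (s j') \<and> r = subst_word s r' @ r''"
  using assms
proof (induction w arbitrary: r)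
  case (Cons a w)
  have p: "prefix (r @ [j]) (s a @ subst_word s w)" using Cons.prems by simp
  show ?case
  proof (cases "length r < length (s a)")
    case True
    then have "prefix (r @ [j]) (s a)"
      by (rule_tac prefix_length_prefix[OF p]) simp_all
    then show ?thesis by (intro exI[of _ "[]"] exI[of _ a] exI[of _ r]) simp
  next
    case False
    then have "prefix (s a) r"
      by (rule_tac prefix_length_prefix[OF _ append_prefixD[OF p]]) simp_all
    then obtain r2 where r2: "r = s a @ r2" by (rule prefixE)
    then have "prefix (r2 @ [j]) (subst_word s w)" using p by simp
    then obtain r' j' r'' where "prefix (r' @ [j']) w" "prefix (r'' @ [j]) (s j')" "r2 = subst_word s r' @ r''"
      using Cons.IH by blast
    then show ?thesis by (intro exI[of _ "a # r'"] exI[of _ j'] exI[of _ r'']) (simp add: r2)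
  qed
qed simp

section \<open>Weights of words and the accelerated substitutions\<close>

definition wsum :: "('a \<Rightarrow> 'v::real_vector) \<Rightarrow> 'a list \<Rightarrow> 'v" where
  "wsum g w = sum_list (map g w)"

lemma wsum_Nil [simp]: "wsum g [] = 0"
  and wsum_Cons [simp]: "wsum g (a # w) = g a + wsum g w"
  and wsum_append [simp]: "wsum g (v @ w) = wsum g v + wsum g w"
  by (simp_all add: wsum_def)

lemma wsum_replicate [simp]: "wsum g (replicate n a) = of_nat n *\<^sub>R g a"
  by (induction n) (simp_all add: algebra_simps)

lemma wsum_subst_word: "wsum g (subst_word s w) = wsum (\<lambda>j. wsum g (s j)) w"
  by (induction w) simp_all

text \<open>The digit \<open>(a, b)\<close> stands for a run of \<open>a\<close> substitutions \<open>\<beta>\<^sub>1\<close> followed by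
  \<open>\<beta>\<^sub>2\<close> (if \<open>b\<close> is false) or \<open>\<beta>\<^sub>3\<close> (if \<open>b\<close> is true).\<close>

type_synonym digit = "nat \<times> bool"

fun acc_subst :: "digit \<Rightarrow> letter \<Rightarrow> letter list" where
  "acc_subst (a, b) L3 = L2 # replicate (Suc a) L3"
| "acc_subst (a, b) L1 = (if b then [L3] else [L1])"
| "acc_subst (a, b) L2 = (if b then [L1] else [L3])"

text \<open>Only the image of \<open>L3\<close> is longer than one letter. The letter
  \<open>j\<close> following the prefix is recorded because a nonempty prefix forces
  \<open>j = L3\<close>; the pieces of \<open>L1\<close> and \<open>L2\<close> are small for this
  reason.\<close>

lemma prefix_acc_subst:
  assumes "prefix (r @ [j]) (acc_subst (a, b) i)"
  shows "(r = [] \<and> j = hd (acc_subst (a, b) i)) \<or> (i = L3 \<and> j = L3 \<and> (\<exists>k\<le>a. r = L2 # replicate k L3))"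
proof (cases i)
  case L3
  then have p: "prefix (r @ [j]) (L2 # replicate (Suc a) L3)" using assms by simp
  show ?thesis
  proof (cases r)
    case (Cons c r')
    then have c: "c = L2" "prefix (r' @ [j]) (replicate (Suc a) L3)" using p by simp_all
    then obtain z where z: "replicate (Suc a) L3 = (r' @ [j]) @ z" by (auto simp: prefix_def)
    have "set ((r' @ [j]) @ z) \<subseteq> {L3}" unfolding z[symmetric] by auto
    then have "\<forall>x\<in>set r'. x = L3" "j = L3" by auto
    moreover have "length (replicate (Suc a) L3) = length ((r' @ [j]) @ z)" unfolding z ..
    then have "length r' \<le> a" by simp
    ultimately show ?thesis using L3 Cons c
      by (metis replicate_length_same)
  qed (use p L3 in simp)
qed (use assms in \<open>auto simp: prefix_Cons Cons_eq_append_conv append_eq_Cons_conv split: if_splits\<close>)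

definition push :: "(letter \<Rightarrow> 'v::real_vector) \<Rightarrow> digit \<Rightarrow> letter \<Rightarrow> 'v" where
  "push g d j = wsum g (acc_subst d j)"

lemma push_simps:
  "push g (a, b) L1 = (if b then g L3 else g L1)"
  "push g (a, b) L2 = (if b then g L1 else g L3)"
  "push g (a, b) L3 = g L2 + of_nat (Suc a) *\<^sub>R g L3"
  by (simp_all add: push_def algebra_simps)

text \<open>\<open>level d g n j\<close> is the total weight of the word \<open>\<gamma>\<^sub>0 \<dots> \<gamma>\<^bsub>n-1\<^esub>(j)\<close>, where \<open>\<gamma>\<^sub>k\<close> is the
  substitution of the digit \<open>d k\<close>.\<close>

primrec level :: "(nat \<Rightarrow> digit) \<Rightarrow> (letter \<Rightarrow> 'v::real_vector) \<Rightarrow> nat \<Rightarrow> letter \<Rightarrow> 'v" where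
  "level d g 0 = g"
| "level d g (Suc n) = push (level d g n) (d n)"

abbreviation acc_prefix :: "(nat \<Rightarrow> digit) \<Rightarrow> nat \<Rightarrow> letter list \<Rightarrow> letter list" where
  "acc_prefix d \<equiv> subst_prefix (\<lambda>n. acc_subst (d n))"

lemma wsum_acc_prefix: "wsum g (acc_prefix d n w) = wsum (level d g n) w"
proof (induction n arbitrary: w)
  case (Suc n)
  have "push (level d g n) (d n) = (\<lambda>j. wsum (level d g n) (acc_subst (d n) j))"
    by (rule ext) (simp add: push_def)
  then show ?case by (simp add: Suc wsum_subst_word)
qed simp

lemma level_shift: "level (\<lambda>k. d (Suc k)) (push g (d 0)) n = level d g (Suc n)"
  by (induction n) simp_all

lemma level_add: "level (\<lambda>k. d (m + k)) (level d g m) n = level d g (m + n)"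
  by (induction n) simp_all

definition wmax :: "(letter \<Rightarrow> real) \<Rightarrow> real" where
  "wmax g = max (max \<bar>g L1\<bar> \<bar>g L2\<bar>) \<bar>g L3\<bar>"

lemma wmax_ge: "\<bar>g j\<bar> \<le> wmax g"
  by (cases j) (auto simp: wmax_def)

lemma wmax_le_iff: "wmax g \<le> c \<longleftrightarrow> (\<forall>j. \<bar>g j\<bar> \<le> c)"
proof
  show "wmax g \<le> c \<Longrightarrow> \<forall>j. \<bar>g j\<bar> \<le> c" using wmax_ge order_trans by blast
  show "\<forall>j. \<bar>g j\<bar> \<le> c \<Longrightarrow> wmax g \<le> c" unfolding wmax_def by simp
qed

lemma wmax_nonneg: "0 \<le> wmax g"
  by (simp add: wmax_def)

text \<open>The weight vanishes on the direction \<open>(x1, x2, 1)\<close> of the letter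
  frequencies: such a \<open>g\<close> is a projection along this direction.\<close>

definition orth :: "real \<times> real \<Rightarrow> (letter \<Rightarrow> 'v::real_vector) \<Rightarrow> bool" where
  "orth x g \<longleftrightarrow> fst x *\<^sub>R g L1 + snd x *\<^sub>R g L2 + g L3 = 0"

text \<open>The incidence matrix of \<open>acc_subst (a, b)\<close> acting on the direction
  \<open>(z1, z2, 1)\<close>, normalised to last coordinate 1. It is the inverse branch belonging to
  the digit.\<close>

fun acc_branch :: "digit \<Rightarrow> real \<times> real \<Rightarrow> real \<times> real" where
  "acc_branch (a, b) (z1, z2) =
     (if b then (z2 / (z1 + 1 + of_nat a), 1 / (z1 + 1 + of_nat a))
      else (z1 / (z2 + 1 + of_nat a), 1 / (z2 + 1 + of_nat a)))"

definition open_Delta2 :: "(real \<times> real) set" where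
  "open_Delta2 = {(x1, x2). 0 < x1 \<and> x1 < x2 \<and> x2 < 1}"

lemma orth_push:
  assumes "orth (acc_branch d z) g" "z \<in> open_Delta2"
  shows "orth z (push g d)"
proof -
  obtain a b z1 z2 where [simp]: "d = (a, b)" "z = (z1, z2)" by (cases d, cases z)
  have z: "0 < z1" "z1 < z2" "z2 < 1" using assms(2) by (simp_all add: open_Delta2_def)
  show ?thesis
  proof (cases b)
    case True
    define s where "s = z1 + 1 + of_nat a"
    have s: "s > 0" using z by (simp add: s_def)
    have "0 = s *\<^sub>R ((z2 / s) *\<^sub>R g L1 + (1 / s) *\<^sub>R g L2 + g L3)"
      using assms(1) True by (simp add: orth_def s_def)
    also have "\<dots> = z2 *\<^sub>R g L1 + g L2 + s *\<^sub>R g L3" using s by (simp add: scaleR_right_distrib)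
    also have "\<dots> = z1 *\<^sub>R g L3 + z2 *\<^sub>R g L1 + (g L2 + of_nat (Suc a) *\<^sub>R g L3)"
      by (simp add: s_def algebra_simps)
    finally show ?thesis using True by (simp add: orth_def push_simps)
  next
    case False
    define s where "s = z2 + 1 + of_nat a"
    have s: "s > 0" using z by (simp add: s_def)
    have "0 = s *\<^sub>R ((z1 / s) *\<^sub>R g L1 + (1 / s) *\<^sub>R g L2 + g L3)"
      using assms(1) False by (simp add: orth_def s_def)
    also have "\<dots> = z1 *\<^sub>R g L1 + g L2 + s *\<^sub>R g L3" using s by (simp add: scaleR_right_distrib)
    also have "\<dots> = z1 *\<^sub>R g L1 + z2 *\<^sub>R g L3 + (g L2 + of_nat (Suc a) *\<^sub>R g L3)"
      by (simp add: s_def algebra_simps)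
    finally show ?thesis using False by (simp add: orth_def push_simps)
  qed
qed

text \<open>The second bound is what \<open>run_bound\<close> needs for a run of
  \<open>Suc a\<close> letters \<open>L3\<close>.\<close>

lemma acc_branch_bounds:
  assumes "z \<in> open_Delta2"
  shows "acc_branch (a, b) z \<in> open_Delta2 \<and> of_nat (Suc a) * snd (acc_branch (a, b) z) \<le> 1"
  using assms by (cases z) (auto simp: open_Delta2_def divide_simps)

text \<open>Since \<open>g L3 = - (x1 g L1 + x2 g L2)\<close>, the new weight is \<open>(1 - k x2) g L2 - k x1 g L1\<close>, a
  combination of total mass at most one.\<close>

lemma run_bound:
  assumes "orth (x1, x2) g" "0 < x1" "x1 < x2" "of_nat k * x2 \<le> 1"
  shows "\<bar>g L2 + of_nat k * g L3\<bar> \<le> wmax g"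
proof -
  have g3: "g L3 = - (x1 * g L1 + x2 * g L2)" using assms(1) by (simp add: orth_def)
  have kx: "0 \<le> of_nat k * x1" "of_nat k * x1 \<le> of_nat k * x2" using assms by (simp_all add: mult_left_mono)
  have "g L2 + of_nat k * g L3 = (1 - of_nat k * x2) * g L2 - (of_nat k * x1) * g L1"
    by (simp add: g3 algebra_simps)
  also have "\<bar>\<dots>\<bar> \<le> \<bar>(1 - of_nat k * x2) * g L2\<bar> + \<bar>(of_nat k * x1) * g L1\<bar>" by (rule abs_triangle_ineq4)
  also have "\<dots> = (1 - of_nat k * x2) * \<bar>g L2\<bar> + (of_nat k * x1) * \<bar>g L1\<bar>"
    using assms kx by (simp add: abs_mult)
  also have "\<dots> \<le> (1 - of_nat k * x2) * wmax g + (of_nat k * x1) * wmax g"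
    using assms kx by (intro add_mono mult_left_mono wmax_ge) simp_all
  also have "\<dots> = (1 - (of_nat k * x2 - of_nat k * x1)) * wmax g" by (simp add: algebra_simps)
  also have "\<dots> \<le> 1 * wmax g" using kx by (intro mult_right_mono wmax_nonneg) simp
  finally show ?thesis by simp
qed

lemma wmax_push:
  assumes "orth (acc_branch d z) g" "z \<in> open_Delta2"
  shows "wmax (push g d) \<le> wmax g"
proof -
  obtain a b where d: "d = (a, b)" by (cases d)
  obtain x1 x2 where x: "acc_branch d z = (x1, x2)" by (cases "acc_branch d z")
  have o: "orth (x1, x2) g" using assms(1) by (simp only: x)
  have b: "0 < x1" "x1 < x2" "of_nat (Suc a) * x2 \<le> 1"
    using acc_branch_bounds[OF assms(2), of a b] x d by (simp_all add: open_Delta2_def)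
  have "\<bar>push g d j\<bar> \<le> wmax g" for j
    using run_bound[OF o, of "Suc a"] b wmax_ge[of g]
    by (cases j) (simp_all add: d x push_simps del: of_nat_Suc)
  then show ?thesis by (simp add: wmax_le_iff)
qed

lemma wsum_prefix_acc_subst:
  assumes "orth (acc_branch d z) g" "z \<in> open_Delta2" "prefix (r @ [j]) (acc_subst d i)"
  shows "\<bar>wsum g r\<bar> \<le> wmax g"
proof -
  obtain a b where d: "d = (a, b)" by (cases d)
  obtain x1 x2 where x: "acc_branch d z = (x1, x2)" by (cases "acc_branch d z")
  have o: "orth (x1, x2) g" using assms(1) by (simp only: x)
  have b: "0 < x1" "x1 < x2" "of_nat (Suc a) * x2 \<le> 1"
    using acc_branch_bounds[OF assms(2), of a b] x d by (simp_all add: open_Delta2_def)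
  have "r = [] \<or> (\<exists>k\<le>a. r = L2 # replicate k L3)"
    using prefix_acc_subst assms(3) unfolding d by blast
  then show ?thesis
  proof (elim disjE exE conjE)
    fix k assume k: "k \<le> a" "r = L2 # replicate k L3"
    have "of_nat k * x2 \<le> 1"
      by (rule order_trans[OF _ b(3)]) (use k b in \<open>intro mult_right_mono, simp_all\<close>)
    then show ?thesis using run_bound[OF o, of k] b k by simp
  qed (simp add: wmax_nonneg)
qed

text \<open>The word \<open>W\<^sub>K\<close>. The middle digit exchanges the roles of the first two
  columns, so that the two long runs move in different directions.\<close>

definition block :: "nat \<Rightarrow> (nat \<Rightarrow> digit) \<Rightarrow> nat \<Rightarrow> bool" where
  "block K d n \<longleftrightarrow> d n = (K, False) \<and> d (Suc n) = (0, True) \<and> d (Suc (Suc n)) = (K, False)"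

section \<open>Prefixes of limit words and their positions\<close>

text \<open>For a fixed digit, taking the first letter of the image permutes the letters; this is
  the inverse permutation. Pulling back a letter \<open>i\<close> through it gives nested words that
  all begin with \<open>i\<close>.\<close>

fun first_inv :: "digit \<Rightarrow> letter \<Rightarrow> letter" where
  "first_inv (a, b) L1 = (if b then L2 else L1)"
| "first_inv (a, b) L2 = L3"
| "first_inv (a, b) L3 = (if b then L1 else L2)"

lemma acc_subst_first_inv: "\<exists>w. acc_subst d (first_inv d i) = i # w"
  by (cases d; cases i) auto

primrec first_letter :: "(nat \<Rightarrow> digit) \<Rightarrow> letter \<Rightarrow> nat \<Rightarrow> letter" where
  "first_letter d i 0 = i"
| "first_letter d i (Suc n) = first_inv (d n) (first_letter d i n)"

definition lim_prefix :: "(nat \<Rightarrow> digit) \<Rightarrow> letter \<Rightarrow> nat \<Rightarrow> letter list" where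
  "lim_prefix d i n = acc_prefix d n [first_letter d i n]"

text \<open>The positions of the limit word starting with \<open>i\<close>: \<open>r\<close> is what
  has been read so far and \<open>j\<close> is the next letter. Finite prefixes suffice, so nothing
  has to be known yet about their growth.\<close>

definition Pre :: "(nat \<Rightarrow> digit) \<Rightarrow> letter \<Rightarrow> (letter list \<times> letter) set" where
  "Pre d i = {(r, j). \<exists>n. prefix (r @ [j]) (lim_prefix d i n)}"

lemma lim_prefix_Suc: "prefix (lim_prefix d i n) (lim_prefix d i (Suc n))"
proof -
  obtain w where "acc_subst (d n) (first_inv (d n) (first_letter d i n)) = first_letter d i n # w"
    using acc_subst_first_inv by blast
  then have "lim_prefix d i (Suc n) = acc_prefix d n ([first_letter d i n] @ w)"
    by (simp add: lim_prefix_def)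
  then show ?thesis by (simp only: lim_prefix_def subst_prefix_append) simp
qed

lemma lim_prefix_mono: "m \<le> n \<Longrightarrow> prefix (lim_prefix d i m) (lim_prefix d i n)"
  by (induction n rule: dec_induct) (auto intro: prefix_order.trans lim_prefix_Suc)

lemma first_letter_add: "first_letter d i (m + n) = first_letter (\<lambda>k. d (m + k)) (first_letter d i m) n"
  by (induction n) simp_all

lemma lim_prefix_add: "lim_prefix d i (m + n) = acc_prefix d m (lim_prefix (\<lambda>k. d (m + k)) (first_letter d i m) n)"
  by (simp add: lim_prefix_def first_letter_add subst_prefix_add)

text \<open>Desubstitution through \<open>m\<close> levels: a position is the image of a position of
  the limit word of the shifted digits, plus a position inside the tower over its next
  letter.\<close>

lemma Pre_decomp:
  assumes "(r, j) \<in> Pre d i"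
  obtains r' j' r'' where "(r', j') \<in> Pre (\<lambda>k. d (m + k)) (first_letter d i m)"
    "prefix (r'' @ [j]) (acc_prefix d m [j'])" "r = acc_prefix d m r' @ r''"
proof -
  obtain n where "prefix (r @ [j]) (lim_prefix d i n)" using assms by (auto simp: Pre_def)
  then have "prefix (r @ [j]) (lim_prefix d i (m + n))"
    using lim_prefix_mono[of n "m + n"] prefix_order.trans by (metis le_add2)
  then have "prefix (r @ [j]) (subst_word (\<lambda>j. acc_prefix d m [j]) (lim_prefix (\<lambda>k. d (m + k)) (first_letter d i m) n))"
    unfolding lim_prefix_add by (subst (asm) subst_prefix_conv_subst_word)
  from prefix_subst_word[OF this] obtain r' j' r'' where
    *: "prefix (r' @ [j']) (lim_prefix (\<lambda>k. d (m + k)) (first_letter d i m) n)"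
    "prefix (r'' @ [j]) (acc_prefix d m [j'])" "r = subst_word (\<lambda>j. acc_prefix d m [j]) r' @ r''"
    by blast
  have "r = acc_prefix d m r' @ r''" using *(3) by (simp add: subst_prefix_conv_subst_word[of _ _ r'])
  with * show ?thesis by (intro that[of r' j' r'']) (auto simp: Pre_def)
qed

section \<open>Renormalised directions and the contraction of weights\<close>

locale brun_seq =
  fixes d :: "nat \<Rightarrow> digit" and z :: "nat \<Rightarrow> real \<times> real"
  assumes z_in: "\<And>n. z n \<in> open_Delta2"
    and z_step: "\<And>n. z n = acc_branch (d n) (z (Suc n))"

lemma brun_seq_shift: "brun_seq d z \<Longrightarrow> brun_seq (\<lambda>k. d (m + k)) (\<lambda>k. z (m + k))"
proof (rule brun_seq.intro)
  assume "brun_seq d z"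
  then interpret brun_seq d z .
  show "z (m + n) \<in> open_Delta2" for n by (rule z_in)
  show "z (m + n) = acc_branch (d (m + n)) (z (m + Suc n))" for n using z_step[of "m + n"] by simp
qed

context brun_seq
begin

lemma orth_level: "orth (z 0) g \<Longrightarrow> orth (z n) (level d g n)"
proof (induction n)
  case (Suc n)
  then have "orth (acc_branch (d n) (z (Suc n))) (level d g n)" using z_step[of n] by simp
  from orth_push[OF this z_in] show ?case by simp
qed simp

lemma wmax_level_Suc: "orth (z 0) g \<Longrightarrow> wmax (level d g (Suc n)) \<le> wmax (level d g n)"
  using orth_level[of g n] wmax_push[of "d n" "z (Suc n)"] z_in z_step[of n] by simp

lemma wmax_level_antimono: "orth (z 0) g \<Longrightarrow> m \<le> n \<Longrightarrow> wmax (level d g n) \<le> wmax (level d g m)"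
  by (rule lift_Suc_antimono_le[of "\<lambda>n. wmax (level d g n)"]) (rule wmax_level_Suc)

end

text \<open>The Dumont-Thomas expansion: peeling off one digit after the other writes
  \<open>r\<close> as a sum of one short prefix per level. Each has weight at most the norm at its
  level, however long the run is.\<close>

lemma prefix_bound:
  assumes "brun_seq d z" "orth (z 0) g" "prefix (r @ [j]) (lim_prefix d i n)"
  shows "\<bar>wsum g r\<bar> \<le> (\<Sum>k<n. wmax (level d g k))"
  using assms
proof (induction n arbitrary: d z g r j i)
  case 0
  then have "r = []" by (simp add: lim_prefix_def prefix_Cons)
  then show ?case by simp
next
  case (Suc n)
  interpret brun_seq d z by fact
  let ?d = "\<lambda>k. d (Suc k)"
  have "lim_prefix d i (Suc n) = subst_word (acc_subst (d 0)) (lim_prefix ?d (first_letter d i 1) n)"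
    using lim_prefix_add[of d i 1 n] by simp
  then have "prefix (r @ [j]) (subst_word (acc_subst (d 0)) (lim_prefix ?d (first_letter d i 1) n))"
    using Suc.prems(3) by simp
  from prefix_subst_word[OF this] obtain r' j' r'' where
    *: "prefix (r' @ [j']) (lim_prefix ?d (first_letter d i 1) n)"
    "prefix (r'' @ [j]) (acc_subst (d 0) j')" "r = subst_word (acc_subst (d 0)) r' @ r''"
    by blast
  have o: "orth (acc_branch (d 0) (z (Suc 0))) g" using Suc.prems(2) z_step[of 0] by simp
  have "\<bar>wsum (push g (d 0)) r'\<bar> \<le> (\<Sum>k<n. wmax (level ?d (push g (d 0)) k))"
    by (rule Suc.IH[OF _ _ *(1), where z = "\<lambda>k. z (Suc k)"])
       (use brun_seq_shift[OF Suc.prems(1), of 1] orth_push[OF o z_in] in simp_all)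
  moreover have "\<bar>wsum g r''\<bar> \<le> wmax g"
    by (rule wsum_prefix_acc_subst[OF o z_in *(2)])
  moreover have "wsum g r = wsum (push g (d 0)) r' + wsum g r''"
    using *(3) by (simp add: wsum_subst_word push_def[abs_def])
  moreover have "(\<Sum>k<Suc n. wmax (level d g k)) = wmax g + (\<Sum>k<n. wmax (level ?d (push g (d 0)) k))"
    unfolding sum.lessThan_Suc_shift level_shift by simp
  ultimately show ?case by linarith
qed

context brun_seq
begin

text \<open>The quantification over all weights makes the bound applicable to the weights that the
  preceding digits hand over to the tail.\<close>

definition tail_bound :: "real \<Rightarrow> bool" where
  "tail_bound C \<longleftrightarrow> (\<forall>g. orth (z 0) g \<longrightarrow> (\<forall>n. (\<Sum>k<n. wmax (level d g k)) \<le> C * wmax g))"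

lemma Pre_bound:
  assumes "tail_bound C" "orth (z 0) g" "(r, j) \<in> Pre d i"
  shows "\<bar>wsum g r\<bar> \<le> C * wmax g"
proof -
  obtain n where n: "prefix (r @ [j]) (lim_prefix d i n)" using assms(3) by (auto simp: Pre_def)
  show ?thesis
    using prefix_bound[OF brun_seq_axioms assms(2) n] assms(1,2) unfolding tail_bound_def
    by (meson order_trans)
qed

text \<open>\<open>Y\<close> is the last coordinate of the image of \<open>(z1, z2, 1)\<close> under
  the incidence matrix of the block, hence the common denominator of \<open>z 0\<close>. It has
  order \<open>K\<^sup>2\<close>.\<close>

context
  fixes K :: nat and z1 z2 Y :: real
  assumes block: "block K d 0" and z3: "z 3 = (z1, z2)"
    and Y: "Y = (real K + 1) * z1 + (real K + 2) * z2 + (real K + 1) * (real K + 2)"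
begin

lemma z3_bounds: "0 < z1" "z1 < z2" "z2 < 1"
  using z_in[of 3] by (simp_all add: z3 open_Delta2_def)

lemma Y_ge: "(real K + 1) * (real K + 2) \<le> Y" and Y_pos: "0 < Y"
proof -
  have *: "0 \<le> (real K + 1) * z1" "0 \<le> (real K + 2) * z2" using z3_bounds by simp_all
  then show 1: "(real K + 1) * (real K + 2) \<le> Y" unfolding Y by simp
  have "0 < (real K + 1) * (real K + 2)" by (intro mult_pos_pos) simp_all
  also have "\<dots> \<le> Y" using 1 by simp
  finally show "0 < Y" .
qed

lemma block_z0: "z 0 = (1 / Y, (z1 + z2 + real K + 1) / Y)"
proof -
  have d: "d 0 = (K, False)" "d (Suc 0) = (0, True)" "d 2 = (K, False)"
    using block by (simp_all add: block_def numeral_2_eq_2)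
  define D where "D = z2 + 1 + real K"
  define S where "S = z1 + z2 + real K + 1"
  have pos: "D > 0" "S > 0" unfolding D_def S_def using z3_bounds by simp_all
  have Y': "Y = D + (real K + 1) * S" unfolding Y S_def D_def by (simp add: algebra_simps)
  have z2: "z 2 = (z1 / D, 1 / D)"
    using z_step[of 2] by (simp add: d z3 D_def)
  have "z1 / D + 1 = S / D" using pos by (simp add: S_def D_def field_simps)
  moreover have "z (Suc 0) = (1 / D / (z1 / D + 1), 1 / (z1 / D + 1))"
    using z_step[of "Suc 0"] z2 by (simp add: d numeral_2_eq_2)
  ultimately have z1: "z (Suc 0) = (1 / S, D / S)" using pos by simp
  have "D / S + 1 + real K = Y / S" using pos unfolding Y' by (simp add: field_simps)
  moreover have "z 0 = (1 / S / (D / S + 1 + real K), 1 / (D / S + 1 + real K))"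
    using z_step[of 0] z1 by (simp add: d)
  ultimately have "z 0 = (1 / Y, S / Y)" using pos by simp
  then show ?thesis by (simp add: S_def)
qed

lemma block_levels:
  fixes g :: "letter \<Rightarrow> real"
  shows "level d g 1 L1 = g L1" "level d g 1 L2 = g L3" "level d g 1 L3 = g L2 + (real K + 1) * g L3"
    "level d g 2 L1 = g L2 + (real K + 1) * g L3" "level d g 2 L2 = g L1" "level d g 2 L3 = g L2 + (real K + 2) * g L3"
    "level d g 3 L1 = g L2 + (real K + 1) * g L3" "level d g 3 L2 = g L2 + (real K + 2) * g L3"
    "level d g 3 L3 = g L1 + (real K + 1) * (g L2 + (real K + 2) * g L3)"
  using block by (simp_all add: block_def numeral_2_eq_2 numeral_3_eq_3 push_simps algebra_simps)

text \<open>After elimination of \<open>g L3\<close>, the values at level 3 multiplied by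
  \<open>Y\<close> are combinations of \<open>g L1\<close> and \<open>g L2\<close> with coefficients
  of total mass at most \<open>3 * (K + 2)\<close>, whereas \<open>Y\<close> is at least
  \<open>(K + 1) * (K + 2)\<close>.\<close>

lemma block_contracts:
  assumes o: "orth (z 0) g"
  shows "wmax (level d g 3) \<le> 3 / (real K + 1) * wmax g"
proof -
  have bound: "\<bar>g1\<bar> \<le> 3 / (real K + 1) * wmax g"
    if "Y * g1 = A * g L1 + B * g L2" "\<bar>A\<bar> + \<bar>B\<bar> \<le> 3 * (real K + 2)" for g1 A B
  proof -
    have "Y * \<bar>g1\<bar> = \<bar>A * g L1 + B * g L2\<bar>" using Y_pos by (simp add: abs_mult flip: that(1))
    also have "\<dots> \<le> \<bar>A\<bar> * \<bar>g L1\<bar> + \<bar>B\<bar> * \<bar>g L2\<bar>" by (metis abs_mult abs_triangle_ineq)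
    also have "\<dots> \<le> \<bar>A\<bar> * wmax g + \<bar>B\<bar> * wmax g" by (intro add_mono mult_left_mono wmax_ge) simp_all
    also have "\<dots> \<le> (3 * (real K + 2)) * wmax g"
      using mult_right_mono[OF that(2) wmax_nonneg[of g]] by (simp add: algebra_simps)
    finally have 1: "Y * \<bar>g1\<bar> \<le> (3 * (real K + 2)) * wmax g" .
    have "((real K + 1) * (real K + 2)) * \<bar>g1\<bar> \<le> Y * \<bar>g1\<bar>" by (rule mult_right_mono[OF Y_ge]) simp
    with 1 have "(real K + 2) * ((real K + 1) * \<bar>g1\<bar>) \<le> (real K + 2) * (3 * wmax g)" by (simp add: algebra_simps)
    then have "(real K + 1) * \<bar>g1\<bar> \<le> 3 * wmax g" by (subst (asm) mult_le_cancel_left_pos) simp_all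
    then show ?thesis by (simp add: field_simps)
  qed
  have "Y * ((1 / Y) * g L1 + (z1 + z2 + real K + 1) / Y * g L2 + g L3) = 0"
    using o by (simp add: block_z0 orth_def)
  then have Y3: "Y * g L3 = - g L1 - (z1 + z2 + real K + 1) * g L2"
    using Y_pos by (simp add: distrib_left)
  have L2: "Y * (g L2 + (real K + 2) * g L3) = - (real K + 2) * g L1 + (- z1) * g L2"
  proof -
    have "Y * (g L2 + (real K + 2) * g L3) = Y * g L2 + (real K + 2) * (Y * g L3)" by (simp add: algebra_simps)
    also have "\<dots> = - (real K + 2) * g L1 + (- z1) * g L2" unfolding Y3 by (simp add: Y algebra_simps)
    finally show ?thesis .
  qed
  have L1: "Y * (g L2 + (real K + 1) * g L3) = - (real K + 1) * g L1 + (z2 + real K + 1) * g L2"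
  proof -
    have "Y * (g L2 + (real K + 1) * g L3) = Y * (g L2 + (real K + 2) * g L3) - Y * g L3" by (simp add: algebra_simps)
    also have "\<dots> = - (real K + 1) * g L1 + (z2 + real K + 1) * g L2" unfolding L2 Y3 by (simp add: algebra_simps)
    finally show ?thesis .
  qed
  have L3: "Y * (g L1 + (real K + 1) * (g L2 + (real K + 2) * g L3)) = ((real K + 1) * z1 + (real K + 2) * z2) * g L1 + (- (real K + 1) * z1) * g L2"
  proof -
    have "Y * (g L1 + (real K + 1) * (g L2 + (real K + 2) * g L3)) = Y * g L1 + (real K + 1) * (Y * (g L2 + (real K + 2) * g L3))"
      by (simp add: algebra_simps)
    also have "\<dots> = ((real K + 1) * z1 + (real K + 2) * z2) * g L1 + (- (real K + 1) * z1) * g L2"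
      unfolding L2 by (simp add: Y algebra_simps)
    finally show ?thesis .
  qed
  have z: "(real K + 1) * z1 \<le> real K + 1" "(real K + 2) * z2 \<le> real K + 2" "0 \<le> (real K + 1) * z1" "0 \<le> (real K + 2) * z2"
    using z3_bounds by (simp_all add: mult_le_cancel_left1)
  have "\<bar>level d g 3 j\<bar> \<le> 3 / (real K + 1) * wmax g" for j
  proof (cases j)
    case L1
    show ?thesis unfolding L1 block_levels
      by (rule bound[OF \<open>Y * (g L2 + (real K + 1) * g L3) = _\<close>]) (use z3_bounds in simp)
  next
    case L2
    show ?thesis unfolding L2 block_levels
      by (rule bound[OF \<open>Y * (g L2 + (real K + 2) * g L3) = _\<close>]) (use z3_bounds in simp)
  next
    case L3
    have "\<bar>(real K + 1) * z1 + (real K + 2) * z2\<bar> + \<bar>- (real K + 1) * z1\<bar> = 2 * ((real K + 1) * z1) + (real K + 2) * z2"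
      using z z3_bounds by (simp add: abs_mult)
    also have "\<dots> \<le> 2 * (real K + 1) + (real K + 2)" using z(1,2) by (intro add_mono mult_left_mono) simp_all
    also have "\<dots> \<le> 3 * (real K + 2)" by simp
    finally show ?thesis unfolding L3 block_levels
      by (rule bound[OF \<open>Y * (g L1 + _) = _\<close>])
  qed
  then show ?thesis by (simp add: wmax_le_iff)
qed

end

end

context brun_seq
begin

lemma block_contracts_at:
  assumes "block K d m" "orth (z 0) g"
  shows "wmax (level d g (m + 3)) \<le> 3 / (real K + 1) * wmax (level d g m)"
proof -
  interpret S: brun_seq "\<lambda>k. d (m + k)" "\<lambda>k. z (m + k)" by (rule brun_seq_shift) unfold_locales
  obtain z1 z2 where z3: "z (m + 3) = (z1, z2)" by (cases "z (m + 3)")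
  have "wmax (level (\<lambda>k. d (m + k)) (level d g m) 3) \<le> 3 / (real K + 1) * wmax (level d g m)"
    by (rule S.block_contracts[OF _ z3 refl])
       (use assms orth_level[OF assms(2), of m] in \<open>simp_all add: block_def\<close>)
  then show ?thesis by (simp only: level_add)
qed

end

section \<open>Summability of weights along a regular tail\<close>

definition superblock :: "nat \<Rightarrow> nat \<Rightarrow> nat" where
  "superblock J s = (\<Sum>r<s. J + r)"

text \<open>Time is counted in units of three digits. The window of index \<open>s\<close> consists
  of \<open>J + s\<close> such units, and a block with parameter 5, which halves the weights, has to
  occur in it.\<close>

definition regular_tail :: "nat \<Rightarrow> (nat \<Rightarrow> digit) \<Rightarrow> bool" where
  "regular_tail J d \<longleftrightarrow> (\<forall>s. \<exists>k. superblock J s \<le> k \<and> k < superblock J (Suc s) \<and> block 5 d (3 * k))"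

lemma sum_geometric_weights: "(\<Sum>r<s. (real J + real r) / 2 ^ r) = 2 * J + 2 - (2 * J + 2 * s + 2) / 2 ^ s"
proof (induction s)
  case (Suc s)
  show ?case unfolding sum.lessThan_Suc Suc.IH by (simp add: field_simps)
qed simp

text \<open>The norms never increase and are halved in every window, so the sum is at most
  \<open>3 * b 0\<close> times the sum of \<open>(J + s) / 2 ^ s\<close>, which stays below
  \<open>2 * J + 2\<close>.\<close>

lemma (in brun_seq) tail_bound_regular:
  assumes "1 \<le> J" "regular_tail J d"
  shows "tail_bound (6 * (real J + 1))"
  unfolding tail_bound_def
proof (intro allI impI)
  fix g :: "letter \<Rightarrow> real" and n assume o: "orth (z 0) g"
  define b where "b k = wmax (level d g k)" for k
  have anti: "b n \<le> b m" if "m \<le> n" for m n unfolding b_def by (rule wmax_level_antimono[OF o that])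
  have b0: "0 \<le> b k" for k unfolding b_def by (rule wmax_nonneg)
  let ?T = "superblock J"
  have T_Suc: "?T (Suc s) = ?T s + (J + s)" for s by (simp add: superblock_def)
  have T_ge: "s \<le> ?T s" for s using assms(1) by (induction s) (simp_all add: T_Suc superblock_def)
  have half: "b (3 * ?T s) \<le> b 0 / 2 ^ s" for s
  proof (induction s)
    case (Suc s)
    obtain k where k: "?T s \<le> k" "k < ?T (Suc s)" "block 5 d (3 * k)"
      using assms(2) unfolding regular_tail_def by blast
    have "b (3 * ?T (Suc s)) \<le> b (3 * k + 3)" by (rule anti) (use k in simp)
    also have "\<dots> \<le> 3 / (real 5 + 1) * b (3 * k)"
      unfolding b_def by (rule block_contracts_at[OF k(3) o])
    also have "\<dots> \<le> b (3 * ?T s) / 2" using anti[of "3 * ?T s" "3 * k"] k by simp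
    also have "\<dots> \<le> b 0 / 2 ^ Suc s" using Suc by simp
    finally show ?case .
  qed (simp add: superblock_def)
  have "(\<Sum>k<3 * ?T s. b k) \<le> (\<Sum>r<s. (real J + real r) / 2 ^ r) * (3 * b 0)" for s
  proof (induction s)
    case (Suc s)
    have "(\<Sum>k<3 * ?T (Suc s). b k) = (\<Sum>k<3 * ?T s. b k) + (\<Sum>k=3 * ?T s..<3 * ?T (Suc s). b k)"
      using sum.atLeastLessThan_concat[of 0 "3 * ?T s" "3 * ?T (Suc s)" b]
      by (simp add: T_Suc atLeast0LessThan)
    also have "(\<Sum>k=3 * ?T s..<3 * ?T (Suc s). b k) \<le> (\<Sum>k=3 * ?T s..<3 * ?T (Suc s). b 0 / 2 ^ s)"
      by (intro sum_mono order_trans[OF anti half]) simp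
    also have "\<dots> = (real J + real s) / 2 ^ s * (3 * b 0)" by (simp add: T_Suc)
    finally show ?case using Suc by (simp add: algebra_simps)
  qed (simp add: superblock_def)
  note this[of n]
  also have "(\<Sum>r<n. (real J + real r) / 2 ^ r) * (3 * b 0) \<le> (2 * real J + 2) * (3 * b 0)"
    unfolding sum_geometric_weights using b0[of 0] by (intro mult_right_mono) simp_all
  finally have "(\<Sum>k<3 * ?T n. b k) \<le> (2 * real J + 2) * (3 * b 0)" .
  moreover have "(\<Sum>k<n. b k) \<le> (\<Sum>k<3 * ?T n. b k)"
    using T_ge[of n] b0 by (intro sum_mono2) auto
  ultimately show "(\<Sum>k<n. wmax (level d g k)) \<le> 6 * (real J + 1) * wmax g"
    by (simp add: b_def algebra_simps)
qed

section \<open>Coordinates of the positions at the start of a long block\<close>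

fun coord1 :: "real \<times> real \<Rightarrow> letter \<Rightarrow> real" where
  "coord1 x L1 = 1" | "coord1 x L2 = 0" | "coord1 x L3 = - fst x"

fun coord2 :: "real \<times> real \<Rightarrow> letter \<Rightarrow> real" where
  "coord2 x L1 = 0" | "coord2 x L2 = 1" | "coord2 x L3 = - snd x"

lemma orth_coord: "orth x (coord1 x)" "orth x (coord2 x)"
  by (simp_all add: orth_def)

lemma wmax_coord:
  assumes "x \<in> open_Delta2"
  shows "wmax (coord1 x) = 1" "wmax (coord2 x) = 1"
  using assms by (auto simp: wmax_def open_Delta2_def)

text \<open>\<open>coord1\<close> and \<open>coord2\<close> are the weights orthogonal to
  \<open>x\<close> with values \<open>(1, 0)\<close> and \<open>(0, 1)\<close> on the first two
  letters. They reduce positions for any planar weight to two universal scalar ones.\<close>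

lemma wsum_coord:
  assumes "orth x G"
  shows "wsum G r = wsum (coord1 x) r *\<^sub>R G L1 + wsum (coord2 x) r *\<^sub>R G L2"
proof (induction r)
  case (Cons j r)
  have G3: "G L3 = - (fst x *\<^sub>R G L1 + snd x *\<^sub>R G L2)"
    using assms unfolding orth_def by (rule minus_unique[symmetric])
  show ?case by (cases j) (simp_all add: Cons G3 algebra_simps)
qed simp

text \<open>The block makes the first two coordinates of a position, with respect to the first two
  projected columns, range over the unit square up to \<open>eta\<close>; positions followed by \<open>L2\<close> lie near
  an edge, and those followed by \<open>L1\<close> near a vertex.\<close>

lemma (in brun_seq) Pre_region:
  assumes block: "block K d 0" and tail: "brun_seq.tail_bound (\<lambda>k. d (3 + k)) (\<lambda>k. z (3 + k)) C"
    and pre: "(r, j) \<in> Pre d i" and eta: "eta = (C + 1) * (3 / (real K + 1))"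
  shows "- eta \<le> wsum (coord1 (z 0)) r \<and> wsum (coord1 (z 0)) r \<le> 1 + eta"
    and "- eta \<le> wsum (coord2 (z 0)) r \<and> wsum (coord2 (z 0)) r \<le> 1 + eta"
    and "j = L2 \<Longrightarrow> wsum (coord2 (z 0)) r \<le> eta"
    and "j = L1 \<Longrightarrow> wsum (coord1 (z 0)) r \<le> eta \<and> wsum (coord2 (z 0)) r \<le> eta"
proof -
  interpret S: brun_seq "\<lambda>k. d (3 + k)" "\<lambda>k. z (3 + k)" by (rule brun_seq_shift) unfold_locales
  obtain z1 z2 where z3: "z 3 = (z1, z2)" by (cases "z 3")
  define Y where "Y = (real K + 1) * z1 + (real K + 2) * z2 + (real K + 1) * (real K + 2)"
  note blk = block z3 Y_def
  have zb: "0 < z1" "z1 < z2" "z2 < 1" using z3_bounds[OF blk] .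
  have Yg: "(real K + 1) * (real K + 2) \<le> Y" and Yp: "0 < Y" using Y_ge[OF blk] Y_pos[OF blk] .
  define p where "p = 1 / Y"
  define q where "q = (z1 + z2 + real K + 1) / Y"
  have z0: "z 0 = (p, q)" unfolding p_def q_def by (rule block_z0[OF blk])
  define del where "del = 3 / (real K + 1)"
  have del: "0 < del" by (simp add: del_def)
  obtain r' j' r'' where dec: "(r', j') \<in> Pre (\<lambda>k. d (3 + k)) (first_letter d i 3)"
    "prefix (r'' @ [j]) (acc_prefix d 3 [j'])" "r = acc_prefix d 3 r' @ r''"
    by (rule Pre_decomp[OF pre, of 3])
  have far: "\<bar>wsum (level d g 3) r'\<bar> \<le> C * del" if "orth (z 0) g" "wmax g = 1" for g :: "letter \<Rightarrow> real"
  proof -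
    have o3: "orth (z (3 + 0)) (level d g 3)" using orth_level[OF that(1), of 3] by simp
    have "\<bar>wsum (level d g 3) r'\<bar> \<le> C * wmax (level d g 3)"
      by (rule S.Pre_bound[OF tail o3 dec(1)])
    also have "\<dots> \<le> C * del"
    proof (rule mult_left_mono)
      show "wmax (level d g 3) \<le> del"
        using block_contracts[OF blk that(1)] that(2) by (simp add: del_def)
      \<comment> \<open>The empty sum in \<open>tail_bound\<close>, for a weight of norm one, forces
        \<open>C\<close> to be nonnegative.\<close>
      have "0 \<le> C * wmax (coord1 (z (3 + 0)))"
        using tail[unfolded S.tail_bound_def, rule_format, OF orth_coord(1), of 0] by simp
      then show "0 \<le> C" using wmax_coord(1)[OF z_in[of "3 + 0"]] by simp
    qed
    finally show ?thesis .
  qed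
  have d: "d 0 = (K, False)" "d (Suc 0) = (0, True)" "d (Suc (Suc 0)) = (K, False)"
    using block by (simp_all add: block_def)
  have "acc_prefix d 3 [j'] = subst_word (acc_subst (d 0)) (subst_word (acc_subst (d (Suc 0))) (acc_subst (d (Suc (Suc 0))) j'))"
    by (simp add: numeral_3_eq_3)
  with dec(2) have "prefix (r'' @ [j]) (subst_word (acc_subst (d 0)) (subst_word (acc_subst (d (Suc 0))) (acc_subst (d (Suc (Suc 0))) j')))"
    by simp
  from prefix_subst_word[OF this] obtain s1 j1 r0 where
    s1: "prefix (s1 @ [j1]) (subst_word (acc_subst (d (Suc 0))) (acc_subst (d (Suc (Suc 0))) j'))"
    and r0: "prefix (r0 @ [j]) (acc_subst (d 0) j1)" "r'' = subst_word (acc_subst (d 0)) s1 @ r0" by blast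
  from prefix_subst_word[OF s1] obtain r2 j2 r1 where
    r2: "prefix (r2 @ [j2]) (acc_subst (d (Suc (Suc 0))) j')"
    and r1: "prefix (r1 @ [j1]) (acc_subst (d (Suc 0)) j2)" "s1 = subst_word (acc_subst (d (Suc 0))) r2 @ r1" by blast
  \<comment> \<open>One contribution from behind the block and one from each of its three
    levels.\<close>
  have split: "wsum g r = wsum (level d g 3) r' + wsum (level d g 2) r2 + wsum (level d g 1) r1 + wsum g r0"
    for g :: "letter \<Rightarrow> real"
    unfolding dec(3) r0(2) r1(2)
    by (simp add: wsum_acc_prefix wsum_subst_word push_def[abs_def] numeral_2_eq_2 numeral_3_eq_3)
  have c0: "r0 = [] \<or> (j = L3 \<and> (\<exists>k\<le>K. r0 = L2 # replicate k L3))"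
    and c0': "j = L1 \<Longrightarrow> r0 = [] \<and> j1 = L1"
    using prefix_acc_subst[OF r0(1)[unfolded d]] by (auto simp: d, cases j1, auto)
  have c1: "r1 = [] \<or> r1 = [L2]" and c1': "j1 = L1 \<Longrightarrow> r1 = [] \<and> j2 = L2"
    using prefix_acc_subst[OF r1(1)[unfolded d]] by (auto simp: d, cases j2, auto)
  have c2: "r2 = [] \<or> (\<exists>k\<le>K. r2 = L2 # replicate k L3)" and c2': "j2 = L2 \<Longrightarrow> r2 = []"
    using prefix_acc_subst[OF r2[unfolded d]] by auto
  have inv: "a / Y \<le> b" if "a \<le> b * ((real K + 1) * (real K + 2))" "0 \<le> b" for a b
  proof -
    have "a \<le> b * Y" using that mult_left_mono[OF Yg that(2)] by linarith
    then show ?thesis using Yp by (simp add: pos_divide_le_eq)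
  qed
  have del3: "1 / (real K + 1) = del / 3" by (simp add: del_def divide_simps)
  have p: "0 \<le> p" "p \<le> del / 3"
    using Yp inv[of 1 "1 / (real K + 1)"] unfolding p_def del3[symmetric] by simp_all
  have q: "0 \<le> q" "q \<le> 2 * (del / 3)"
  proof -
    show "0 \<le> q" unfolding q_def using Yp zb by simp
    have "q \<le> 2 * (1 / (real K + 1))" unfolding q_def by (rule inv) (use zb in simp_all)
    then show "q \<le> 2 * (del / 3)" by (simp only: del3)
  qed
  have kp: "0 \<le> k * p \<and> k * p \<le> del / 3" if "k \<le> K" for k :: nat
  proof -
    have "k / Y \<le> 1 / (real K + 1)" by (rule inv) (use that in simp_all)
    then show ?thesis using p by (simp add: p_def del3)
  qed
  have kq: "0 \<le> k * q \<and> k * q \<le> 1" if "k \<le> K" for k :: nat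
  proof -
    have "k * q \<le> (real K + 1) * q" using that q by (intro mult_right_mono) simp_all
    also have "\<dots> \<le> 1"
    proof -
      have "(real K + 1) * (z1 + z2 + real K + 1) \<le> Y" unfolding Y_def using zb by (simp add: algebra_simps)
      then show ?thesis using Yp by (simp add: q_def)
    qed
    finally show ?thesis using q by simp
  qed
  have k2: "0 \<le> k * ((real K + 2) * p) \<and> k * ((real K + 2) * p) \<le> 1" if "k \<le> K" for k :: nat
  proof -
    have "real k * (real K + 2) \<le> (real K + 1) * (real K + 2)" using that by (intro mult_right_mono) simp_all
    then have "(real k * (real K + 2)) / Y \<le> 1" by (intro inv) simp_all
    then show ?thesis using p by (simp add: p_def)
  qed
  \<comment> \<open>\<open>(K + 2) * q\<close> exceeds 1 only by \<open>z1 * p\<close>. So while a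
    run at level 2 sweeps the first coordinate, the second one hardly moves.\<close>
  have q2: "1 - (real K + 2) * q = - z1 * p"
    using Yp unfolding q_def p_def by (simp add: field_simps) (simp add: Y_def algebra_simps)
  have kz: "0 \<le> k * (z1 * p) \<and> k * (z1 * p) \<le> del / 3" if "k \<le> K" for k :: nat
  proof -
    have "z1 * (k * p) \<le> 1 * (k * p)" using zb kp[OF that] by (intro mult_right_mono) simp_all
    then show ?thesis using kp[OF that] zb p by (simp add: algebra_simps)
  qed
  note lev = block_levels[OF blk]
  \<comment> \<open>The facts \<open>A\<close> concern the first coordinate and the facts
    \<open>B\<close> the second; the number is the level. The sweeps are \<open>A2\<close> and
    \<open>B0\<close>; the other four are errors, whose total in each coordinate is at most
    \<open>del\<close>.\<close>
  have A0: "- (del / 3) \<le> wsum (coord1 (z 0)) r0 \<and> wsum (coord1 (z 0)) r0 \<le> 0"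
    using c0 kp del by (auto simp: z0)
  have B0: "0 \<le> wsum (coord2 (z 0)) r0 \<and> wsum (coord2 (z 0)) r0 \<le> 1"
    using c0 kq by (auto simp: z0)
  have A1: "- (del / 3) \<le> wsum (level d (coord1 (z 0)) 1) r1 \<and> wsum (level d (coord1 (z 0)) 1) r1 \<le> 0"
    using c1 p del by (auto simp: d push_simps z0)
  have B1: "- (2 * (del / 3)) \<le> wsum (level d (coord2 (z 0)) 1) r1 \<and> wsum (level d (coord2 (z 0)) 1) r1 \<le> 0"
    using c1 q del by (auto simp: d push_simps z0)
  have A2: "0 \<le> wsum (level d (coord1 (z 0)) 2) r2 \<and> wsum (level d (coord1 (z 0)) 2) r2 \<le> 1"
    using c2
  proof (elim disjE exE conjE)
    fix k assume k: "k \<le> K" "r2 = L2 # replicate k L3"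
    have "wsum (level d (coord1 (z 0)) 2) r2 = 1 - k * ((real K + 2) * p)"
      by (simp add: k lev) (simp add: z0)
    then show ?thesis using k2[OF k(1)] by simp
  qed simp
  have B2: "- (del / 3) \<le> wsum (level d (coord2 (z 0)) 2) r2 \<and> wsum (level d (coord2 (z 0)) 2) r2 \<le> 0"
    using c2
  proof (elim disjE exE conjE)
    fix k assume k: "k \<le> K" "r2 = L2 # replicate k L3"
    have "wsum (level d (coord2 (z 0)) 2) r2 = k * (1 - (real K + 2) * q)"
      by (simp add: k lev) (simp add: z0)
    also have "\<dots> = - (k * (z1 * p))" unfolding q2 by simp
    finally show ?thesis using kz[OF k(1)] by simp
  qed (use del in simp)
  have F1: "\<bar>wsum (level d (coord1 (z 0)) 3) r'\<bar> \<le> C * del" and F2: "\<bar>wsum (level d (coord2 (z 0)) 3) r'\<bar> \<le> C * del"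
    using far orth_coord wmax_coord[OF z_in] by auto
  have eta': "eta = C * del + del" unfolding eta del_def[symmetric] by (simp add: algebra_simps)
  show "- eta \<le> wsum (coord1 (z 0)) r \<and> wsum (coord1 (z 0)) r \<le> 1 + eta"
    using A0 A1 A2 F1 del unfolding split eta' by linarith
  show "- eta \<le> wsum (coord2 (z 0)) r \<and> wsum (coord2 (z 0)) r \<le> 1 + eta"
    using B0 B1 B2 F2 del unfolding split eta' by linarith
  show "wsum (coord2 (z 0)) r \<le> eta" if "j = L2"
  proof -
    have "r0 = []" using c0 that by auto
    then show ?thesis using B1 B2 F2 del unfolding split eta' by simp linarith
  qed
  show "wsum (coord1 (z 0)) r \<le> eta \<and> wsum (coord2 (z 0)) r \<le> eta" if "j = L1"
  proof -
    have "r0 = []" "r1 = []" "r2 = []" using c0' c1' c2' that by auto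
    then have "wsum g r = wsum (level d g 3) r'" for g :: "letter \<Rightarrow> real" unfolding split by simp
    then show ?thesis using F1 F2 del unfolding eta' by (simp only:) linarith
  qed
qed

section \<open>The area of the pieces\<close>

definition det2 :: "real \<times> real \<Rightarrow> real \<times> real \<Rightarrow> real" where
  "det2 u v = fst u * snd v - snd u * fst v"

definition parallelogram :: "real \<times> real \<Rightarrow> real \<times> real \<Rightarrow> real \<Rightarrow> real \<Rightarrow> real \<Rightarrow> real \<Rightarrow> (real \<times> real) set" where
  "parallelogram u v a b c e = (\<lambda>(\<alpha>, \<beta>). \<alpha> *\<^sub>R u + \<beta> *\<^sub>R v) ` ({a..b} \<times> {c..e})"

lemma parallelogram_swap: "parallelogram u v a b c e = parallelogram v u c e a b"
  unfolding parallelogram_def by (force simp: add.commute)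

lemma compact_parallelogram [simp]: "compact (parallelogram u v a b c e)"
  unfolding parallelogram_def case_prod_unfold
  by (intro compact_continuous_image compact_Times continuous_intros) simp_all

lemma emeasure_affine_interval:
  fixes f w a b :: real
  assumes "f \<noteq> 0" "a \<le> b"
  shows "{x. a \<le> (x - w) / f \<and> (x - w) / f \<le> b} \<in> sets borel"
    "emeasure lborel {x. a \<le> (x - w) / f \<and> (x - w) / f \<le> b} = ennreal (\<bar>f\<bar> * (b - a))"
proof -
  have *: "{x. a \<le> (x - w) / f \<and> (x - w) / f \<le> b} = (if 0 < f then {w + f * a..w + f * b} else {w + f * b..w + f * a})"
  proof (cases "0 < f")
    case True
    then show ?thesis by (auto simp: pos_le_divide_eq pos_divide_le_eq mult.commute)
  next
    case False
    then have "f < 0" using assms by simp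
    then show ?thesis by (auto simp: neg_le_divide_eq neg_divide_le_eq mult.commute)
  qed
  show "{x. a \<le> (x - w) / f \<and> (x - w) / f \<le> b} \<in> sets borel" unfolding * by simp
  show "emeasure lborel {x. a \<le> (x - w) / f \<and> (x - w) / f \<le> b} = ennreal (\<bar>f\<bar> * (b - a))"
    unfolding * using assms mult_left_mono[OF assms(2), of f] mult_left_mono_neg[OF assms(2), of f]
    by (auto simp: algebra_simps)
qed

text \<open>A shear along the direction of \<open>u\<close> turns the fibres into intervals, and
  Fubini's theorem multiplies two lengths. The shear needs \<open>u\<close> not to be vertical;
  otherwise \<open>u\<close> and \<open>v\<close> are exchanged.\<close>

lemma emeasure_parallelogram:
  assumes "det2 u v \<noteq> 0" "a \<le> b" "c \<le> e"
  shows "emeasure lborel (parallelogram u v a b c e) \<le> ennreal (\<bar>det2 u v\<bar> * ((b - a) * (e - c)))"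
proof -
  have main: "emeasure lborel (parallelogram u v a b c e) \<le> ennreal (\<bar>det2 u v\<bar> * ((b - a) * (e - c)))"
    if f: "fst u \<noteq> 0" and D: "det2 u v \<noteq> 0" and le: "a \<le> b" "c \<le> e" for u v a b c e
  proof -
    \<comment> \<open>The slope of \<open>u\<close>. In the sheared coordinate \<open>s\<close> the
      vector \<open>u\<close> disappears and \<open>v\<close> contributes \<open>D'\<close>.\<close>
    define k where "k = snd u / fst u"
    define D' where "D' = det2 u v / fst u"
    have D': "D' \<noteq> 0" using f D by (simp add: D'_def)
    let ?S = "parallelogram u v a b c e"
    have [measurable]: "?S \<in> sets borel" by (intro borel_compact) simp
    define I where "I = {s. c \<le> (s - 0) / D' \<and> (s - 0) / D' \<le> e}"
    define J where "J s = {x. a \<le> (x - s / D' * fst v) / fst u \<and> (x - s / D' * fst v) / fst u \<le> b}" for s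
    have [measurable]: "I \<in> sets borel" unfolding I_def by (rule emeasure_affine_interval) (use D' le in auto)
    have J [measurable]: "J s \<in> sets borel" for s unfolding J_def by (rule emeasure_affine_interval) (use f le in auto)
    have S: "s \<in> I \<and> x \<in> J s" if "(x, s + k * x) \<in> ?S" for x s
    proof -
      obtain \<alpha> \<beta> where ab: "a \<le> \<alpha>" "\<alpha> \<le> b" "c \<le> \<beta>" "\<beta> \<le> e" 
        and x: "x = \<alpha> * fst u + \<beta> * fst v" and y: "s + k * x = \<alpha> * snd u + \<beta> * snd v"
        using \<open>(x, s + k * x) \<in> ?S\<close> unfolding parallelogram_def by (cases u; cases v) auto
      have "s = \<beta> * D'"
        using y f unfolding x k_def D'_def det2_def by (simp add: field_simps)
      then have s: "s / D' = \<beta>" using D' by simp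
      then show ?thesis unfolding I_def J_def using ab f by (simp add: s x)
    qed
    have meas [measurable]: "Measurable.pred (borel \<Otimes>\<^sub>M borel) (\<lambda>(x, s). x \<in> J s)"
      unfolding J_def by measurable
    have "emeasure lborel ?S = (\<integral>\<^sup>+p. indicator ?S p \<partial>(lborel \<Otimes>\<^sub>M lborel))" by (simp add: lborel_prod)
    also have "\<dots> = (\<integral>\<^sup>+x. \<integral>\<^sup>+y. indicator ?S (x, y) \<partial>lborel \<partial>lborel)"
      by (rule lborel.nn_integral_fst[symmetric]) (simp add: lborel_prod)
    also have "\<dots> = (\<integral>\<^sup>+x. \<integral>\<^sup>+s. indicator ?S (x, s + k * x) \<partial>lborel \<partial>lborel)"
    proof (rule nn_integral_cong)
      fix x
      have [measurable]: "(\<lambda>y. indicator ?S (x, y) :: ennreal) \<in> borel_measurable borel" by measurable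
      show "(\<integral>\<^sup>+y. indicator ?S (x, y) \<partial>lborel) = (\<integral>\<^sup>+s. indicator ?S (x, s + k * x) \<partial>lborel)"
        by (rule lborel_translate[symmetric]) measurable
    qed
    also have "\<dots> \<le> (\<integral>\<^sup>+x. \<integral>\<^sup>+s. indicator I s * indicator (J s) x \<partial>lborel \<partial>lborel)"
      by (intro nn_integral_mono) (use S in \<open>auto split: split_indicator\<close>)
    also have "\<dots> = (\<integral>\<^sup>+s. \<integral>\<^sup>+x. indicator I s * indicator (J s) x \<partial>lborel \<partial>lborel)"
      by (rule lborel_pair.Fubini'[symmetric]) measurable
    also have "\<dots> = (\<integral>\<^sup>+s. indicator I s * ennreal (\<bar>fst u\<bar> * (b - a)) \<partial>lborel)"
    proof (rule nn_integral_cong)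
      fix s
      have "(\<integral>\<^sup>+x. indicator I s * indicator (J s) x \<partial>lborel) = indicator I s * (\<integral>\<^sup>+x. indicator (J s) x \<partial>lborel)"
        by (rule nn_integral_cmult) simp
      also have "(\<integral>\<^sup>+x. indicator (J s) x \<partial>lborel) = emeasure lborel (J s)" by simp
      also have "\<dots> = ennreal (\<bar>fst u\<bar> * (b - a))"
        unfolding J_def by (rule emeasure_affine_interval) (use f le in auto)
      finally show "(\<integral>\<^sup>+x. indicator I s * indicator (J s) x \<partial>lborel) = indicator I s * ennreal (\<bar>fst u\<bar> * (b - a))" .
    qed
    also have "\<dots> = emeasure lborel I * ennreal (\<bar>fst u\<bar> * (b - a))"
      by (subst nn_integral_multc) simp_all
    also have "emeasure lborel I = ennreal (\<bar>D'\<bar> * (e - c))"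
      unfolding I_def by (rule emeasure_affine_interval) (use D' le in auto)
    also have "ennreal (\<bar>D'\<bar> * (e - c)) * ennreal (\<bar>fst u\<bar> * (b - a)) = ennreal (\<bar>det2 u v\<bar> * ((b - a) * (e - c)))"
    proof -
      have "(\<bar>D'\<bar> * (e - c)) * (\<bar>fst u\<bar> * (b - a)) = \<bar>det2 u v\<bar> * ((b - a) * (e - c))"
        using f by (simp add: D'_def abs_divide)
      then show ?thesis using le by (subst ennreal_mult[symmetric]) simp_all
    qed
    finally show ?thesis .
  qed
  show ?thesis
  proof (cases "fst u = 0")
    case True
    then have "fst v \<noteq> 0" using assms(1) by (auto simp: det2_def)
    moreover have "det2 v u = - det2 u v" by (simp add: det2_def algebra_simps)
    ultimately show ?thesis using main[of v u c e a b] assms by (simp add: parallelogram_swap mult.commute)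
  qed (use main assms in simp)
qed

section \<open>Tower heights and the total area\<close>

lemma wsum_one: "wsum (\<lambda>_. 1 :: real) w = length w"
  by (induction w) simp_all

lemma length_acc_prefix: "real (length (acc_prefix d n [j])) = level d (\<lambda>_. 1) n j"
  using wsum_acc_prefix[of "\<lambda>_. 1 :: real" d n "[j]"] by (simp only: wsum_one wsum_Cons wsum_Nil add_0_right)

text \<open>The tower over \<open>L3\<close> is the highest. This is a benefit of the acceleration:
  within a run of \<beta>1 the column of the letter 2 grows beyond that of the letter 3.\<close>

lemma heights_le:
  fixes d n
  defines "H \<equiv> level d (\<lambda>_. 1 :: real) n"
  shows "0 < H L1 \<and> 0 < H L2 \<and> 0 < H L3 \<and> H L1 \<le> H L3 \<and> H L2 \<le> H L3"
  unfolding H_def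
proof (induction n)
  case (Suc n)
  let ?H = "level d (\<lambda>_. 1 :: real) n"
  obtain a b where d: "d n = (a, b)" by (cases "d n")
  have "1 * ?H L3 \<le> real (Suc a) * ?H L3" using Suc by (intro mult_right_mono) simp_all
  define c where "c = real (Suc a) * ?H L3"
  have "?H L3 \<le> c" using \<open>1 * ?H L3 \<le> _\<close> by (simp only: c_def mult_1)
  with Suc show ?case by (auto simp: d push_simps c_def[symmetric] simp del: of_nat_Suc)
qed simp

context brun_seq
begin

text \<open>One digit multiplies the determinant of the first two projected columns by
  \<open>snd (z n)\<close>, up to sign, and divides the weighted sum of the heights by the same
  factor.\<close>

lemma det_height_invariant:
  assumes "orth (z 0) \<tau>"
  shows "\<bar>det2 (level d \<tau> n L1) (level d \<tau> n L2)\<bar> *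
      (fst (z n) * level d (\<lambda>_. 1) n L1 + snd (z n) * level d (\<lambda>_. 1) n L2 + level d (\<lambda>_. 1) n L3)
    = \<bar>det2 (\<tau> L1) (\<tau> L2)\<bar> * (fst (z 0) + snd (z 0) + 1)"
proof (induction n)
  case (Suc n)
  obtain a b where d: "d n = (a, b)" by (cases "d n")
  obtain z1 z2 where zS: "z (Suc n) = (z1, z2)" by (cases "z (Suc n)")
  have zb: "0 < z1" "z1 < z2" using z_in[of "Suc n"] by (simp_all add: zS open_Delta2_def)
  let ?G = "level d \<tau> n" and ?H = "level d (\<lambda>_. 1 :: real) n"
  have "orth (z n) ?G" using assms by (rule orth_level)
  then have G3: "?G L3 = - (fst (z n) *\<^sub>R ?G L1 + snd (z n) *\<^sub>R ?G L2)"
    unfolding orth_def by (rule minus_unique[symmetric])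
  define s where "s = (if b then z1 else z2) + 1 + real a"
  have s: "s > 0" unfolding s_def using zb by simp
  have zn: "z n = (if b then (z2 / s, 1 / s) else (z1 / s, 1 / s))"
    using z_step[of n] by (simp add: d zS s_def)
  have "\<bar>det2 (level d \<tau> (Suc n) L1) (level d \<tau> (Suc n) L2)\<bar> = snd (z n) * \<bar>det2 (?G L1) (?G L2)\<bar>"
  proof -
    have "det2 (level d \<tau> (Suc n) L1) (level d \<tau> (Suc n) L2) = (if b then 1 else -1) * (snd (z n) * det2 (?G L1) (?G L2))"
      by (simp add: d push_simps G3 det2_def algebra_simps)
    moreover have "0 \<le> snd (z n)" using s by (simp add: zn)
    ultimately show ?thesis by (simp add: abs_mult)
  qed
  moreover have "snd (z n) * (fst (z (Suc n)) * level d (\<lambda>_. 1) (Suc n) L1 + snd (z (Suc n)) * level d (\<lambda>_. 1) (Suc n) L2 + level d (\<lambda>_. 1) (Suc n) L3)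
    = fst (z n) * ?H L1 + snd (z n) * ?H L2 + ?H L3"
  proof -
    have "fst (z (Suc n)) * level d (\<lambda>_. 1) (Suc n) L1 + snd (z (Suc n)) * level d (\<lambda>_. 1) (Suc n) L2 + level d (\<lambda>_. 1) (Suc n) L3
      = (if b then z2 * ?H L1 + ?H L2 + s * ?H L3 else z1 * ?H L1 + ?H L2 + s * ?H L3)"
      by (simp add: zS d push_simps s_def algebra_simps)
    then show ?thesis using s by (simp add: zn field_simps)
  qed
  moreover have "x * b' = r" if "x = q * a" "q * b' = b" "a * b = r" for x q a b b' r :: real
    using that by auto
  ultimately show ?case using Suc.IH by blast
qed simp

text \<open>At level \<open>N\<close> the pieces are covered by copies of the sets
  \<open>A j\<close>, one for each floor of the tower over \<open>j\<close>. Replacing every height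
  by \<open>H L3\<close> leaves \<open>D * H L3\<close> times nearly one, and the invariant bounds
  \<open>D * H L3\<close> by one.\<close>

lemma pieces_area:
  fixes \<tau> :: "letter \<Rightarrow> real \<times> real"
  assumes orth: "orth (z 0) \<tau>" and det: "\<bar>det2 (\<tau> L1) (\<tau> L2)\<bar> * (fst (z 0) + snd (z 0) + 1) = 1"
    and block: "block K d N"
    and tail: "brun_seq.tail_bound (\<lambda>k. d (N + (3 + k))) (\<lambda>k. z (N + (3 + k))) C"
    and eta: "eta = (C + 1) * (3 / (real K + 1))" "0 \<le> eta"
  shows "(\<Sum>i\<in>UNIV. emeasure lborel (closure {wsum \<tau> r |r. (r, i) \<in> Pre d i0})) \<le> ennreal (1 + 6 * eta + 12 * eta\<^sup>2)"
proof -
  interpret S: brun_seq "\<lambda>k. d (N + k)" "\<lambda>k. z (N + k)" by (rule brun_seq_shift) unfold_locales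
  define G where "G = level d \<tau> N"
  define H where "H = level d (\<lambda>_. 1 :: real) N"
  define D where "D = \<bar>det2 (G L1) (G L2)\<bar>"
  have oG: "orth (z N) G" unfolding G_def by (rule orth_level[OF orth])
  have zN: "0 < fst (z N)" "0 < snd (z N)" using z_in[of N] by (auto simp: open_Delta2_def)
  have inv: "D * (fst (z N) * H L1 + snd (z N) * H L2 + H L3) = 1"
    using det_height_invariant[OF orth, of N] det by (simp add: D_def G_def H_def)
  have H: "0 < H L1" "0 < H L2" "0 < H L3" "H L1 \<le> H L3" "H L2 \<le> H L3"
    using heights_le[of d N] by (simp_all add: H_def)
  have D: "0 < D" using inv unfolding D_def by (metis abs_eq_0 mult_zero_left zero_less_abs_iff zero_neq_one)
  have DH: "D * H L3 \<le> 1"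
  proof -
    have "D * H L3 \<le> D * (fst (z N) * H L1 + snd (z N) * H L2 + H L3)"
      using D H zN by (intro mult_left_mono) simp_all
    then show ?thesis by (simp add: inv)
  qed
  define top1 where "top1 j = (if j = L1 then eta else 1 + eta)" for j
  define top2 where "top2 j = (if j = L3 then 1 + eta else eta)" for j
  define A where "A j = parallelogram (G L1) (G L2) (- eta) (top1 j) (- eta) (top2 j)" for j
  define area where "area j = D * ((top1 j + eta) * (top2 j + eta))" for j
  have emA: "emeasure lborel (A j) \<le> ennreal (area j)" for j
    unfolding A_def area_def D_def
    using emeasure_parallelogram[of "G L1" "G L2" "- eta" "top1 j" "- eta" "top2 j"] D eta(2)
    by (simp add: top1_def top2_def D_def)
  have area0: "0 \<le> area j" for j using D eta(2) by (simp add: area_def top1_def top2_def)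
  have inA: "wsum G r \<in> A j" if "(r, j) \<in> Pre (\<lambda>k. d (N + k)) i" for r j i
  proof -
    have b0: "block K (\<lambda>k. d (N + k)) 0" using block by (simp add: block_def)
    note R = S.Pre_region[OF b0 tail that eta(1)]
    have zN0: "z (N + 0) = z N" by simp
    show ?thesis
      unfolding A_def parallelogram_def wsum_coord[OF oG, of r]
    proof (rule image_eqI)
      show "(wsum (coord1 (z N)) r, wsum (coord2 (z N)) r) \<in> {- eta..top1 j} \<times> {- eta..top2 j}"
        using R unfolding zN0 by (cases j) (auto simp: top1_def top2_def)
    qed simp
  qed
  define W where "W j = acc_prefix d N [j]" for j
  have lenW: "real (length (W j)) = H j" for j by (simp add: W_def H_def length_acc_prefix)
  \<comment> \<open>The floors of the tower over \<open>j\<close> that carry the letter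
    \<open>i\<close>. For fixed \<open>j\<close> they partition the tower, which turns the sum over
    \<open>i\<close> into its height.\<close>
  define L where "L i j = {l \<in> {..<length (W j)}. W j ! l = i}" for i j
  have finL: "finite (L i j)" for i j by (simp add: L_def)
  have cover: "closure {wsum \<tau> r |r. (r, i) \<in> Pre d i0} \<subseteq> (\<Union>j. \<Union>l\<in>L i j. (+) (wsum \<tau> (take l (W j))) ` A j)" for i
  proof (rule closure_minimal)
    have "compact ((+) c ` A j)" for c j unfolding A_def by (intro compact_translation compact_parallelogram)
    then have "closed ((+) c ` A j)" for c j by (rule compact_imp_closed)
    then show "closed (\<Union>j. \<Union>l\<in>L i j. (+) (wsum \<tau> (take l (W j))) ` A j)"
      by (intro closed_UN ballI finL finite)
    show "{wsum \<tau> r |r. (r, i) \<in> Pre d i0} \<subseteq> (\<Union>j. \<Union>l\<in>L i j. (+) (wsum \<tau> (take l (W j))) ` A j)"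
    proof
      fix x assume "x \<in> {wsum \<tau> r |r. (r, i) \<in> Pre d i0}"
      then obtain r where r: "x = wsum \<tau> r" "(r, i) \<in> Pre d i0" by blast
      obtain r' j r'' where dec: "(r', j) \<in> Pre (\<lambda>k. d (N + k)) (first_letter d i0 N)"
        "prefix (r'' @ [i]) (acc_prefix d N [j])" "r = acc_prefix d N r' @ r''"
        by (rule Pre_decomp[OF r(2), of N])
      obtain zs where zs: "W j = r'' @ i # zs" using dec(2) unfolding W_def by (auto simp: prefix_def)
      have "length r'' \<in> L i j" by (simp add: L_def zs)
      moreover have "take (length r'') (W j) = r''" by (simp add: zs)
      moreover have "x = wsum \<tau> r'' + wsum G r'" by (simp add: r dec(3) wsum_acc_prefix G_def)
      ultimately show "x \<in> (\<Union>j. \<Union>l\<in>L i j. (+) (wsum \<tau> (take l (W j))) ` A j)"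
        using inA[OF dec(1)] by (intro UN_I[of j] UNIV_I UN_I[of "length r''"]) auto
    qed
  qed
  have trans: "emeasure lborel ((+) c ` A j) \<le> ennreal (area j)" for c j
  proof -
    have "compact (A j)" by (simp add: A_def)
    then have "A j \<in> sets borel" by (rule borel_compact)
    then show ?thesis using emA by (simp add: emeasure_translate_image)
  qed
  have measT: "(+) c ` A j \<in> sets lborel" for c j
    unfolding A_def by (simp add: borel_compact compact_translation)
  have "emeasure lborel (closure {wsum \<tau> r |r. (r, i) \<in> Pre d i0}) \<le> (\<Sum>j\<in>UNIV. \<Sum>l\<in>L i j. ennreal (area j))" for i
  proof -
    have "emeasure lborel (closure {wsum \<tau> r |r. (r, i) \<in> Pre d i0})
        \<le> emeasure lborel (\<Union>j. \<Union>l\<in>L i j. (+) (wsum \<tau> (take l (W j))) ` A j)"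
      by (intro emeasure_mono cover sets.finite_UN finL finite measT)
    also have "\<dots> \<le> (\<Sum>j\<in>UNIV. emeasure lborel (\<Union>l\<in>L i j. (+) (wsum \<tau> (take l (W j))) ` A j))"
      by (intro emeasure_subadditive_finite) (auto intro!: sets.finite_UN finL simp del: sets_lborel simp: measT)
    also have "\<dots> \<le> (\<Sum>j\<in>UNIV. \<Sum>l\<in>L i j. emeasure lborel ((+) (wsum \<tau> (take l (W j))) ` A j))"
      by (intro sum_mono emeasure_subadditive_finite finL) (auto simp del: sets_lborel simp: measT)
    also have "\<dots> \<le> (\<Sum>j\<in>UNIV. \<Sum>l\<in>L i j. ennreal (area j))"
      by (intro sum_mono trans)
    finally show ?thesis .
  qed
  then have "(\<Sum>i\<in>UNIV. emeasure lborel (closure {wsum \<tau> r |r. (r, i) \<in> Pre d i0}))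
      \<le> (\<Sum>i\<in>UNIV. \<Sum>j\<in>UNIV. \<Sum>l\<in>L i j. ennreal (area j))" by (intro sum_mono)
  also have "\<dots> = (\<Sum>j\<in>UNIV. \<Sum>i\<in>UNIV. \<Sum>l\<in>L i j. ennreal (area j))" by (rule sum.swap)
  also have "\<dots> = (\<Sum>j\<in>UNIV. \<Sum>l<length (W j). ennreal (area j))"
    unfolding L_def by (intro sum.cong refl sum.group) auto
  also have "\<dots> = (\<Sum>j\<in>UNIV. ennreal (H j * area j))"
    by (simp add: lenW[symmetric] ennreal_mult area0 ennreal_of_nat_eq_real_of_nat)
  also have "\<dots> = ennreal (\<Sum>j\<in>UNIV. H j * area j)"
  proof (rule sum_ennreal)
    fix j
    show "0 \<le> H j * area j" using H area0 by (cases j) (simp_all add: less_imp_le)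
  qed
  also have "(\<Sum>j\<in>UNIV. H j * area j) = H L1 * area L1 + H L2 * area L2 + H L3 * area L3"
    by (simp add: UNIV_letter)
  also have "\<dots> \<le> H L3 * area L1 + H L3 * area L2 + H L3 * area L3"
    using H area0 by (intro add_mono mult_right_mono) simp_all
  \<comment> \<open>The three areas are \<open>4 * eta\<^sup>2\<close>,
    \<open>2 * eta * (1 + 2 * eta)\<close> and \<open>(1 + 2 * eta)\<^sup>2\<close>, times
    \<open>D\<close>.\<close>
  also have "\<dots> = (D * H L3) * (1 + 6 * eta + 12 * eta\<^sup>2)"
    by (simp add: area_def top1_def top2_def algebra_simps power2_eq_square)
  also have "\<dots> \<le> 1 * (1 + 6 * eta + 12 * eta\<^sup>2)"
    using DH eta(2) by (intro mult_right_mono) simp_all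
  finally show ?thesis by (simp add: ennreal_leI)
qed

end

section \<open>Limit words\<close>

lemma length_subst_word_ge: "(\<And>a. s a \<noteq> []) \<Longrightarrow> length w \<le> length (subst_word s w)"
proof (induction w)
  case (Cons a w)
  then have "1 \<le> length (s a)" by (simp add: Suc_le_eq)
  with Cons show ?case by simp
qed simp

lemma acc_subst_nonempty: "acc_subst e j \<noteq> []"
  by (cases e; cases j) auto

lemma length_acc_prefix_ge: "length w \<le> length (acc_prefix d n w)"
proof (induction n arbitrary: w)
  case (Suc n)
  have "length w \<le> length (subst_word (acc_subst (d n)) w)"
    by (rule length_subst_word_ge) (rule acc_subst_nonempty)
  also have "\<dots> \<le> length (acc_prefix d (Suc n) w)" using Suc by simp
  finally show ?case .
qed simp

lemma set_subst_word: "set (subst_word s w) = (\<Union>a\<in>set w. set (s a))"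
  by (simp add: subst_word_def)

lemma L3_in_acc_prefix: "L3 \<in> set w \<Longrightarrow> L3 \<in> set (acc_prefix d n w)"
proof (induction n arbitrary: w)
  case (Suc n)
  have "L3 \<in> set (acc_subst (d n) L3)" by (cases "d n") simp
  with Suc.prems have "L3 \<in> set (subst_word (acc_subst (d n)) w)" by (auto simp: set_subst_word)
  then show ?case using Suc.IH by simp
qed simp

lemma all_in_acc_prefix: "set w = UNIV \<Longrightarrow> set (acc_prefix d n w) = UNIV"
proof (induction n arbitrary: w)
  case (Suc n)
  obtain a b where d: "d n = (a, b)" by (cases "d n")
  have "set (subst_word (acc_subst (d n)) w) = set (acc_subst (d n) L1) \<union> set (acc_subst (d n) L2) \<union> set (acc_subst (d n) L3)"
    using Suc.prems by (auto simp: set_subst_word UNIV_letter)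
  also have "\<dots> = UNIV" by (auto simp: d UNIV_letter)
  finally show ?case using Suc.IH by simp
qed simp

lemma block_word:
  assumes "block K d 0"
  shows "acc_prefix d 3 [L1] = L2 # replicate (Suc K) L3"
    "acc_prefix d 3 [L2] = L3 # L2 # replicate (Suc K) L3"
    "\<exists>v. acc_prefix d 3 [L3] = L1 # L3 # L2 # replicate (Suc K) L3 @ v"
  using assms by (simp_all add: block_def numeral_3_eq_3)

lemma block_words:
  assumes "block K d 0"
  shows "2 \<le> length (acc_prefix d 3 [j])" "L3 \<in> set (acc_prefix d 3 [j])" "set (acc_prefix d 3 [L3]) = UNIV"
proof -
  obtain v where v: "acc_prefix d 3 [L3] = L1 # L3 # L2 # replicate (Suc K) L3 @ v"
    using block_word(3)[OF assms] by blast
  show "2 \<le> length (acc_prefix d 3 [j])" "L3 \<in> set (acc_prefix d 3 [j])"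
    by (cases j; simp add: block_word(1,2)[OF assms] v)+
  have "x \<in> set (acc_prefix d 3 [L3])" for x by (cases x) (simp_all add: v)
  then show "set (acc_prefix d 3 [L3]) = UNIV" by blast
qed

text \<open>Blocks of any size, occurring again and again, are all that growth and primitivity
  require; the parameter may be zero.\<close>

locale recurrent_digits =
  fixes d :: "nat \<Rightarrow> digit"
  assumes recurrent: "\<And>n. \<exists>N\<ge>n. \<exists>K. block K d N"
begin

text \<open>Every letter has an image of length at least two under a block, so each further block
  makes the prefix strictly longer.\<close>

lemma length_lim_prefix: "\<exists>n. k < length (lim_prefix d i n)"
proof (induction k)
  case 0
  then show ?case using length_acc_prefix_ge[of "[i]" d 0] by (intro exI[of _ 0]) (simp add: lim_prefix_def)
next
  case (Suc k)
  then obtain n where n: "k < length (lim_prefix d i n)" by blast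
  obtain N K where N: "n \<le> N" "block K d N" using recurrent by blast
  have b: "block K (\<lambda>k. d (N + k)) 0" using N(2) by (simp add: block_def)
  let ?i = "first_letter d i N"
  have "prefix (lim_prefix (\<lambda>k. d (N + k)) ?i 0) (lim_prefix (\<lambda>k. d (N + k)) ?i 3)"
    by (rule lim_prefix_mono) simp
  then obtain v where v: "lim_prefix (\<lambda>k. d (N + k)) ?i 3 = ?i # v" by (auto simp: lim_prefix_def prefix_def)
  have "2 \<le> length (lim_prefix (\<lambda>k. d (N + k)) ?i 3)"
    unfolding lim_prefix_def by (rule block_words(1)[OF b])
  then have "1 \<le> length v" by (simp add: v)
  also have "\<dots> \<le> length (acc_prefix d N v)" by (rule length_acc_prefix_ge)
  finally have "1 \<le> length (acc_prefix d N v)" .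
  moreover have "lim_prefix d i (N + 3) = acc_prefix d N ([?i] @ v)"
    by (simp only: lim_prefix_add v append_Cons append_Nil)
  then have "lim_prefix d i (N + 3) = lim_prefix d i N @ acc_prefix d N v"
    by (simp only: subst_prefix_append lim_prefix_def)
  moreover have "length (lim_prefix d i n) \<le> length (lim_prefix d i N)"
    using lim_prefix_mono[OF N(1)] by (rule prefix_length_le)
  ultimately show ?case using n by (intro exI[of _ "N + 3"]) simp
qed

definition lim_word :: "letter \<Rightarrow> nat \<Rightarrow> letter" where
  "lim_word i k = lim_prefix d i (SOME n. k < length (lim_prefix d i n)) ! k"

lemma lim_word_nth: "k < length (lim_prefix d i n) \<Longrightarrow> lim_word i k = lim_prefix d i n ! k"
proof -
  assume k: "k < length (lim_prefix d i n)"
  define m where "m = (SOME n. k < length (lim_prefix d i n))"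
  have m: "k < length (lim_prefix d i m)" unfolding m_def by (rule someI_ex[OF length_lim_prefix])
  have "prefix (lim_prefix d i m) (lim_prefix d i n) \<or> prefix (lim_prefix d i n) (lim_prefix d i m)"
    using lim_prefix_mono[of m n d i] lim_prefix_mono[of n m d i] by linarith
  then have "lim_prefix d i m ! k = lim_prefix d i n ! k"
    using k m by (auto simp: prefix_def nth_append)
  then show ?thesis by (simp add: lim_word_def m_def)
qed

lemma lim_prefix_eq_map: "lim_prefix d i n = map (lim_word i) [0..<length (lim_prefix d i n)]"
  by (rule nth_equalityI) (simp_all add: lim_word_nth)

lemma map_lim_word_Pre: "(map (lim_word i) [0..<k], lim_word i k) \<in> Pre d i"
proof -
  obtain n where n: "k < length (lim_prefix d i n)" using length_lim_prefix by blast
  have "map (lim_word i) [0..<k] @ [lim_word i k] = map (lim_word i) [0..<Suc k]" by simp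
  also have "\<dots> = take (Suc k) (lim_prefix d i n)"
    using n by (subst lim_prefix_eq_map) (simp add: take_map)
  finally show ?thesis unfolding Pre_def by (auto intro!: exI[of _ n] simp: take_is_prefix)
qed

text \<open>Two blocks beyond level \<open>n\<close> are used. The later one produces
  \<open>L3\<close>, which survives all digits in between, and the earlier one turns
  \<open>L3\<close> into a word with all letters, a property that persists down to level
  \<open>n\<close>.\<close>

lemma acc_prefix_in_lim:
  "\<exists>m. sublist (acc_prefix d n [j]) (lim_prefix d i m)"
proof -
  obtain N K where N: "n \<le> N" "block K d N" using recurrent by blast
  obtain N2 K2 where N2: "N + 3 \<le> N2" "block K2 d N2" using recurrent by blast
  have b: "block K (\<lambda>k. d (N + k)) 0" "block K2 (\<lambda>k. d (N2 + k)) 0"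
    using N(2) N2(2) by (simp_all add: block_def)
  define w2 where "w2 = lim_prefix (\<lambda>k. d (N2 + k)) (first_letter d i N2) 3"
  have "L3 \<in> set w2" unfolding w2_def lim_prefix_def by (rule block_words(2)[OF b(2)])
  define w1 where "w1 = acc_prefix (\<lambda>k. d (N + 3 + k)) (N2 - (N + 3)) w2"
  have "L3 \<in> set w1" unfolding w1_def by (rule L3_in_acc_prefix) fact
  define w0 where "w0 = acc_prefix (\<lambda>k. d (N + k)) 3 w1"
  have "set w0 = UNIV"
  proof -
    have "set (acc_prefix (\<lambda>k. d (N + k)) 3 [L3]) \<subseteq> set w0"
      unfolding w0_def subst_prefix_conv_subst_word[of _ _ w1] set_subst_word using \<open>L3 \<in> set w1\<close> by blast
    then show ?thesis using block_words(3)[OF b(1)] by blast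
  qed
  define w where "w = acc_prefix (\<lambda>k. d (n + k)) (N - n) w0"
  have "set w = UNIV" unfolding w_def by (rule all_in_acc_prefix) fact
  have "lim_prefix d i (N2 + 3) = acc_prefix d n w"
  proof -
    have "acc_prefix d n w = acc_prefix d (n + (N - n)) w0" unfolding w_def by (subst subst_prefix_add) simp
    also have "n + (N - n) = N" using N by simp
    also have "acc_prefix d N w0 = acc_prefix d (N + 3) w1" unfolding w0_def by (subst subst_prefix_add) simp
    also have "\<dots> = acc_prefix d (N + 3 + (N2 - (N + 3))) w2" unfolding w1_def by (subst (2) subst_prefix_add) simp
    also have "N + 3 + (N2 - (N + 3)) = N2" using N2 by simp
    also have "acc_prefix d N2 w2 = lim_prefix d i (N2 + 3)" unfolding w2_def by (rule lim_prefix_add[symmetric])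
    finally show ?thesis ..
  qed
  moreover obtain a c where "w = a @ j # c" using \<open>set w = UNIV\<close> split_list[of j w] by blast
  then have "acc_prefix d n w = acc_prefix d n a @ acc_prefix d n [j] @ acc_prefix d n c"
    by (metis append_Cons append_Nil subst_prefix_append)
  ultimately have "sublist (acc_prefix d n [j]) (lim_prefix d i (N2 + 3))"
    by (simp add: sublist_appendI)
  then show ?thesis by blast
qed

text \<open>The right-hand side is the shift \<open>X\<close> of \<open>toral_coding\<close> for the
  reference word \<open>lim_word i\<close>; the choice of \<open>i\<close> does not matter.\<close>

lemma sadic_words_eq:
  "sadic_words (\<lambda>n. acc_subst (d n)) = {w. \<forall>k l. \<exists>m. \<forall>j<l. w (k + j) = lim_word i (m + j)}"
proof (intro equalityI subsetI CollectI allI)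
  fix w k l assume "w \<in> sadic_words (\<lambda>n. acc_subst (d n))"
  then obtain j n where "sublist (map w [k..<k + l]) (acc_prefix d n [j])" unfolding sadic_words_def by blast
  moreover obtain m where "sublist (acc_prefix d n [j]) (lim_prefix d i m)" using acc_prefix_in_lim by blast
  ultimately have "sublist (map w [k..<k + l]) (lim_prefix d i m)" by (rule sublist_order.order.trans)
  then obtain a b where ab: "lim_prefix d i m = a @ map w [k..<k + l] @ b" by (auto simp: sublist_def)
  have "w (k + j) = lim_word i (length a + j)" if "j < l" for j
  proof -
    have "lim_word i (length a + j) = lim_prefix d i m ! (length a + j)"
      by (rule lim_word_nth) (use that in \<open>simp add: ab\<close>)
    also have "\<dots> = w (k + j)" using that by (simp add: ab nth_append)
    finally show ?thesis ..
  qed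
  then show "\<exists>m. \<forall>j<l. w (k + j) = lim_word i (m + j)" by blast
next
  fix w assume w: "w \<in> {w. \<forall>k l. \<exists>m. \<forall>j<l. w (k + j) = lim_word i (m + j)}"
  show "w \<in> sadic_words (\<lambda>n. acc_subst (d n))"
    unfolding sadic_words_def
  proof (intro CollectI allI)
    fix k l
    obtain m where m: "\<And>j. j < l - k \<Longrightarrow> w (k + j) = lim_word i (m + j)" using w by blast
    obtain n where n: "m + (l - k) < length (lim_prefix d i n)" using length_lim_prefix by blast
    have "map w [k..<l] = map (lim_word i) [m..<m + (l - k)]"
      by (rule nth_equalityI) (simp_all add: m)
    moreover have "lim_prefix d i n = map (lim_word i) [0..<m] @ map (lim_word i) [m..<m + (l - k)]
        @ map (lim_word i) [m + (l - k)..<length (lim_prefix d i n)]"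
    proof -
      let ?L = "length (lim_prefix d i n)"
      have "[0..<?L] = [0..<m] @ [m..<m + (l - k)] @ [m + (l - k)..<?L]"
        using upt_add_eq_append[of 0 m "?L - m"] upt_add_eq_append[of m "m + (l - k)" "?L - m - (l - k)"] n by simp
      then show ?thesis by (subst lim_prefix_eq_map) simp
    qed
    ultimately have "sublist (map w [k..<l]) (lim_prefix d i n)" by (metis sublist_appendI)
    then show "\<exists>i n. sublist (map w [k..<l]) (acc_prefix d n [i])" unfolding lim_prefix_def by blast
  qed
qed

end

section \<open>Natural codings for regular digit sequences\<close>

lemma sum_upto_wsum: "(\<Sum>m<k. g (u m)) = wsum g (map u [0..<k])"
  by (induction k) simp_all

locale regular_brun_seq = brun_seq +
  assumes regular: "\<And>m0. \<exists>m\<ge>m0. \<exists>N. block (m\<^sup>2) d N \<and> regular_tail m (\<lambda>k. d (N + (3 + k)))"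
begin

sublocale recurrent_digits d
proof
  fix n
  \<comment> \<open>Larger than all run lengths among the digits up to \<open>n\<close>, so that a
    block with parameter at least \<open>m0\<close> can only begin later.\<close>
  define m0 where "m0 = Suc (Max ((\<lambda>k. fst (d k)) ` {..n}))"
  obtain m N where m: "m0 \<le> m" "block (m\<^sup>2) d N" using regular by blast
  have "n \<le> N"
  proof (rule ccontr)
    assume "\<not> n \<le> N"
    then have "fst (d N) \<le> Max ((\<lambda>k. fst (d k)) ` {..n})" by (intro Max_ge) auto
    moreover have "fst (d N) = m\<^sup>2" using m(2) by (simp add: block_def)
    moreover have "m \<le> m\<^sup>2" by (simp add: power2_eq_square)
    ultimately show False using m(1) by (simp add: m0_def)
  qed
  then show "\<exists>N\<ge>n. \<exists>K. block K d N" using m(2) by blast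
qed

lemma good_level:
  assumes "1 \<le> m0"
  obtains m N where "m0 \<le> m" "block (m\<^sup>2) d N"
    "brun_seq.tail_bound (\<lambda>k. d (N + (3 + k))) (\<lambda>k. z (N + (3 + k))) (6 * (real m + 1))"
proof -
  obtain m N where m: "m0 \<le> m" "block (m\<^sup>2) d N" "regular_tail m (\<lambda>k. d (N + (3 + k)))" using regular by blast
  interpret S: brun_seq "\<lambda>k. d (N + (3 + k))" "\<lambda>k. z (N + (3 + k))"
    using brun_seq_shift[OF brun_seq_axioms, of "N + 3"] by (simp add: add.assoc)
  have "S.tail_bound (6 * (real m + 1))" by (rule S.tail_bound_regular) (use assms m in auto)
  then show ?thesis using m that by blast
qed

lemma wsum_Pre_bounded:
  fixes g :: "letter \<Rightarrow> real"
  assumes "orth (z 0) g"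
  shows "\<exists>B. \<forall>(r, j) \<in> Pre d i. \<bar>wsum g r\<bar> \<le> B"
proof -
  obtain m N where tail: "brun_seq.tail_bound (\<lambda>k. d (N + (3 + k))) (\<lambda>k. z (N + (3 + k))) (6 * (real m + 1))"
    by (rule good_level[OF order_refl])
  define M where "M = N + 3"
  interpret S: brun_seq "\<lambda>k. d (M + k)" "\<lambda>k. z (M + k)"
    by (rule brun_seq_shift) unfold_locales
  have tail: "S.tail_bound (6 * (real m + 1))" using tail by (simp add: M_def add.assoc)
  have oM: "orth (z (M + 0)) (level d g M)" using orth_level[OF assms, of M] by simp
  define B where "B = (\<Sum>k<M. wmax (level d g k)) + 6 * (real m + 1) * wmax (level d g M)"
  have "\<bar>wsum g r\<bar> \<le> B" if rj: "(r, j) \<in> Pre d i" for r j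
  proof -
    obtain n where n: "prefix (r @ [j]) (lim_prefix d i n)" using rj by (auto simp: Pre_def)
    have "\<bar>wsum g r\<bar> \<le> (\<Sum>k<n. wmax (level d g k))" by (rule prefix_bound[OF brun_seq_axioms assms n])
    also have "\<dots> \<le> (\<Sum>k<M + n. wmax (level d g k))" by (intro sum_mono2) (auto simp: wmax_nonneg)
    also have "\<dots> = (\<Sum>k<M. wmax (level d g k)) + (\<Sum>k<n. wmax (level d g (M + k)))"
      by (induction n) simp_all
    also have "\<dots> \<le> B"
      using tail[unfolded S.tail_bound_def, rule_format, OF oM, of n] unfolding B_def level_add by simp
    finally show ?thesis .
  qed
  then show ?thesis by blast
qed

text \<open>\<open>g1\<close> and \<open>g2\<close> form a basis of the lattice, and
  \<open>t0\<close> is its combination with the letter frequencies as coefficients.\<close>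

theorem brun_natural_coding:
  fixes g1 g2 t0 :: "real \<times> real"
  assumes g: "g1 \<in> Z2" "g2 \<in> Z2" "\<bar>det2 g1 g2\<bar> = 1"
    and t0: "(fst (z 0) + snd (z 0) + 1) *\<^sub>R t0 = fst (z 0) *\<^sub>R g1 + snd (z 0) *\<^sub>R g2"
    and dense: "\<And>y e. e > 0 \<Longrightarrow> \<exists>n. \<exists>g\<in>Z2. norm (of_nat n *\<^sub>R t0 + g - y) < e"
  defines "X \<equiv> sadic_words (\<lambda>n. acc_subst (d n))"
  shows "(\<exists>\<mu>. unique_invariant_prob X \<mu> \<and> measurably_conjugate \<mu> word_shift torus2 (\<lambda>c. lattice_coset Z2 t0 + c)) \<and>
   (\<exists>R P \<tau>. natural_partition Z2 (lattice_coset Z2 t0) R P \<tau> \<and> (\<forall>w\<in>X. \<exists>x\<in>R. coding_of P \<tau> x w))"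
proof -
  \<comment> \<open>The steps are congruent to \<open>t0\<close>, and their average with respect to
    the frequencies vanishes, which is \<open>orth\<close>. The basis property normalises the
    determinant so that the invariant of the towers equals one.\<close>
  define \<tau> where "\<tau> j = t0 - (if j = L1 then g1 else if j = L2 then g2 else 0)" for j
  obtain x1 x2 where x: "z 0 = (x1, x2)" by (cases "z 0")
  have xb: "0 < x1" "0 < x2" using z_in[of 0] by (simp_all add: x open_Delta2_def)
  have t0: "(x1 + x2 + 1) *\<^sub>R t0 = x1 *\<^sub>R g1 + x2 *\<^sub>R g2" using t0 by (simp add: x)
  have orth: "orth (z 0) \<tau>"
    using t0 by (simp add: orth_def \<tau>_def x algebra_simps)
  have orth_fst: "orth (z 0) (\<lambda>j. fst (\<tau> j))" and orth_snd: "orth (z 0) (\<lambda>j. snd (\<tau> j))"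
    using arg_cong[OF orth[unfolded orth_def], of fst] arg_cong[OF orth[unfolded orth_def], of snd]
    by (simp_all add: orth_def)
  have det: "\<bar>det2 (\<tau> L1) (\<tau> L2)\<bar> * (fst (z 0) + snd (z 0) + 1) = 1"
  proof -
    define s where "s = x1 + x2 + 1"
    have s: "0 < s" using xb by (simp add: s_def)
    have comp: "s * fst t0 = x1 * fst g1 + x2 * fst g2" "s * snd t0 = x1 * snd g1 + x2 * snd g2"
      using arg_cong[OF t0, of fst] arg_cong[OF t0, of snd] by (simp_all add: s_def)
    have "s * det2 (\<tau> L1) (\<tau> L2) = s * det2 g1 g2 - (s * fst t0) * (snd g2 - snd g1) - (s * snd t0) * (fst g1 - fst g2)"
      by (simp add: det2_def \<tau>_def algebra_simps)
    also have "\<dots> = det2 g1 g2"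
      unfolding comp by (simp add: det2_def s_def algebra_simps)
    finally have "\<bar>s * det2 (\<tau> L1) (\<tau> L2)\<bar> = 1" using g(3) by simp
    then show ?thesis using s by (simp add: abs_mult x s_def mult.commute)
  qed
  interpret T: toral_coding "lim_word L1" \<tau> t0
  proof
    show "\<tau> i - t0 \<in> Z2" for i using g Z2_uminus by (simp add: \<tau>_def)
    show "bounded (range (\<lambda>k. \<Sum>m<k. \<tau> (lim_word L1 m)))"
    proof -
      obtain B1 where B1: "\<forall>(r, j) \<in> Pre d L1. \<bar>wsum (\<lambda>j. fst (\<tau> j)) r\<bar> \<le> B1"
        using wsum_Pre_bounded[OF orth_fst] by blast
      obtain B2 where B2: "\<forall>(r, j) \<in> Pre d L1. \<bar>wsum (\<lambda>j. snd (\<tau> j)) r\<bar> \<le> B2"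
        using wsum_Pre_bounded[OF orth_snd] by blast
      have "(\<Sum>m<k. \<tau> (lim_word L1 m)) \<in> {- B1..B1} \<times> {- B2..B2}" for k
      proof -
        have "\<bar>\<Sum>m<k. fst (\<tau> (lim_word L1 m))\<bar> \<le> B1" "\<bar>\<Sum>m<k. snd (\<tau> (lim_word L1 m))\<bar> \<le> B2"
          using bspec[OF B1 map_lim_word_Pre[of L1 k]] bspec[OF B2 map_lim_word_Pre[of L1 k]]
          by (simp_all add: sum_upto_wsum[of "\<lambda>j. fst (\<tau> j)"] sum_upto_wsum[of "\<lambda>j. snd (\<tau> j)"])
        then show ?thesis by (simp add: mem_Times_iff fst_sum snd_sum abs_le_iff)
      qed
      then have "range (\<lambda>k. \<Sum>m<k. \<tau> (lim_word L1 m)) \<subseteq> {- B1..B1} \<times> {- B2..B2}" by blast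
      then show ?thesis by (rule bounded_subset[rotated]) (intro bounded_Times bounded_closed_interval)
    qed
    show "(\<Sum>i\<in>UNIV. emeasure lborel (closure {\<Sum>m<k. \<tau> (lim_word L1 m) |k. lim_word L1 k = i})) \<le> 1"
    proof -
      let ?S = "\<Sum>i\<in>UNIV. emeasure lborel (closure {wsum \<tau> r |r. (r, i) \<in> Pre d L1})"
      have "{\<Sum>m<k. \<tau> (lim_word L1 m) |k. lim_word L1 k = i} \<subseteq> {wsum \<tau> r |r. (r, i) \<in> Pre d L1}" for i
        unfolding sum_upto_wsum using map_lim_word_Pre by blast
      then have "(\<Sum>i\<in>UNIV. emeasure lborel (closure {\<Sum>m<k. \<tau> (lim_word L1 m) |k. lim_word L1 k = i})) \<le> ?S"
        by (intro sum_mono emeasure_mono closure_mono) auto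
      also have "?S \<le> 1"
      proof (rule ennreal_le_epsilon)
        fix e :: real assume e: "0 < e"
        \<comment> \<open>For \<open>eta\<close> at most 1 the excess
          \<open>6 * eta + 12 * eta\<^sup>2\<close> is at most \<open>18 * eta\<close>.\<close>
        define e' where "e' = min 1 (e / 18)"
        have e': "0 < e'" "e' \<le> 1" "18 * e' \<le> e" using e by (auto simp: e'_def)
        obtain m0 :: nat where m0: "39 / e' < m0" using reals_Archimedean2 by blast
        obtain m N where m: "Suc m0 \<le> m" "block (m\<^sup>2) d N"
          "brun_seq.tail_bound (\<lambda>k. d (N + (3 + k))) (\<lambda>k. z (N + (3 + k))) (6 * (real m + 1))"
          by (rule good_level[of "Suc m0"]) simp
        define eta where "eta = (6 * (real m + 1) + 1) * (3 / (real (m\<^sup>2) + 1))"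
        have eta0: "0 \<le> eta" by (simp add: eta_def)
        have mp: "0 < real m" "1 \<le> real m" using m(1) by simp_all
        \<comment> \<open>Here \<open>6 * (m + 1) + 1\<close> is at most \<open>13 * m\<close>, and
          together with the factor 3 and \<open>K = m\<^sup>2\<close> this gives
          \<open>39 / m\<close>.\<close>
        have "eta \<le> (13 * real m) * (3 / (real m)\<^sup>2)"
          unfolding eta_def using mp
          by (intro mult_mono divide_left_mono mult_pos_pos) (auto intro: add_nonneg_pos)
        also have "\<dots> = 39 / m" using mp by (simp add: power2_eq_square)
        also have "\<dots> \<le> e'"
        proof -
          have "39 < e' * m0" using m0 e' by (simp add: field_simps)
          also have "\<dots> \<le> e' * m" using m(1) e' by (intro mult_left_mono) simp_all
          finally show ?thesis using mp by (simp add: field_simps)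
        qed
        finally have eta: "eta \<le> e'" .
        have "?S \<le> ennreal (1 + 6 * eta + 12 * eta\<^sup>2)"
          by (rule pieces_area[OF orth det m(2,3) eta_def eta0])
        also have "1 + 6 * eta + 12 * eta\<^sup>2 \<le> 1 + e"
        proof -
          have "eta\<^sup>2 \<le> eta * 1" unfolding power2_eq_square using eta e' eta0 by (intro mult_left_mono) simp_all
          then show ?thesis using eta e' by simp
        qed
        finally show "?S \<le> 1 + ennreal e" using e by (simp add: ennreal_leI ennreal_plus)
      qed
      finally show ?thesis .
    qed
  qed (rule dense)
  have "T.X = X" unfolding X_def T.X_def by (rule sadic_words_eq[symmetric])
  then show ?thesis using T.natural_coding by simp
qed

end

section \<open>Cylinders of the accelerated algorithm\<close>

definition irr :: "real \<times> real \<Rightarrow> bool" where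
  "irr x \<longleftrightarrow> x \<in> Delta2 \<and>
     (\<forall>a b c :: int. of_int a * fst x + of_int b * snd x + of_int c = 0 \<longrightarrow> a = 0 \<and> b = 0 \<and> c = 0)"

lemma irrD: "irr x \<Longrightarrow> of_int a * fst x + of_int b * snd x + of_int c = 0 \<Longrightarrow> a = 0 \<and> b = 0 \<and> c = (0 :: int)"
  unfolding irr_def by blast

lemma irr_open_Delta2: "irr x \<Longrightarrow> x \<in> open_Delta2"
proof -
  assume x: "irr x"
  have "fst x \<noteq> 0" using irrD[OF x, of 1 0 0] by auto
  moreover have "fst x \<noteq> snd x" using irrD[OF x, of 1 "-1" 0] by auto
  moreover have "snd x \<noteq> 1" using irrD[OF x, of 0 1 "-1"] by auto
  ultimately show ?thesis using x by (cases x) (auto simp: irr_def Delta2_def open_Delta2_def)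
qed

definition acc_digit :: "real \<times> real \<Rightarrow> digit" where
  "acc_digit x = (nat \<lfloor>1 / snd x\<rfloor> - 1, \<not> fst x / snd x \<le> frac (1 / snd x))"

text \<open>In terms of \<open>1 / x2\<close> and \<open>x1 / x2\<close>, a run of Brun's map
  removes the integer part of the first and keeps the second; the two results are then sorted. The
  bit of \<open>acc_digit\<close> tells which of them is smaller.\<close>

definition acc_map :: "real \<times> real \<Rightarrow> real \<times> real" where
  "acc_map x = (min (fst x / snd x) (frac (1 / snd x)), max (fst x / snd x) (frac (1 / snd x)))"

lemma acc_branch_digit:
  assumes "irr x" shows "x = acc_branch (acc_digit x) (acc_map x)"
proof -
  obtain x1 x2 where x: "x = (x1, x2)" by (cases x)
  have b: "0 < x1" "x1 < x2" "x2 < 1" using irr_open_Delta2[OF assms] by (simp_all add: x open_Delta2_def)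
  define n where "n = \<lfloor>1 / x2\<rfloor>"
  have "1 \<le> n" using b by (simp add: n_def le_floor_iff)
  then have "real (nat n - 1) = of_int n - 1" by (subst of_nat_diff) (simp_all add: le_nat_iff)
  then have s: "frac (1 / x2) + 1 + real (nat \<lfloor>1 / x2\<rfloor> - 1) = 1 / x2" by (simp add: frac_def n_def)
  show ?thesis
    using b s by (simp add: x acc_digit_def acc_map_def min_def max_def)
qed

lemma irr_acc_map:
  assumes "irr x" shows "irr (acc_map x)"
proof -
  obtain x1 x2 where x: "x = (x1, x2)" by (cases x)
  have b: "0 < x1" "x1 < x2" "x2 < 1" using irr_open_Delta2[OF assms] by (simp_all add: x open_Delta2_def)
  define p r where "p = x1 / x2" and "r = frac (1 / x2)"
  have pr: "0 \<le> p" "p \<le> 1" "0 \<le> r" "r \<le> 1" using b by (simp_all add: p_def r_def less_imp_le[OF frac_lt_1])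
  have *: "a = 0 \<and> b = 0 \<and> c = 0" if "of_int a * p + of_int b * r + of_int c = 0" for a b c :: int
  proof -
    have e: "x2 * r = 1 - x2 * of_int \<lfloor>1 / x2\<rfloor>" "x2 * p = x1"
      using \<open>0 < x1\<close> \<open>x1 < x2\<close> by (simp_all add: r_def p_def frac_def algebra_simps)
    have "of_int a * x1 + of_int (c - b * \<lfloor>1 / x2\<rfloor>) * x2 + of_int b = of_int a * (x2 * p) + of_int b * (x2 * r) + of_int c * x2"
      unfolding e by (simp add: algebra_simps)
    also have "\<dots> = x2 * (of_int a * p + of_int b * r + of_int c)" by (simp add: algebra_simps)
    also have "\<dots> = 0" using that by simp
    finally have "of_int a * x1 + of_int (c - b * \<lfloor>1 / x2\<rfloor>) * x2 + of_int b = 0" .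
    then show ?thesis using irrD[OF assms, of a "c - b * \<lfloor>1 / x2\<rfloor>" b] by (auto simp: x)
  qed
  have "acc_map x = (p, r) \<or> acc_map x = (r, p)"
    by (auto simp: acc_map_def x p_def r_def min_def max_def)
  moreover have "acc_map x \<in> Delta2"
    using pr by (auto simp: acc_map_def x Delta2_def simp flip: p_def r_def)
  moreover have "a = 0 \<and> b = 0 \<and> c = 0" if "of_int a * r + of_int b * p + of_int c = 0" for a b c :: int
    using *[of b a c] that by (simp add: algebra_simps)
  ultimately show ?thesis
    using * unfolding irr_def by (elim disjE) (simp_all only: fst_conv snd_conv simp_thms, blast+)
qed

definition digits :: "real \<times> real \<Rightarrow> nat \<Rightarrow> digit" where
  "digits x n = acc_digit ((acc_map ^^ n) x)"

lemma irr_acc_iter: "irr x \<Longrightarrow> irr ((acc_map ^^ n) x)"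
  by (induction n) (simp_all add: irr_acc_map)

lemma brun_seq_digits: "irr x \<Longrightarrow> brun_seq (digits x) (\<lambda>n. (acc_map ^^ n) x)"
  by (rule brun_seq.intro)
     (simp_all add: irr_acc_iter irr_open_Delta2 digits_def acc_branch_digit[symmetric])

lemma digits_acc_map: "digits (acc_map x) n = digits x (Suc n)"
  by (simp add: digits_def funpow_swap1)

section \<open>Charts of cylinders and their areas\<close>

definition chart :: "(letter \<Rightarrow> real \<times> real) \<Rightarrow> (letter \<Rightarrow> real) \<Rightarrow> real \<times> real \<Rightarrow> real \<times> real" where
  "chart B H z = (1 / (fst z * H L1 + snd z * H L2 + H L3)) *\<^sub>R (fst z *\<^sub>R B L1 + snd z *\<^sub>R B L2 + B L3)"

text \<open>\<open>chart B H\<close> is the projective map of the matrix with rows \<open>B\<close>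
  (two coordinates) and \<open>H\<close>, divided by the \<open>H\<close>-coordinate. Precomposing
  with an inverse branch multiplies this matrix by an incidence matrix, which is \<open>push\<close>
  on the rows.\<close>

lemma chart_branch:
  assumes "z \<in> open_Delta2"
  shows "chart B H (acc_branch e z) = chart (push B e) (push H e) z"
proof -
  obtain a b z1 z2 where e: "e = (a, b)" "z = (z1, z2)" by (cases e, cases z)
  have z: "0 < z1" "z1 < z2" using assms by (simp_all add: open_Delta2_def e)
  define s where "s = (if b then z1 else z2) + 1 + real a"
  have s: "s > 0" unfolding s_def using z by simp
  have br: "acc_branch e z = (if b then (z2 / s, 1 / s) else (z1 / s, 1 / s))" by (simp add: s_def e)
  have *: "fst z *\<^sub>R push g e L1 + snd z *\<^sub>R push g e L2 + push g e L3
    = s *\<^sub>R (fst (acc_branch e z) *\<^sub>R g L1 + snd (acc_branch e z) *\<^sub>R g L2 + g L3)" for g :: "letter \<Rightarrow> 'v::real_vector"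
  proof -
    have "s *\<^sub>R (fst (acc_branch e z) *\<^sub>R g L1 + snd (acc_branch e z) *\<^sub>R g L2 + g L3)
      = (if b then z2 *\<^sub>R g L1 + g L2 + s *\<^sub>R g L3 else z1 *\<^sub>R g L1 + g L2 + s *\<^sub>R g L3)"
      using s unfolding br by (simp add: scaleR_right_distrib)
    then show ?thesis by (simp add: e push_simps s_def algebra_simps)
  qed
  have H: "fst z * push H e L1 + snd z * push H e L2 + push H e L3
      = s * (fst (acc_branch e z) * H L1 + snd (acc_branch e z) * H L2 + H L3)"
    using *[of H] by simp
  show ?thesis unfolding chart_def *[of B] H using s by simp
qed

text \<open>The determinant of the matrix of \<open>B\<close> and \<open>H\<close>, expanded along
  the row \<open>H\<close>.\<close>

definition vol :: "(letter \<Rightarrow> real \<times> real) \<Rightarrow> (letter \<Rightarrow> real) \<Rightarrow> real" where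
  "vol B H = H L1 * det2 (B L2) (B L3) - H L2 * det2 (B L1) (B L3) + H L3 * det2 (B L1) (B L2)"

lemma vol_push: "\<bar>vol (push B e) (push H e)\<bar> = \<bar>vol B H\<bar>"
proof -
  obtain a b where e: "e = (a, b)" by (cases e)
  have "vol (push B e) (push H e) = (if b then 1 else -1) * vol B H"
    by (simp add: e vol_def push_simps det2_def algebra_simps)
  then show ?thesis by simp
qed

text \<open>What is known about the past of a point: unimodularity gives the exact area of its
  cylinder, and the order of the column sums gives the lower bound for the next block. Both persist
  under \<open>push\<close>.\<close>

definition frame :: "(letter \<Rightarrow> real \<times> real) \<Rightarrow> (letter \<Rightarrow> real) \<Rightarrow> bool" where
  "frame B H \<longleftrightarrow> \<bar>vol B H\<bar> = 1 \<and> 0 < H L1 \<and> 0 < H L2 \<and> 0 < H L3 \<and> H L1 \<le> H L3 \<and> H L2 \<le> H L3"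

lemma frame_push: "frame B H \<Longrightarrow> frame (push B e) (push H e)"
proof -
  assume f: "frame B H"
  obtain a b where e: "e = (a, b)" by (cases e)
  have "1 * H L3 \<le> real (Suc a) * H L3" using f by (intro mult_right_mono) (simp_all add: frame_def)
  define c where "c = real (Suc a) * H L3"
  have "H L3 \<le> c" using \<open>1 * H L3 \<le> _\<close> by (simp only: c_def mult_1)
  with f show ?thesis unfolding frame_def vol_push
    by (auto simp: e push_simps c_def[symmetric] simp del: of_nat_Suc)
qed

text \<open>Twice the area of the cylinder triangle with column sums \<open>H\<close>.\<close>

definition cyl_area :: "(letter \<Rightarrow> real) \<Rightarrow> real" where
  "cyl_area H = 1 / (H L3 * (H L2 + H L3) * (H L1 + H L2 + H L3))"

lemma cyl_area_nonneg: "frame B H \<Longrightarrow> 0 \<le> cyl_area H"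
  by (auto simp: frame_def cyl_area_def)

text \<open>Being covered by a Borel set of small area avoids measurability questions about the
  sets of exceptional points.\<close>

definition covered :: "(real \<times> real) set \<Rightarrow> real \<Rightarrow> bool" where
  "covered S r \<longleftrightarrow> (\<exists>U\<in>sets borel. S \<subseteq> U \<and> emeasure lborel U \<le> ennreal r)"

lemma covered_mono: "covered S r \<Longrightarrow> T \<subseteq> S \<Longrightarrow> r \<le> r' \<Longrightarrow> covered T r'"
  unfolding covered_def by (meson ennreal_leI order_trans)

lemma covered_UN:
  fixes A :: "nat \<Rightarrow> (real \<times> real) set"
  assumes A: "\<And>a. covered (A a) (r a)" and r: "\<And>a. 0 \<le> r a" and R: "\<And>m. (\<Sum>a<m. r a) \<le> R"
  shows "covered (\<Union>a. A a) R"
proof -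
  obtain U where U: "\<And>a. U a \<in> sets borel" "\<And>a. A a \<subseteq> U a" "\<And>a. emeasure lborel (U a) \<le> ennreal (r a)"
    using A unfolding covered_def by metis
  have "emeasure lborel (\<Union>a. U a) \<le> (\<Sum>a. emeasure lborel (U a))"
    using U(1) by (intro emeasure_subadditive_countably) auto
  also have "\<dots> = (SUP m. \<Sum>a<m. emeasure lborel (U a))" by (rule suminf_eq_SUP)
  also have "\<dots> \<le> ennreal R"
  proof (rule SUP_least)
    fix m
    have "(\<Sum>a<m. emeasure lborel (U a)) \<le> (\<Sum>a<m. ennreal (r a))" using U(3) by (intro sum_mono)
    also have "\<dots> = ennreal (\<Sum>a<m. r a)" using r by (intro sum_ennreal)
    also have "\<dots> \<le> ennreal R" using R by (rule ennreal_leI)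
    finally show "(\<Sum>a<m. emeasure lborel (U a)) \<le> ennreal R" .
  qed
  finally have "emeasure lborel (\<Union>a. U a) \<le> ennreal R" .
  moreover have "(\<Union>a. U a) \<in> sets borel" using U(1) by (intro sets.countable_UN') auto
  moreover have "(\<Union>a. A a) \<subseteq> (\<Union>a. U a)" using U(2) by blast
  ultimately show ?thesis unfolding covered_def by blast
qed

lemma covered_Un:
  assumes "covered S r" "covered T q" "0 \<le> r" "0 \<le> q"
  shows "covered (S \<union> T) (r + q)"
proof -
  obtain U V where U: "U \<in> sets borel" "S \<subseteq> U" "emeasure lborel U \<le> ennreal r"
    and V: "V \<in> sets borel" "T \<subseteq> V" "emeasure lborel V \<le> ennreal q"
    using assms(1,2) unfolding covered_def by blast
  have "emeasure lborel (U \<union> V) \<le> emeasure lborel U + emeasure lborel V"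
    using U V by (intro emeasure_subadditive) auto
  also have "\<dots> \<le> ennreal (r + q)" using U V assms by (simp add: add_mono)
  finally show ?thesis unfolding covered_def using U V by (intro bexI[of _ "U \<union> V"]) auto
qed

text \<open>The corners of \<open>Delta2\<close> go to \<open>P0\<close>, \<open>P1\<close>,
  \<open>P2\<close>, and the image triangle is covered by the parallelogram on two of its sides.
  This doubles the area, but as \<open>cyl_area\<close> carries the same factor throughout,
  conditional probabilities are not affected.\<close>

lemma covered_chart:
  assumes f: "frame B H"
  shows "covered (chart B H ` open_Delta2) (cyl_area H)"
proof -
  define h k l where "h = H L3" and "k = H L2 + H L3" and "l = H L1 + H L2 + H L3"
  have pos: "0 < h" "0 < k" "0 < l" using f by (simp_all add: frame_def h_def k_def l_def)
  define P0 where "P0 = (1 / h) *\<^sub>R B L3"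
  define P1 where "P1 = (1 / k) *\<^sub>R (B L2 + B L3)"
  define P2 where "P2 = (1 / l) *\<^sub>R (B L1 + B L2 + B L3)"
  let ?u = "P1 - P0" and ?v = "P2 - P0"
  have det: "h * k * l * det2 ?u ?v = vol B H \<or> h * k * l * det2 ?u ?v = - vol B H"
  proof -
    have e: "h *\<^sub>R P0 = B L3" "k *\<^sub>R P1 = B L2 + B L3" "l *\<^sub>R P2 = B L1 + B L2 + B L3"
      using pos by (simp_all add: P0_def P1_def P2_def)
    have "h * k * l * det2 ?u ?v = h * det2 (k *\<^sub>R P1) (l *\<^sub>R P2) - l * det2 (k *\<^sub>R P1) (h *\<^sub>R P0) - k * det2 (h *\<^sub>R P0) (l *\<^sub>R P2)"
      by (simp add: det2_def algebra_simps)
    also have "\<dots> = - vol B H" unfolding e by (simp add: det2_def vol_def h_def k_def l_def algebra_simps)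
    finally show ?thesis by simp
  qed
  then have "\<bar>h * k * l * det2 ?u ?v\<bar> = \<bar>vol B H\<bar>" by (elim disjE) (simp_all only: abs_minus_cancel)
  moreover have "\<bar>h * k * l * det2 ?u ?v\<bar> = h * k * l * \<bar>det2 ?u ?v\<bar>" using pos by (simp add: abs_mult)
  ultimately have hkl: "h * k * l * \<bar>det2 ?u ?v\<bar> = 1" using f by (simp add: frame_def)
  have "cyl_area H = 1 / (h * k * l)" by (simp add: cyl_area_def h_def k_def l_def)
  then have area: "\<bar>det2 ?u ?v\<bar> = cyl_area H"
    using eq_divide_imp[of "h * k * l" "\<bar>det2 ?u ?v\<bar>" 1] hkl pos by (simp add: mult.commute)
  let ?U = "(+) P0 ` parallelogram ?u ?v 0 1 0 1"
  have "chart B H ` open_Delta2 \<subseteq> ?U"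
  proof
    fix y assume "y \<in> chart B H ` open_Delta2"
    then obtain z1 z2 where z: "0 < z1" "z1 < z2" "z2 < 1" "y = chart B H (z1, z2)"
      by (auto simp: open_Delta2_def)
    define T where "T = z1 * H L1 + z2 * H L2 + H L3"
    have T: "T = z1 * l + (z2 - z1) * k + (1 - z2) * h" by (simp add: T_def h_def k_def l_def algebra_simps)
    have terms: "0 < z1 * l" "0 < (z2 - z1) * k" "0 < (1 - z2) * h" using z pos by simp_all
    then have T0: "0 < T" unfolding T by linarith
    have e: "h *\<^sub>R P0 = B L3" "k *\<^sub>R P1 = B L2 + B L3" "l *\<^sub>R P2 = B L1 + B L2 + B L3"
      using pos by (simp_all add: P0_def P1_def P2_def)
    define al be where "al = (z2 - z1) * k / T" and "be = z1 * l / T"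
    have "T *\<^sub>R (P0 + (al *\<^sub>R ?u + be *\<^sub>R ?v)) = T *\<^sub>R P0 + ((z2 - z1) * k) *\<^sub>R ?u + (z1 * l) *\<^sub>R ?v"
      using T0 by (simp add: al_def be_def scaleR_right_distrib)
    also have "\<dots> = (1 - z2) *\<^sub>R (h *\<^sub>R P0) + (z2 - z1) *\<^sub>R (k *\<^sub>R P1) + z1 *\<^sub>R (l *\<^sub>R P2)"
      unfolding T by (simp add: algebra_simps)
    also have "\<dots> = z1 *\<^sub>R B L1 + z2 *\<^sub>R B L2 + B L3" unfolding e by (simp add: algebra_simps)
    finally have "(1 / T) *\<^sub>R (T *\<^sub>R (P0 + (al *\<^sub>R ?u + be *\<^sub>R ?v))) = y"
      by (simp add: z(4) chart_def T_def)
    then have "y = P0 + (al *\<^sub>R ?u + be *\<^sub>R ?v)" using T0 by simp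
    moreover have "0 \<le> al" "al \<le> 1" "0 \<le> be" "be \<le> 1"
      using terms T0 by (simp_all add: al_def be_def T)
    then have "al *\<^sub>R ?u + be *\<^sub>R ?v \<in> parallelogram ?u ?v 0 1 0 1" unfolding parallelogram_def by force
    ultimately show "y \<in> ?U" by blast
  qed
  moreover have "compact ?U" by (intro compact_translation compact_parallelogram)
  then have "?U \<in> sets borel" by (rule borel_compact)
  moreover have "emeasure lborel ?U \<le> ennreal (cyl_area H)"
  proof -
    have m: "parallelogram ?u ?v 0 1 0 1 \<in> sets borel" by (rule borel_compact) simp
    have "emeasure lborel ?U = emeasure lborel (parallelogram ?u ?v 0 1 0 1)" by (rule emeasure_translate_image[OF m])
    also have "\<dots> \<le> ennreal (\<bar>det2 ?u ?v\<bar> * ((1 - 0) * (1 - 0)))"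
    proof (rule emeasure_parallelogram)
      show "det2 ?u ?v \<noteq> 0" using hkl by auto
    qed simp_all
    finally show ?thesis by (simp add: area)
  qed
  ultimately show ?thesis unfolding covered_def by blast
qed

section \<open>Subdivision of cylinders and the probability of a block\<close>

text \<open>One step of Brun's algorithm in terms of areas: the cylinder with column sums
  \<open>p\<close>, \<open>q\<close>, \<open>r\<close> splits into the cylinders of \<beta>2 and
  \<beta>3 and the cylinder of \<beta>1, in which \<open>q\<close> becomes \<open>q + r\<close>.
  Iterating the last one sums over the digits.\<close>

lemma cyl_area_step: 
  assumes "0 < p" "0 < q" "(0::real) < r"
  shows "1 / (r * (q + r) * (p + q + r)) = 1 / ((q + r) * (q + r + r) * (p + (q + r) + r))
     + 1 / ((q + r) * (p + (q + r)) * (r + p + (q + r))) + 1 / (r * (q + r + r) * (p + (q + r) + r))"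
proof -
  define x y where "x = q + r" and "y = p + q + r"
  have pos: "0 < r" "0 < x" "0 < y" "0 < x + r" "0 < y + r" using assms by (simp_all add: x_def y_def)
  have "1 / (x * (x + r) * (y + r)) + 1 / (x * y * (y + r)) + 1 / (r * (x + r) * (y + r)) = 1 / (r * x * y)"
  proof -
    have "1 / (x * (x + r) * (y + r)) + 1 / (r * (x + r) * (y + r)) = 1 / (r * x * (y + r))"
      using pos by (simp add: divide_simps)
    moreover have "1 / (r * x * (y + r)) + 1 / (x * y * (y + r)) = 1 / (r * x * y)"
      using pos by (simp add: divide_simps)
    ultimately show ?thesis by linarith
  qed
  then show ?thesis by (simp add: x_def y_def algebra_simps)
qed

lemma cyl_area_digit_sum:
  assumes "frame B H"
  shows "(\<Sum>a<m. cyl_area (push H (a, False)) + cyl_area (push H (a, True)))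
      = cyl_area H - 1 / (H L3 * (H L2 + real m * H L3 + H L3) * (H L1 + (H L2 + real m * H L3) + H L3))"
proof (induction m)
  case 0
  then show ?case by (simp add: cyl_area_def)
next
  case (Suc m)
  have pos: "0 < H L1" "0 < H L2 + real m * H L3" "0 < H L3"
    using assms by (auto simp: frame_def add_pos_nonneg)
  have "cyl_area (push H (m, False)) = 1 / ((H L2 + real m * H L3 + H L3) * (H L2 + real m * H L3 + H L3 + H L3) * (H L1 + (H L2 + real m * H L3 + H L3) + H L3))"
    by (simp add: cyl_area_def push_simps algebra_simps)
  moreover have "cyl_area (push H (m, True)) = 1 / ((H L2 + real m * H L3 + H L3) * (H L1 + (H L2 + real m * H L3 + H L3)) * (H L3 + H L1 + (H L2 + real m * H L3 + H L3)))"
    by (simp add: cyl_area_def push_simps algebra_simps)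
  moreover have "H L2 + real (Suc m) * H L3 = H L2 + real m * H L3 + H L3" by (simp add: algebra_simps)
  ultimately show ?case
    using cyl_area_step[OF pos] Suc.IH by simp
qed

lemma cyl_area_digits_le:
  assumes "frame B H"
  shows "(\<Sum>a<m. cyl_area (push H (a, False)) + cyl_area (push H (a, True))) \<le> cyl_area H"
  unfolding cyl_area_digit_sum[OF assms] using assms by (simp add: frame_def add_nonneg_nonneg)

lemma cyl_area_push_le:
  assumes f: "frame B H" shows "cyl_area (push H e) \<le> cyl_area H"
proof -
  obtain a b where e: "e = (a, b)" by (cases e)
  have t0: "0 \<le> cyl_area (push H e)" for e using cyl_area_nonneg[OF frame_push[OF f]] .
  have "cyl_area (push H e) \<le> cyl_area (push H (a, False)) + cyl_area (push H (a, True))"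
    using t0[of "(a, False)"] t0[of "(a, True)"] by (cases b) (simp_all add: e)
  also have "\<dots> \<le> (\<Sum>a<Suc a. cyl_area (push H (a, False)) + cyl_area (push H (a, True)))"
    using t0 by (simp add: sum_nonneg)
  also have "\<dots> \<le> cyl_area H" by (rule cyl_area_digits_le[OF f])
  finally show ?thesis .
qed

text \<open>If conditionally on each digit other than \<open>e0\<close> the exceptional proportion
  is \<open>c\<close>, the loss is \<open>c\<close> times the area that remains once the cylinder of
  \<open>e0\<close> is taken out.\<close>

lemma covered_digits:
  assumes f: "frame B H" and c: "0 \<le> c"
    and A: "\<And>e. e \<noteq> e0 \<Longrightarrow> covered (A e) (c * cyl_area (push H e))"
  shows "covered (\<Union>e\<in>- {e0}. A e) (c * (cyl_area H - cyl_area (push H e0)))"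
proof -
  define r where "r e = (if e = e0 then 0 else c * cyl_area (push H e))" for e
  define A' where "A' e = (if e = e0 then {} else A e)" for e
  have t0: "0 \<le> cyl_area (push H e)" for e using cyl_area_nonneg[OF frame_push[OF f]] .
  have r0: "0 \<le> r e" for e using t0 c by (simp add: r_def)
  have cA: "covered (A' e) (r e)" for e
    using A unfolding A'_def r_def by (auto simp: covered_def intro!: bexI[of _ "{}"])
  have cov: "covered (A' (a, False) \<union> A' (a, True)) (r (a, False) + r (a, True))" for a
    by (intro covered_Un cA r0)
  have R: "(\<Sum>a<m. r (a, False) + r (a, True)) \<le> c * (cyl_area H - cyl_area (push H e0))" for m
  proof -
    define M where "M = max m (Suc (fst e0))"
    have "(\<Sum>a<m. r (a, False) + r (a, True)) \<le> (\<Sum>a<M. r (a, False) + r (a, True))"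
      by (intro sum_mono2) (auto simp: M_def r0)
    also have "\<dots> = (\<Sum>a<M. c * (cyl_area (push H (a, False)) + cyl_area (push H (a, True))) - (if a = fst e0 then c * cyl_area (push H e0) else 0))"
      by (intro sum.cong refl) (cases e0, auto simp: r_def algebra_simps)
    also have "\<dots> = c * (\<Sum>a<M. cyl_area (push H (a, False)) + cyl_area (push H (a, True))) - c * cyl_area (push H e0)"
      by (simp add: sum_subtractf sum_distrib_left M_def)
    also have "\<dots> \<le> c * cyl_area H - c * cyl_area (push H e0)"
      using mult_left_mono[OF cyl_area_digits_le[OF f] c] by simp
    finally show ?thesis by (simp add: algebra_simps)
  qed
  have "covered (\<Union>a. A' (a, False) \<union> A' (a, True)) (c * (cyl_area H - cyl_area (push H e0)))"
    by (rule covered_UN[OF cov _ R]) (simp add: r0)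
  moreover have "(\<Union>e\<in>- {e0}. A e) \<subseteq> (\<Union>a. A' (a, False) \<union> A' (a, True))"
  proof
    fix y assume "y \<in> (\<Union>e\<in>- {e0}. A e)"
    then obtain a b where e: "(a, b) \<noteq> e0" "y \<in> A (a, b)" by auto
    then have "y \<in> A' (a, False) \<union> A' (a, True)" by (cases b) (auto simp: A'_def)
    then show "y \<in> (\<Union>a. A' (a, False) \<union> A' (a, True))" by blast
  qed
  ultimately show ?thesis by (rule covered_mono) simp
qed

lemma covered_all_digits:
  assumes f: "frame B H" and c: "0 \<le> c"
    and A: "\<And>e. covered (A e) (c * cyl_area (push H e))"
  shows "covered (\<Union>e. A e) (c * cyl_area H)"
proof -
  have t0: "0 \<le> cyl_area (push H e)" for e using cyl_area_nonneg[OF frame_push[OF f]] .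
  have "covered (\<Union>a. A (a, False) \<union> A (a, True)) (c * cyl_area H)"
  proof (rule covered_UN[of _ "\<lambda>a. c * cyl_area (push H (a, False)) + c * cyl_area (push H (a, True))"])
    show "covered (A (a, False) \<union> A (a, True)) (c * cyl_area (push H (a, False)) + c * cyl_area (push H (a, True)))" for a
      by (intro covered_Un A mult_nonneg_nonneg c t0)
    show "0 \<le> c * cyl_area (push H (a, False)) + c * cyl_area (push H (a, True))" for a using c t0 by simp
    show "(\<Sum>a<m. c * cyl_area (push H (a, False)) + c * cyl_area (push H (a, True))) \<le> c * cyl_area H" for m
      using mult_left_mono[OF cyl_area_digits_le[OF f] c, of m] by (simp add: sum_distrib_left distrib_left)
  qed
  moreover have "(\<Union>e. A e) \<subseteq> (\<Union>a. A (a, False) \<union> A (a, True))"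
  proof
    fix y assume "y \<in> (\<Union>e. A e)"
    then obtain a b where "y \<in> A (a, b)" by auto
    then have "y \<in> A (a, False) \<union> A (a, True)" by (cases b) auto
    then show "y \<in> (\<Union>a. A (a, False) \<union> A (a, True))" by blast
  qed
  ultimately show ?thesis by (rule covered_mono) simp
qed

definition block_prob :: "nat \<Rightarrow> real" where
  "block_prob K = 1 / (6 * (real K + 2) ^ 6)"

lemma block_prob_bounds: "0 < block_prob K" "block_prob K \<le> 1"
proof -
  show "0 < block_prob K" by (simp add: block_prob_def)
  have "1 \<le> (real K + 2) ^ 6" by (intro one_le_power) simp
  then have "1 \<le> 6 * (real K + 2) ^ 6" by linarith
  then show "block_prob K \<le> 1" by (simp add: block_prob_def divide_le_eq)
qed

definition push3 :: "nat \<Rightarrow> (letter \<Rightarrow> 'v::real_vector) \<Rightarrow> letter \<Rightarrow> 'v" where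
  "push3 K g = push (push (push g (K, False)) (0, True)) (K, False)"

text \<open>With \<open>h\<close> the largest column sum, the area is at most
  \<open>1 / h ^ 3\<close>. A block raises all column sums to at most
  \<open>(K + 2)\<^sup>2 * h\<close>, and the three factors of the new denominator are at most one,
  two and three times this.\<close>

lemma cyl_area_block:
  assumes f: "frame B H"
  shows "block_prob K * cyl_area H \<le> cyl_area (push3 K H)"
proof -
  define h where "h = H L3"
  define u where "u = (real K + 2)\<^sup>2"
  have h: "0 < h" "0 < H L1" "H L1 \<le> h" "0 < H L2" "H L2 \<le> h" using f by (simp_all add: frame_def h_def)
  have u: "u = real K * real K + 4 * real K + 4" by (simp add: u_def power2_eq_square algebra_simps)
  have u1: "0 < u" by (simp add: u_def)
  have v: "push3 K H L1 = H L2 + (real K + 1) * h" "push3 K H L2 = H L2 + (real K + 2) * h"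
    "push3 K H L3 = H L1 + (real K + 1) * (H L2 + (real K + 2) * h)"
    by (simp_all add: push3_def push_simps h_def algebra_simps)
  have Kh: "0 \<le> real K * h" using h by simp
  have KH: "real K * H L2 \<le> real K * h" using h by (intro mult_left_mono) simp_all
  have KKh: "0 \<le> real K * (real K * h)" using h by simp
  have b: "push3 K H L1 \<le> u * h" "push3 K H L2 \<le> u * h" "push3 K H L3 \<le> u * h"
  proof -
    define a1 a2 a3 where "a1 = real K * h" and "a2 = real K * (real K * h)" and "a3 = real K * H L2"
    have a: "0 \<le> a1" "0 \<le> a2" "a3 \<le> a1" using Kh KH KKh by (simp_all only: a1_def a2_def a3_def)
    have "u * h = a2 + 4 * a1 + 4 * h" "push3 K H L1 = H L2 + a1 + h" "push3 K H L2 = H L2 + a1 + 2 * h"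
      "push3 K H L3 = H L1 + a3 + H L2 + a2 + 3 * a1 + 2 * h"
      by (simp_all add: u v a1_def a2_def a3_def algebra_simps)
    then show "push3 K H L1 \<le> u * h" "push3 K H L2 \<le> u * h" "push3 K H L3 \<le> u * h"
      using a h by linarith+
  qed
  have p: "0 < push3 K H L1" "0 < push3 K H L2" "0 < push3 K H L3"
    unfolding v using h by (simp_all add: add_pos_nonneg)
  have "cyl_area H \<le> 1 / (h * h * h)"
  proof -
    have "h * h * h \<le> H L3 * (H L2 + H L3) * (H L1 + H L2 + H L3)"
      using h by (intro mult_mono) (simp_all add: h_def)
    then show ?thesis unfolding cyl_area_def using h by (intro divide_left_mono) (simp_all add: h_def)
  qed
  then have "block_prob K * cyl_area H \<le> block_prob K * (1 / (h * h * h))"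
    using block_prob_bounds[of K] by (intro mult_left_mono) simp_all
  also have "\<dots> = 1 / ((u * h) * (2 * (u * h)) * (3 * (u * h)))"
  proof -
    have "(real K + 2) ^ 6 = u * u * u" by (simp add: u_def power2_eq_square eval_nat_numeral)
    then show ?thesis by (simp add: block_prob_def)
  qed
  also have "\<dots> \<le> cyl_area (push3 K H)"
  proof -
    have "push3 K H L3 * (push3 K H L2 + push3 K H L3) * (push3 K H L1 + push3 K H L2 + push3 K H L3)
        \<le> (u * h) * (2 * (u * h)) * (3 * (u * h))"
      using b p by (intro mult_mono) simp_all
    then show ?thesis unfolding cyl_area_def using p h u1 by (intro divide_left_mono) simp_all
  qed
  finally show ?thesis .
qed

text \<open>The trials are three digits apart, so the digits inspected by different trials are
  disjoint; \<open>k\<close> is the number of digits before the next trial.\<close>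

definition no_block :: "nat \<Rightarrow> nat \<Rightarrow> nat \<Rightarrow> (real \<times> real) set" where
  "no_block K k n = {x. irr x \<and> (\<forall>i<n. \<not> block K (digits x) (k + 3 * i))}"

lemma no_block_acc:
  assumes "x \<in> no_block K (Suc k) n"
  shows "acc_map x \<in> no_block K k n"
proof -
  have "block K (digits (acc_map x)) m = block K (digits x) (Suc m)" for m
    by (simp add: block_def digits_acc_map)
  then show ?thesis using assms by (auto simp: no_block_def irr_acc_map)
qed

lemma chart_acc:
  assumes "irr x"
  shows "chart B H x = chart (push B (acc_digit x)) (push H (acc_digit x)) (acc_map x)"
  using chart_branch[OF irr_open_Delta2[OF irr_acc_map[OF assms]], of B H "acc_digit x"]
  by (simp only: acc_branch_digit[OF assms, symmetric])

text \<open>Outer induction on the number of trials, inner induction on the digits to wait. Both are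
  over all frames, which expresses that the probability of success is bounded below whatever the
  past.\<close>

lemma covered_no_block:
  "frame B H \<Longrightarrow> covered (chart B H ` no_block K k n) ((1 - block_prob K) ^ n * cyl_area H)"
proof (induction n arbitrary: k B H)
  case 0
  have "no_block K k 0 \<subseteq> open_Delta2" by (auto simp: no_block_def irr_open_Delta2)
  then show ?case using covered_chart[OF 0] by (auto intro: covered_mono)
next
  case (Suc n)
  let ?c = "(1 - block_prob K) ^ n"
  have c0: "0 \<le> ?c" using block_prob_bounds[of K] by simp
  show ?case using Suc.prems
  proof (induction k arbitrary: B H)
    case (Suc k)
    let ?A = "\<lambda>e. chart (push B e) (push H e) ` no_block K k (Suc n)"
    have "covered (\<Union>e. ?A e) ((1 - block_prob K) ^ Suc n * cyl_area H)"
      using block_prob_bounds[of K]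
      by (intro covered_all_digits[OF Suc.prems] Suc.IH frame_push Suc.prems) simp
    moreover have "chart B H ` no_block K (Suc k) (Suc n) \<subseteq> (\<Union>e. ?A e)"
    proof
      fix y assume "y \<in> chart B H ` no_block K (Suc k) (Suc n)"
      then obtain x where x: "x \<in> no_block K (Suc k) (Suc n)" "y = chart B H x" by blast
      then have "irr x" by (simp add: no_block_def)
      then have "y = chart (push B (acc_digit x)) (push H (acc_digit x)) (acc_map x)"
        unfolding x(2) by (rule chart_acc)
      then show "y \<in> (\<Union>e. ?A e)" using no_block_acc[OF x(1)] by blast
    qed
    ultimately show ?case by (rule covered_mono) simp
  next
    case 0
    define e1 e2 where "e1 = (K, False)" and "e2 = (0 :: nat, True)"
    define B1 H1 where "B1 = push B e1" and "H1 = push H e1"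
    define B2 H2 where "B2 = push B1 e2" and "H2 = push H1 e2"
    define B3 H3 where "B3 = push B2 e1" and "H3 = push H2 e1"
    note f0 = 0
    have f1: "frame B1 H1" unfolding B1_def H1_def by (rule frame_push[OF f0])
    have f2: "frame B2 H2" unfolding B2_def H2_def by (rule frame_push[OF f1])
    have H3: "H3 = push3 K H" by (simp add: H3_def H2_def H1_def push3_def e1_def e2_def)
    \<comment> \<open>A failing trial deviates from the block at its first, second or third digit;
      accordingly 2, 1 or 0 digits remain before the next trial. The three losses telescope to the
      area outside the cylinder of the block.\<close>
    let ?A0 = "\<lambda>e. chart (push B e) (push H e) ` no_block K 2 n"
    let ?A1 = "\<lambda>e. chart (push B1 e) (push H1 e) ` no_block K 1 n"
    let ?A2 = "\<lambda>e. chart (push B2 e) (push H2 e) ` no_block K 0 n"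
    have c1: "covered (\<Union>e\<in>- {e1}. ?A0 e) (?c * (cyl_area H - cyl_area H1))"
      unfolding H1_def by (intro covered_digits[OF f0] Suc.IH frame_push f0 c0)
    have c2: "covered (\<Union>e\<in>- {e2}. ?A1 e) (?c * (cyl_area H1 - cyl_area H2))"
      unfolding H2_def by (intro covered_digits[OF f1] Suc.IH frame_push f1 c0)
    have c3: "covered (\<Union>e\<in>- {e1}. ?A2 e) (?c * (cyl_area H2 - cyl_area H3))"
      unfolding H3_def by (intro covered_digits[OF f2] Suc.IH frame_push f2 c0)
    have t: "0 \<le> ?c * (cyl_area H - cyl_area H1)" "0 \<le> ?c * (cyl_area H1 - cyl_area H2)" "0 \<le> ?c * (cyl_area H2 - cyl_area H3)"
      using c0 cyl_area_push_le[OF f0, of e1] cyl_area_push_le[OF f1, of e2] cyl_area_push_le[OF f2, of e1]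
      by (simp_all add: H1_def H2_def H3_def)
    have "covered ((\<Union>e\<in>- {e1}. ?A0 e) \<union> ((\<Union>e\<in>- {e2}. ?A1 e) \<union> (\<Union>e\<in>- {e1}. ?A2 e)))
        (?c * (cyl_area H - cyl_area H1) + (?c * (cyl_area H1 - cyl_area H2) + ?c * (cyl_area H2 - cyl_area H3)))"
      using t by (intro covered_Un c1 c2 c3) simp_all
    moreover have "chart B H ` no_block K 0 (Suc n) \<subseteq> (\<Union>e\<in>- {e1}. ?A0 e) \<union> ((\<Union>e\<in>- {e2}. ?A1 e) \<union> (\<Union>e\<in>- {e1}. ?A2 e))"
    proof
      fix y assume "y \<in> chart B H ` no_block K 0 (Suc n)"
      then obtain x where x: "x \<in> no_block K 0 (Suc n)" "y = chart B H x" by blast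
      then have irr: "irr x" and nb: "\<And>i. i < Suc n \<Longrightarrow> \<not> block K (digits x) (3 * i)" by (auto simp: no_block_def)
      have "x \<in> no_block K (Suc 2) n"
        unfolding no_block_def using irr nb[of "Suc _"] by (simp add: numeral_3_eq_3)
      from no_block_acc[OF this] have x1: "acc_map x \<in> no_block K (Suc 1) n" by (simp add: numeral_2_eq_2)
      from no_block_acc[OF x1] have x2: "acc_map (acc_map x) \<in> no_block K (Suc 0) n" by simp
      from no_block_acc[OF x2] have x3: "acc_map (acc_map (acc_map x)) \<in> no_block K 0 n" .
      have d: "digits x 0 = acc_digit x" "digits x (Suc 0) = acc_digit (acc_map x)" "digits x (Suc (Suc 0)) = acc_digit (acc_map (acc_map x))"
        by (simp_all add: digits_def)
      have y1: "y = chart (push B (acc_digit x)) (push H (acc_digit x)) (acc_map x)"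
        unfolding x(2) by (rule chart_acc[OF irr])
      show "y \<in> (\<Union>e\<in>- {e1}. ?A0 e) \<union> ((\<Union>e\<in>- {e2}. ?A1 e) \<union> (\<Union>e\<in>- {e1}. ?A2 e))"
      proof (cases "acc_digit x = e1")
        case False
        then show ?thesis using y1 x1 by (auto simp: numeral_2_eq_2)
      next
        case e1: True
        then have y: "y = chart B1 H1 (acc_map x)" using y1 by (simp add: B1_def H1_def)
        have y2: "y = chart (push B1 (acc_digit (acc_map x))) (push H1 (acc_digit (acc_map x))) (acc_map (acc_map x))"
          unfolding y by (rule chart_acc[OF irr_acc_map[OF irr]])
        show ?thesis
        proof (cases "acc_digit (acc_map x) = e2")
          case False
          then show ?thesis using y2 x2 by auto
        next
          case e2: True
          then have y: "y = chart B2 H2 (acc_map (acc_map x))" using y2 by (simp add: B2_def H2_def)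
          have y3: "y = chart (push B2 (acc_digit (acc_map (acc_map x)))) (push H2 (acc_digit (acc_map (acc_map x)))) (acc_map (acc_map (acc_map x)))"
            unfolding y by (rule chart_acc[OF irr_acc_map[OF irr_acc_map[OF irr]]])
          have "acc_digit (acc_map (acc_map x)) \<noteq> e1"
            using nb[of 0] e1 e2 by (auto simp: block_def d e1_def e2_def)
          then show ?thesis using y3 x3 by auto
        qed
      qed
    qed
    moreover have "?c * (cyl_area H - cyl_area H1) + (?c * (cyl_area H1 - cyl_area H2) + ?c * (cyl_area H2 - cyl_area H3)) \<le> (1 - block_prob K) ^ Suc n * cyl_area H"
    proof -
      have "?c * (cyl_area H - cyl_area H1) + (?c * (cyl_area H1 - cyl_area H2) + ?c * (cyl_area H2 - cyl_area H3)) = ?c * (cyl_area H - cyl_area H3)"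
        by (simp add: algebra_simps)
      also have "\<dots> \<le> ?c * ((1 - block_prob K) * cyl_area H)"
        using cyl_area_block[OF f0, of K] by (intro mult_left_mono c0) (simp add: H3 algebra_simps)
      finally show ?thesis by (simp add: mult_ac)
    qed
    ultimately show ?case by (rule covered_mono)
  qed
qed

section \<open>The exceptional set in frequency coordinates\<close>

definition base :: "letter \<Rightarrow> real \<times> real" where
  "base j = (if j = L1 then (1, 0) else if j = L2 then (0, 1) else 0)"

definition freq :: "real \<times> real \<Rightarrow> real \<times> real" where
  "freq = chart base (\<lambda>_. 1)"

lemma frame_base: "frame base (\<lambda>_. 1)"
  by (simp add: frame_def vol_def base_def det2_def)

lemma cyl_area_one: "cyl_area (\<lambda>_. 1) = 1 / 6"
  by (simp add: cyl_area_def)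

text \<open>This is \<open>m\<close> divided by \<open>block_prob (m\<^sup>2)\<close>: all trials
  fail with probability at most \<open>exp (- m)\<close>, while the number itself is polynomial in
  \<open>m\<close>.\<close>

definition trials :: "nat \<Rightarrow> nat" where
  "trials m = 6 * m * (m\<^sup>2 + 2) ^ 6"

text \<open>Stage \<open>m\<close> succeeds if \<open>W\<close> with \<open>K = m\<^sup>2\<close> occurs among the first trials and each of its
  possible occurrences is followed by a regular tail, whose size is only linear in \<open>m\<close>.\<close>

definition bad :: "nat \<Rightarrow> (real \<times> real) set" where
  "bad m = no_block (m\<^sup>2) 0 (trials m) \<union>
     (\<Union>k\<in>{..<trials m}. \<Union>s. no_block 5 (3 * Suc k + 3 * superblock m s) (m + s))"

lemma not_bad:
  assumes "irr x" "x \<notin> bad m"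
  shows "\<exists>N. block (m\<^sup>2) (digits x) N \<and> regular_tail m (\<lambda>k. digits x (N + (3 + k)))"
proof -
  obtain k where k: "k < trials m" "block (m\<^sup>2) (digits x) (3 * k)"
    using assms by (auto simp: bad_def no_block_def)
  have "regular_tail m (\<lambda>j. digits x (3 * k + (3 + j)))"
    unfolding regular_tail_def
  proof
    fix s
    have "x \<notin> no_block 5 (3 * Suc k + 3 * superblock m s) (m + s)"
      using assms(2) k(1) by (auto simp: bad_def)
    then obtain i where i: "i < m + s" "block 5 (digits x) (3 * Suc k + 3 * superblock m s + 3 * i)"
      using assms(1) by (auto simp: no_block_def)
    have "block 5 (\<lambda>j. digits x (3 * k + (3 + j))) (3 * (superblock m s + i))"
      using i(2) by (simp add: block_def algebra_simps)
    then show "\<exists>j\<ge>superblock m s. j < superblock m (Suc s) \<and> block 5 (\<lambda>j. digits x (3 * k + (3 + j))) (3 * j)"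
      using i(1) by (intro exI[of _ "superblock m s + i"]) (simp add: superblock_def)
  qed
  then show ?thesis using k(2) by blast
qed

definition rate :: "nat \<Rightarrow> real" where
  "rate m = (1 - block_prob (m\<^sup>2)) ^ trials m + real (trials m) * ((1 - block_prob 5) ^ m / block_prob 5)"

text \<open>The growing windows make the failures in the tail after a given trial a geometric series
  starting at \<open>\<theta> ^ m\<close>; a union bound over the trials multiplies it by
  \<open>trials m\<close>.\<close>

lemma covered_bad: "covered (freq ` bad m) (rate m)"
proof -
  define \<theta> where "\<theta> = 1 - block_prob 5"
  have th: "0 \<le> \<theta>" "\<theta> < 1" "1 - \<theta> = block_prob 5" using block_prob_bounds[of 5] by (simp_all add: \<theta>_def)
  define c where "c = \<theta> ^ m / block_prob 5"
  have c0: "0 \<le> c" using th block_prob_bounds[of 5] by (simp add: c_def)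
  have nb: "covered (freq ` no_block K k n) ((1 - block_prob K) ^ n)" for K k n
    using covered_no_block[OF frame_base, of K k n] block_prob_bounds[of K]
    by (auto simp: freq_def cyl_area_one intro: covered_mono)
  define S where "S k = (\<Union>s. freq ` no_block 5 (3 * Suc k + 3 * superblock m s) (m + s))" for k
  have S: "covered (S k) c" for k
    unfolding S_def
  proof (rule covered_UN[where r = "\<lambda>s. \<theta> ^ (m + s)"])
    show "covered (freq ` no_block 5 (3 * Suc k + 3 * superblock m s) (m + s)) (\<theta> ^ (m + s))" for s
      unfolding \<theta>_def by (rule nb)
    show "(\<Sum>s<n. \<theta> ^ (m + s)) \<le> c" for n
    proof -
      have "(\<Sum>s<n. \<theta> ^ (m + s)) = \<theta> ^ m * (\<Sum>s<n. \<theta> ^ s)" by (simp add: power_add sum_distrib_left)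
      also have "(\<Sum>s<n. \<theta> ^ s) = (1 - \<theta> ^ n) / (1 - \<theta>)" using th by (subst sum_gp_strict) simp
      also have "\<dots> \<le> 1 / (1 - \<theta>)" using th by (intro divide_right_mono) simp_all
      finally show ?thesis using th by (simp add: c_def mult_left_mono)
    qed
  qed (use th in simp)
  have "covered (\<Union>k. if k < trials m then S k else {}) (real (trials m) * c)"
  proof (rule covered_UN[where r = "\<lambda>k. if k < trials m then c else 0"])
    show "covered (if k < trials m then S k else {}) (if k < trials m then c else 0)" for k
      using S by (auto simp: covered_def intro!: bexI[of _ "{}"])
    show "0 \<le> (if k < trials m then c else 0)" for k using c0 by simp
    show "(\<Sum>k<n. if k < trials m then c else 0) \<le> real (trials m) * c" for n
    proof -
      have "(\<Sum>k<n. if k < trials m then c else 0) = real (card ({..<n} \<inter> {..<trials m})) * c"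
        by (simp add: sum.If_cases lessThan_def)
      also have "\<dots> \<le> real (trials m) * c"
        using c0 card_mono[of "{..<trials m}" "{..<n} \<inter> {..<trials m}"] by (intro mult_right_mono) simp_all
      finally show ?thesis .
    qed
  qed
  from covered_Un[OF nb[of "m\<^sup>2" 0 "trials m"] this]
  have "covered (freq ` no_block (m\<^sup>2) 0 (trials m) \<union> (\<Union>k. if k < trials m then S k else {}))
      ((1 - block_prob (m\<^sup>2)) ^ trials m + real (trials m) * c)"
    using c0 block_prob_bounds[of "m\<^sup>2"] by simp
  then have "covered (freq ` no_block (m\<^sup>2) 0 (trials m) \<union> (\<Union>k. if k < trials m then S k else {})) (rate m)"
    by (simp only: rate_def c_def \<theta>_def)
  moreover have "freq ` bad m \<subseteq> freq ` no_block (m\<^sup>2) 0 (trials m) \<union> (\<Union>k. if k < trials m then S k else {})"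
    unfolding bad_def S_def image_Un image_UN by (auto 0 3)
  ultimately show ?thesis by (rule covered_mono) simp
qed

lemma rate_tendsto_0: "rate \<longlonglongrightarrow> 0"
proof -
  define \<theta> where "\<theta> = 1 - block_prob 5"
  have th: "0 \<le> \<theta>" "\<theta> < 1" using block_prob_bounds[of 5] by (simp_all add: \<theta>_def)
  \<comment> \<open>\<open>trials m\<close> is at most a constant times \<open>m ^ 14\<close>, so a
    14th root reduces the claim to the limit of \<open>m * x ^ m\<close>.\<close>
  define x where "x = root 14 \<theta>"
  have x: "0 \<le> x" "x ^ 14 = \<theta>" using th by (simp_all add: x_def real_root_pow_pos2)
  have "x < 1" using th real_root_less_iff[of 14 \<theta> 1] by (simp add: x_def)
  have "(\<lambda>m. real m * x ^ m) \<longlonglongrightarrow> 0"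
    by (rule powser_times_n_limit_0) (use x \<open>x < 1\<close> in simp)
  then have "(\<lambda>m. 4374 * (real m * x ^ m) ^ 14 / block_prob 5) \<longlonglongrightarrow> 4374 * 0 ^ 14 / block_prob 5"
    by (intro tendsto_intros) (use block_prob_bounds[of 5] in auto)
  then have lim2: "(\<lambda>m. 4374 * (real m * x ^ m) ^ 14 / block_prob 5) \<longlonglongrightarrow> 0" by simp
  have "(\<lambda>m. exp (-1) ^ m :: real) \<longlonglongrightarrow> 0" by (rule LIMSEQ_realpow_zero) simp_all
  from tendsto_add[OF this lim2]
  have lim: "(\<lambda>m. exp (-1) ^ m + 4374 * (real m * x ^ m) ^ 14 / block_prob 5) \<longlonglongrightarrow> 0" by simp
  have le: "rate m \<le> exp (-1) ^ m + 4374 * (real m * x ^ m) ^ 14 / block_prob 5" if "1 \<le> m" for m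
  proof -
    define p where "p = block_prob (m\<^sup>2)"
    have p: "0 < p" "p \<le> 1" using block_prob_bounds by (simp_all add: p_def)
    have pt: "p * real (trials m) = m"
    proof -
      have q: "real ((m\<^sup>2 + 2) ^ 6) = (real (m\<^sup>2) + 2) ^ 6" by (simp add: add.commute)
      have "(real (m\<^sup>2) + 2) ^ 6 > 0" by (intro zero_less_power) (simp add: add_nonneg_pos)
      then show ?thesis unfolding p_def block_prob_def trials_def of_nat_mult q by simp
    qed
    have "(1 - p) ^ trials m \<le> exp (- p) ^ trials m"
      using p exp_ge_add_one_self[of "- p"] by (intro power_mono) simp_all
    also have "\<dots> = exp (- (p * real (trials m)))" by (simp add: exp_of_nat_mult[symmetric] mult.commute)
    also have "\<dots> = exp (-1) ^ m" unfolding pt by (simp add: exp_of_nat_mult[symmetric])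
    finally have 1: "(1 - p) ^ trials m \<le> exp (-1) ^ m" .
    have "trials m \<le> 4374 * m ^ 14"
    proof -
      have m2: "1 \<le> m\<^sup>2" using that by simp
      have "(m\<^sup>2 + 2) ^ 6 \<le> (3 * m\<^sup>2) ^ 6" using m2 by (intro power_mono) linarith+
      also have "\<dots> = 729 * m ^ 12" by (simp add: power_mult_distrib flip: power_mult)
      finally have "trials m \<le> 6 * m * (729 * m ^ 12)" unfolding trials_def by (intro mult_left_mono) simp_all
      also have "\<dots> = 4374 * m ^ 13" using power_Suc[of m 12] by simp
      also have "\<dots> \<le> 4374 * m ^ 14" using that by (intro mult_left_mono power_increasing) simp_all
      finally show ?thesis .
    qed
    then have "real (trials m) \<le> real (4374 * m ^ 14)" by (simp only: of_nat_le_iff)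
    also have "\<dots> = 4374 * real m ^ 14" by simp
    finally have "real (trials m) \<le> 4374 * real m ^ 14" .
    then have "real (trials m) * \<theta> ^ m \<le> 4374 * real m ^ 14 * \<theta> ^ m" using th by (intro mult_right_mono) simp_all
    also have "\<dots> = 4374 * (real m * x ^ m) ^ 14"
    proof -
      have "\<theta> ^ m = (x ^ m) ^ 14" unfolding x(2)[symmetric] by (simp only: power_mult[symmetric] mult.commute)
      then show ?thesis by (simp add: power_mult_distrib)
    qed
    finally have "real (trials m) * \<theta> ^ m \<le> 4374 * (real m * x ^ m) ^ 14" .
    then have "real (trials m) * \<theta> ^ m / block_prob 5 \<le> 4374 * (real m * x ^ m) ^ 14 / block_prob 5"
      using block_prob_bounds[of 5] by (intro divide_right_mono) simp_all
    with 1 show ?thesis by (simp add: rate_def p_def \<theta>_def)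
  qed
  show ?thesis
  proof (rule tendsto_sandwich[OF _ _ tendsto_const lim])
    show "\<forall>\<^sub>F m in sequentially. rate m \<le> exp (-1) ^ m + 4374 * (real m * x ^ m) ^ 14 / block_prob 5"
      using eventually_ge_at_top[of 1] by eventually_elim (rule le)
    have "0 \<le> rate m" for m using block_prob_bounds[of 5] block_prob_bounds[of "m\<^sup>2"] by (simp add: rate_def)
    then show "\<forall>\<^sub>F m in sequentially. 0 \<le> rate m" by simp
  qed
qed

lemma covered_small_null:
  assumes "\<And>e. 0 < e \<Longrightarrow> covered S e"
  shows "\<exists>N\<in>null_sets lborel. S \<subseteq> N"
proof -
  have "\<forall>n. covered S (1 / Suc n)" using assms by simp
  then obtain U where U: "\<And>n. U n \<in> sets borel" "\<And>n. S \<subseteq> U n" "\<And>n. emeasure lborel (U n) \<le> ennreal (1 / Suc n)"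
    unfolding covered_def by metis
  have m: "(\<Inter>n. U n) \<in> sets borel" using U(1) by (intro sets.countable_INT) auto
  have "emeasure lborel (\<Inter>n. U n) \<le> 0"
  proof (rule ennreal_le_epsilon)
    fix e :: real assume "0 < e"
    then obtain n where n: "1 / Suc n < e" using nat_approx_posE by blast
    have "emeasure lborel (\<Inter>n. U n) \<le> emeasure lborel (U n)" using U(1) by (intro emeasure_mono) auto
    also have "\<dots> \<le> ennreal (1 / Suc n)" by (rule U(3))
    also have "\<dots> \<le> 0 + ennreal e" using n by (simp add: ennreal_leI less_imp_le)
    finally show "emeasure lborel (\<Inter>n. U n) \<le> 0 + ennreal e" .
  qed
  then show ?thesis using m U(2) by (intro bexI[of _ "\<Inter>n. U n"]) (auto simp: null_sets_def)
qed

text \<open>A point failing at all stages from \<open>m0\<close> on lies in every one of the late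
  bad sets, whose areas tend to zero. No Borel-Cantelli argument is needed, since only infinitely
  many successes are claimed.\<close>

lemma exceptional_null_set:
  "\<exists>N\<in>null_sets lborel. \<forall>x. irr x \<and> freq x \<notin> N \<longrightarrow> (\<forall>m0. \<exists>m\<ge>m0. x \<notin> bad m)"
proof -
  define S where "S m0 = (\<Inter>m\<in>{m0..}. bad m)" for m0
  have "\<exists>N\<in>null_sets lborel. freq ` S m0 \<subseteq> N" for m0
  proof (rule covered_small_null)
    fix e :: real assume "0 < e"
    then have "\<forall>\<^sub>F m in sequentially. rate m < e" using rate_tendsto_0 by (simp add: order_tendsto_iff)
    then obtain m where m: "m0 \<le> m" "rate m < e"
      using eventually_ge_at_top[of m0] by (metis (no_types, lifting) eventually_conj eventually_happens' sequentially_bot)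
    show "covered (freq ` S m0) e"
      by (rule covered_mono[OF covered_bad[of m]]) (use m in \<open>auto simp: S_def\<close>)
  qed
  then obtain N where N: "\<And>m0. N m0 \<in> null_sets lborel" "\<And>m0. freq ` S m0 \<subseteq> N m0" by metis
  have "(\<Union>m0. N m0) \<in> null_sets lborel" using N(1) by (rule null_sets_UN)
  moreover have "\<exists>m\<ge>m0. x \<notin> bad m" if "freq x \<notin> (\<Union>m0. N m0)" for x m0
    using that N(2)[of m0] unfolding S_def by blast
  ultimately show ?thesis by blast
qed

section \<open>From Brun to the accelerated algorithm\<close>

lemma brun_region_irr:
  assumes "irr x"
  shows "x \<in> brun_region L1 \<longleftrightarrow> snd x < 1/2"
    "x \<in> brun_region L2 \<longleftrightarrow> 1/2 < snd x \<and> snd x < 1 - fst x"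
    "x \<in> brun_region L3 \<longleftrightarrow> 1 - fst x < snd x"
proof -
  obtain x1 x2 where x: "x = (x1, x2)" by (cases x)
  have b: "0 < x1" "x1 < x2" "x2 < 1" using irr_open_Delta2[OF assms] by (simp_all add: x open_Delta2_def)
  have "x2 \<noteq> 1/2" using irrD[OF assms, of 0 2 "-1"] by (auto simp: x)
  moreover have "x2 \<noteq> 1 - x1" using irrD[OF assms, of 1 1 "-1"] by (auto simp: x)
  ultimately show "x \<in> brun_region L1 \<longleftrightarrow> snd x < 1/2"
    "x \<in> brun_region L2 \<longleftrightarrow> 1/2 < snd x \<and> snd x < 1 - fst x"
    "x \<in> brun_region L3 \<longleftrightarrow> 1 - fst x < snd x"
    using b by (auto simp: x Delta2_def)
qed

lemma ex1_brun_region: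
  assumes "irr x" shows "\<exists>!i. x \<in> brun_region i"
proof -
  obtain x1 x2 where x: "x = (x1, x2)" by (cases x)
  have b: "0 < x1" "x1 < x2" "x2 < 1" using irr_open_Delta2[OF assms] by (simp_all add: x open_Delta2_def)
  have "x2 \<noteq> 1/2" using irrD[OF assms, of 0 2 "-1"] by (auto simp: x)
  moreover have "x2 \<noteq> 1 - x1" using irrD[OF assms, of 1 1 "-1"] by (auto simp: x)
  ultimately consider "x2 < 1/2" | "1/2 < x2" "x2 < 1 - x1" | "1 - x1 < x2" by linarith
  then show ?thesis
  proof cases
    case 1
    show ?thesis
    proof (rule ex1I[of _ L1])
      show "i = L1" if "x \<in> brun_region i" for i
        using that brun_region_irr[OF assms] 1 b by (cases i) (auto simp: x)
    qed (use brun_region_irr[OF assms] 1 in \<open>simp add: x\<close>)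
  next
    case 2
    show ?thesis
    proof (rule ex1I[of _ L2])
      show "i = L2" if "x \<in> brun_region i" for i
        using that brun_region_irr[OF assms] 2 b by (cases i) (auto simp: x)
    qed (use brun_region_irr[OF assms] 2 in \<open>simp add: x\<close>)
  next
    case 3
    show ?thesis
    proof (rule ex1I[of _ L3])
      show "i = L3" if "x \<in> brun_region i" for i
        using that brun_region_irr[OF assms] 3 b by (cases i) (auto simp: x)
    qed (use brun_region_irr[OF assms] 3 in \<open>simp add: x\<close>)
  qed
qed

lemma Phi_0:
  assumes "irr x" "x \<in> brun_region i"
  shows "Phi x 0 = brun_subst i"
  unfolding Phi_def using ex1_brun_region[OF assms(1)] assms(2) by (simp add: the1_equality)

lemma Phi_Suc: "Phi x (Suc n) = Phi (brun_map x) n"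
  by (simp add: Phi_def funpow_swap1)

lemma Phi_add: "Phi x (m + n) = Phi ((brun_map ^^ m) x) n"
proof -
  have "(brun_map ^^ (m + n)) x = (brun_map ^^ n) ((brun_map ^^ m) x)"
    by (metis add.commute comp_apply funpow_add)
  then show ?thesis by (simp add: Phi_def)
qed

text \<open>On \<open>brun_region L1\<close> Brun's map keeps \<open>x1 / x2\<close> and subtracts
  one from \<open>1 / x2\<close>, so it just lowers the run length. With run length zero it
  coincides with the accelerated map.\<close>

lemma brun_step:
  assumes "irr x" "acc_digit x = (a, b)"
  shows "(0 < a \<longrightarrow> x \<in> brun_region L1 \<and> irr (brun_map x) \<and> acc_digit (brun_map x) = (a - 1, b) \<and> acc_map (brun_map x) = acc_map x) \<and>
    (a = 0 \<longrightarrow> x \<in> brun_region (if b then L3 else L2) \<and> brun_map x = acc_map x)"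
proof -
  obtain x1 x2 where x: "x = (x1, x2)" by (cases x)
  have xb: "0 < x1" "x1 < x2" "x2 < 1" using irr_open_Delta2[OF assms(1)] by (simp_all add: x open_Delta2_def)
  define n where "n = \<lfloor>1 / x2\<rfloor>"
  have n1: "1 \<le> n" using xb by (simp add: n_def le_floor_iff)
  have ab: "a = nat n - 1" "b \<longleftrightarrow> \<not> x1 / x2 \<le> frac (1 / x2)"
    using assms(2) by (simp_all add: acc_digit_def x n_def)
  have half: "x2 \<noteq> 1/2" using irrD[OF assms(1), of 0 2 "-1"] by (auto simp: x)
  show ?thesis
  proof (intro conjI impI)
    assume "0 < a"
    then have "2 \<le> n" using ab by simp
    then have "2 \<le> 1 / x2" by (simp add: n_def le_floor_iff)
    then have x2: "x2 < 1/2" using xb half by (simp add: field_simps)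
    show r: "x \<in> brun_region L1" using x2 brun_region_irr(1)[OF assms(1)] by (simp add: x)
    have bm: "brun_map x = (x1 / (1 - x2), x2 / (1 - x2))" using brun_map_eq[OF r] by (simp add: x)
    have quot: "1 / (x2 / (1 - x2)) = 1 / x2 - 1" "(x1 / (1 - x2)) / (x2 / (1 - x2)) = x1 / x2"
      using xb by (simp_all add: field_simps)
    have fl: "\<lfloor>1 / x2 - 1\<rfloor> = n - 1" "frac (1 / x2 - 1) = frac (1 / x2)"
      unfolding n_def by (simp_all add: frac_def)
    show "acc_digit (brun_map x) = (a - 1, b)"
      unfolding bm acc_digit_def fst_conv snd_conv quot fl using ab n1 by (simp add: nat_diff_distrib)
    show "acc_map (brun_map x) = acc_map x"
      unfolding bm acc_map_def fst_conv snd_conv quot fl by (simp add: x)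
    show "irr (brun_map x)"
      unfolding irr_def
    proof (intro conjI allI impI)
      show "brun_map x \<in> Delta2" using xb x2 by (simp add: bm Delta2_def divide_right_mono pos_divide_le_eq)
      fix p q r :: int
      assume "of_int p * fst (brun_map x) + of_int q * snd (brun_map x) + of_int r = 0"
      then have "(of_int p * x1 + of_int q * x2 + of_int r * (1 - x2)) / (1 - x2) = 0"
        using xb by (simp add: bm add_divide_distrib)
      then have "of_int p * x1 + of_int (q - r) * x2 + of_int r = 0"
        using xb by (simp add: algebra_simps)
      then show "p = 0" "q = 0" "r = 0" using irrD[OF assms(1), of p "q - r" r] by (simp_all add: x)
    qed
  next
    assume a0: "a = 0"
    then have n: "n = 1" using ab n1 by simp
    have fr: "frac (1 / x2) = 1 / x2 - 1" using n by (simp add: frac_def n_def)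
    have "1 / x2 < 2" using n unfolding n_def by (simp add: floor_eq_iff)
    then have x2: "1/2 < x2" using xb by (simp add: field_simps)
    have b': "b \<longleftrightarrow> 1 - x1 < x2"
      unfolding ab(2) fr using xb by (simp add: field_simps not_le)
    have ne: "x2 \<noteq> 1 - x1" using irrD[OF assms(1), of 1 1 "-1"] by (auto simp: x)
    show r: "x \<in> brun_region (if b then L3 else L2)"
      using brun_region_irr(2,3)[OF assms(1)] x2 b' ne by (cases b) (simp_all add: x del: brun_region.simps)
    have "brun_map x = brun_branch (if b then L3 else L2) x" by (rule brun_map_eq[OF r])
    also have "\<dots> = (if b then (1 / x2 - 1, x1 / x2) else (x1 / x2, 1 / x2 - 1))"
      using xb by (simp add: x diff_divide_distrib)
    also have "\<dots> = acc_map x"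
      using ab(2) by (simp add: acc_map_def x fr)
    finally show "brun_map x = acc_map x" .
  qed
qed

lemma brun_run:
  assumes "irr x" "acc_digit x = (a, b)"
  shows "(brun_map ^^ Suc a) x = acc_map x \<and> (\<forall>w. subst_prefix (Phi x) (Suc a) w = subst_word (acc_subst (a, b)) w)"
  using assms
proof (induction a arbitrary: x)
  case 0
  have s: "x \<in> brun_region (if b then L3 else L2)" "brun_map x = acc_map x"
    using brun_step[OF 0] by simp_all
  have "Phi x 0 = brun_subst (if b then L3 else L2)" by (rule Phi_0[OF 0(1) s(1)])
  also have "\<dots> = acc_subst (0, b)"
  proof
    fix j show "brun_subst (if b then L3 else L2) j = acc_subst (0, b) j" by (cases j; cases b) simp_all
  qed
  finally show ?case using s(2) by simp
next
  case (Suc a)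
  have s: "x \<in> brun_region L1" "irr (brun_map x)" "acc_digit (brun_map x) = (a, b)" "acc_map (brun_map x) = acc_map x"
    using brun_step[OF Suc.prems] by simp_all
  note IH = Suc.IH[OF s(2,3)]
  have "(brun_map ^^ Suc (Suc a)) x = (brun_map ^^ Suc a) (brun_map x)" by (simp only: funpow_Suc_right o_apply)
  also have "\<dots> = acc_map x" using IH s(4) by simp
  finally have 1: "(brun_map ^^ Suc (Suc a)) x = acc_map x" .
  have "subst_prefix (Phi x) (Suc (Suc a)) w = subst_word (acc_subst (Suc a, b)) w" for w
  proof -
    have "subst_prefix (Phi x) (Suc (Suc a)) w = subst_prefix (Phi x) 1 (subst_prefix (\<lambda>k. Phi x (1 + k)) (Suc a) w)"
      using subst_prefix_add[of "Phi x" 1 "Suc a" w] by (simp only: plus_1_eq_Suc)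
    also have "(\<lambda>k. Phi x (1 + k)) = Phi (brun_map x)" by (simp add: Phi_Suc)
    also have "subst_prefix (Phi (brun_map x)) (Suc a) w = subst_word (acc_subst (a, b)) w" using IH by blast
    also have "subst_prefix (Phi x) 1 (subst_word (acc_subst (a, b)) w) = subst_word (brun_subst L1) (subst_word (acc_subst (a, b)) w)"
      using Phi_0[OF Suc.prems(1) s(1)] by simp
    also have "\<dots> = subst_word (acc_subst (Suc a, b)) w"
    proof (induction w)
      case (Cons j w)
      have r: "subst_word (brun_subst L1) (replicate k L3) = replicate k L3" for k by (induction k) simp_all
      have "subst_word (brun_subst L1) (acc_subst (a, b) j) = acc_subst (Suc a, b) j"
        by (cases j) (simp_all add: r)
      then show ?case using Cons by simp
    qed simp
    finally show ?thesis .
  qed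
  with 1 show ?case by blast
qed

lemma Phi_telescope:
  "irr x \<Longrightarrow> \<exists>n\<ge>k. \<forall>w. subst_prefix (Phi x) n w = acc_prefix (digits x) k w"
proof (induction k arbitrary: x)
  case 0
  then show ?case by (intro exI[of _ 0]) simp
next
  case (Suc k)
  obtain a b where ab: "acc_digit x = (a, b)" by (cases "acc_digit x")
  note run = brun_run[OF Suc.prems ab]
  obtain n where n: "k \<le> n" "\<And>w. subst_prefix (Phi (acc_map x)) n w = acc_prefix (digits (acc_map x)) k w"
    using Suc.IH[OF irr_acc_map[OF Suc.prems]] by blast
  have "subst_prefix (Phi x) (Suc a + n) w = acc_prefix (digits x) (Suc k) w" for w
  proof -
    have "subst_prefix (Phi x) (Suc a + n) w = subst_prefix (Phi x) (Suc a) (subst_prefix (\<lambda>k. Phi x (Suc a + k)) n w)"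
      by (rule subst_prefix_add)
    also have "(\<lambda>k. Phi x (Suc a + k)) = Phi (acc_map x)"
      using run by (simp only: Phi_add)
    also have "subst_prefix (Phi x) (Suc a) (subst_prefix (Phi (acc_map x)) n w)
        = subst_word (acc_subst (digits x 0)) (acc_prefix (digits (acc_map x)) k w)"
      using run n(2) ab by (simp add: digits_def)
    also have "\<dots> = acc_prefix (digits x) (1 + k) w"
      by (subst subst_prefix_add) (simp add: digits_acc_map)
    finally show ?thesis by simp
  qed
  then show ?case using n(1) by (intro exI[of _ "Suc a + n"]) simp
qed

lemma brun_subst_onto: "\<exists>j. i \<in> set (brun_subst c j)"
proof (cases c)
  case L1
  then show ?thesis by (cases i) (auto intro: exI[of _ L1] exI[of _ L2])
next
  case L2
  then show ?thesis by (cases i) (auto intro: exI[of _ L1] exI[of _ L3])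
next
  case L3
  then show ?thesis by (cases i) (auto intro: exI[of _ L2] exI[of _ L3])
qed

lemma Phi_onto: "\<exists>j. i \<in> set (subst_prefix (\<lambda>k. Phi x (m + k)) n [j])"
proof (induction n)
  case (Suc n)
  then obtain j where j: "i \<in> set (subst_prefix (\<lambda>k. Phi x (m + k)) n [j])" by blast
  obtain j' where "j \<in> set (Phi x (m + n) j')" using brun_subst_onto unfolding Phi_def by blast
  then obtain u v where "Phi x (m + n) j' = u @ [j] @ v" by (metis append_Cons append_Nil split_list)
  then have "subst_prefix (\<lambda>k. Phi x (m + k)) (Suc n) [j'] = subst_prefix (\<lambda>k. Phi x (m + k)) n (u @ [j] @ v)" by simp
  then show ?case using j by (intro exI[of _ j']) (simp only: subst_prefix_append set_append Un_iff simp_thms)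
qed simp

text \<open>The accelerated prefixes are prefixes of the substitution product taken at the ends of
  runs. A product stopped inside a run is recovered because every letter occurs in some image under
  the remaining substitutions, so its words are factors of later accelerated words.\<close>

lemma sadic_words_Phi:
  assumes "irr x"
  shows "sadic_words (Phi x) = sadic_words (\<lambda>n. acc_subst (digits x n))"
proof -
  have 1: "\<exists>i n. sublist v (subst_prefix (Phi x) n [i])" if v: "sublist v (acc_prefix (digits x) k [i])" for v k i
    using Phi_telescope[OF assms, of k] v by metis
  have 2: "\<exists>i n. sublist v (acc_prefix (digits x) n [i])" if v: "sublist v (subst_prefix (Phi x) k [i])" for v k i
  proof -
    obtain n where n: "k \<le> n" "\<And>w. subst_prefix (Phi x) n w = acc_prefix (digits x) k w"
      using Phi_telescope[OF assms, of k] by blast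
    obtain j where "i \<in> set (subst_prefix (\<lambda>l. Phi x (k + l)) (n - k) [j])" using Phi_onto by blast
    then obtain p q where pq: "subst_prefix (\<lambda>l. Phi x (k + l)) (n - k) [j] = p @ [i] @ q"
      by (metis append_Cons append_Nil split_list)
    have "acc_prefix (digits x) k [j] = subst_prefix (Phi x) (k + (n - k)) [j]" using n by simp
    also have "\<dots> = subst_prefix (Phi x) k (p @ [i] @ q)" unfolding subst_prefix_add pq ..
    finally have "sublist (subst_prefix (Phi x) k [i]) (acc_prefix (digits x) k [j])"
      by (simp add: sublist_appendI del: append_Cons)
    then show ?thesis using v sublist_order.order.trans by blast
  qed
  show ?thesis unfolding sadic_words_def using 1 2 by blast
qed

lemma irr_Phi_domain:
  assumes "irr x" shows "x \<in> Phi_domain"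
proof -
  have "irr ((brun_map ^^ n) x)" for n
  proof (induction n)
    case (Suc n)
    obtain a b where ab: "acc_digit ((brun_map ^^ n) x) = (a, b)" by (cases "acc_digit ((brun_map ^^ n) x)")
    have "irr (brun_map ((brun_map ^^ n) x))"
      using brun_step[OF Suc ab] irr_acc_map[OF Suc] by (cases "a = 0") simp_all
    then show ?case by simp
  qed (use assms in simp)
  then show ?thesis using assms ex1_brun_region by (simp add: Phi_domain_def irr_def)
qed

section \<open>Density of orbits and the conclusion\<close>

definition indep3 :: "real \<Rightarrow> real \<Rightarrow> real \<Rightarrow> bool" where
  "indep3 a b c \<longleftrightarrow> (\<forall>A B C :: int. of_int A * a + of_int B * b + of_int C * c = 0 \<longrightarrow> A = 0 \<and> B = 0 \<and> C = 0)"

lemma indep3D: "indep3 a b c \<Longrightarrow> of_int A * a + of_int B * b + of_int C * c = 0 \<Longrightarrow> A = 0 \<and> B = 0 \<and> C = 0"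
  unfolding indep3_def by blast

lemma indep3_swap: "indep3 a b c \<Longrightarrow> indep3 b a c" "indep3 a b c \<Longrightarrow> indep3 a c b"
proof -
  assume i: "indep3 a b c"
  show "indep3 b a c" unfolding indep3_def
  proof (intro allI impI)
    fix A B C :: int assume "of_int A * b + of_int B * a + of_int C * c = 0"
    then show "A = 0 \<and> B = 0 \<and> C = 0" using indep3D[OF i, of B A C] by (simp add: algebra_simps)
  qed
  show "indep3 a c b" unfolding indep3_def
  proof (intro allI impI)
    fix A B C :: int assume "of_int A * a + of_int B * c + of_int C * b = 0"
    then show "A = 0 \<and> B = 0 \<and> C = 0" using indep3D[OF i, of A C B] by (simp add: algebra_simps)
  qed
qed

text \<open>Kronecker's theorem provides an integer multiple; a large multiple that almost returns to the
  lattice makes it a natural number.\<close>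

lemma dense_orbit:
  fixes t z :: "real \<times> real"
  assumes indep: "indep3 (fst t) (snd t) 1" and e: "0 < e"
  shows "\<exists>n. \<exists>g\<in>Z2. norm (of_nat n *\<^sub>R t + g - z) < e"
proof -
  \<comment> \<open>The third entry 1 is the shape in which Kronecker's theorem expects independence
    modulo the integers.\<close>
  define \<theta> where "\<theta> i = (if i = 0 then fst t else if i = 1 then snd t else 1)" for i :: nat
  define \<alpha> where "\<alpha> i = (if i = 0 then fst z else snd z)" for i :: nat
  have ne: "fst t \<noteq> snd t" "fst t \<noteq> 1" "snd t \<noteq> 1"
    using indep3D[OF indep, of 1 "-1" 0] indep3D[OF indep, of 1 0 "-1"] indep3D[OF indep, of 0 1 "-1"] by auto
  have upto2: "{..2::nat} = {0, 1, 2}" by auto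
  have inj: "inj_on \<theta> {..2}" using ne unfolding upto2 by (auto simp: \<theta>_def)
  interpret module "\<lambda>r x. real_of_int r * x"
    by (simp add: module.intro distrib_left mult.commute)
  have img: "\<theta> ` {..2} = {fst t, snd t, 1}" unfolding upto2 by (auto simp: \<theta>_def)
  have "independent (\<theta> ` {..2})"
    unfolding img
  proof (rule ccontr)
    assume "\<not> independent {fst t, snd t, 1}"
    then obtain f where f: "\<exists>v\<in>{fst t, snd t, 1}. f v \<noteq> 0" "(\<Sum>v\<in>{fst t, snd t, 1}. real_of_int (f v) * v) = 0"
      by (subst (asm) dependent_finite) auto
    have "of_int (f (fst t)) * fst t + of_int (f (snd t)) * snd t + of_int (f 1) * 1 = 0"
      using f(2) ne by simp
    then show False using indep3D[OF indep] f(1) by blast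
  qed
  then have indp: "module.independent (\<lambda>r x. real_of_int r * x) (\<theta> ` {..2})" .
  have e4: "0 < e / 4" using e by simp
  obtain k m where km: "\<And>i. i < 2 \<Longrightarrow> \<bar>of_int k * \<theta> i - of_int (m i) - \<alpha> i\<bar> < e / 4"
    by (rule Kronecker_thm_2[OF indp inj _ e4, of \<alpha>]) (auto simp: \<theta>_def)
  obtain N :: nat where N: "4 * \<bar>of_int k\<bar> / e < N" using reals_Archimedean2 by blast
  have "0 \<le> 4 * \<bar>of_int k\<bar> / e" using e by simp
  then have N0: "0 < N" using N by (metis not_gr_zero of_nat_0 not_less)
  obtain q p where q: "0 < q" "\<And>i. i < 2 \<Longrightarrow> \<bar>of_int q * \<theta> i - of_int (p i)\<bar> < 1 / N"
    by (rule Dirichlet_approx_simult[OF N0, of 2 \<theta>]) blast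
  \<comment> \<open>Since \<open>q\<close> is positive, this is nonnegative even for negative
    \<open>k\<close>. The added multiple costs at most \<open>e / 4\<close> in each coordinate by
    the choice of \<open>N\<close>.\<close>
  define n where "n = nat (k + \<bar>k\<bar> * q)"
  have "\<bar>k\<bar> * 1 \<le> \<bar>k\<bar> * q" using q(1) by (intro mult_left_mono) auto
  then have n: "real n = of_int k + \<bar>of_int k\<bar> * of_int q" unfolding n_def by (subst of_nat_nat) auto
  define g :: "real \<times> real" where "g = (- of_int (m 0 + \<bar>k\<bar> * p 0), - of_int (m 1 + \<bar>k\<bar> * p 1))"
  have "g \<in> Z2" by (simp add: g_def Z2_iff)
  have bound: "\<bar>real n * \<theta> i - of_int (m i + \<bar>k\<bar> * p i) - \<alpha> i\<bar> < e / 2" if "i < 2" for i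
  proof -
    have "real n * \<theta> i - of_int (m i + \<bar>k\<bar> * p i) - \<alpha> i
        = (of_int k * \<theta> i - of_int (m i) - \<alpha> i) + \<bar>of_int k\<bar> * (of_int q * \<theta> i - of_int (p i))"
      unfolding n by (simp add: algebra_simps)
    moreover have "\<bar>\<bar>of_int k\<bar> * (of_int q * \<theta> i - of_int (p i))\<bar> \<le> \<bar>of_int k\<bar> * (1 / N)"
      unfolding abs_mult using q(2)[OF that] by (intro mult_mono) simp_all
    moreover have "\<bar>of_int k\<bar> * (1 / N) \<le> e / 4" using N N0 e by (simp add: field_simps)
    ultimately show ?thesis using km[OF that] by linarith
  qed
  have "norm (of_nat n *\<^sub>R t + g - z) \<le> \<bar>fst (of_nat n *\<^sub>R t + g - z)\<bar> + \<bar>snd (of_nat n *\<^sub>R t + g - z)\<bar>"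
    unfolding norm_prod_def using sqrt_sum_squares_le_sum_abs by simp
  also have "\<dots> < e"
  proof -
    have c: "fst (of_nat n *\<^sub>R t + g - z) = real n * \<theta> 0 - of_int (m 0 + \<bar>k\<bar> * p 0) - \<alpha> 0"
      "snd (of_nat n *\<^sub>R t + g - z) = real n * \<theta> 1 - of_int (m 1 + \<bar>k\<bar> * p 1) - \<alpha> 1"
      by (simp_all add: \<theta>_def \<alpha>_def g_def)
    have "\<bar>fst (of_nat n *\<^sub>R t + g - z)\<bar> < e / 2" "\<bar>snd (of_nat n *\<^sub>R t + g - z)\<bar> < e / 2"
      unfolding c by (rule bound, simp)+
    then show ?thesis by linarith
  qed
  finally show ?thesis using \<open>g \<in> Z2\<close> by blast
qed

section \<open>Almost every point of the torus has a sorted frequency vector\<close>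

definition brun_coded :: "(real \<times> real) set \<Rightarrow> bool" where
  "brun_coded t \<longleftrightarrow> (\<exists>x1 x2. (x1, x2) \<in> Delta2 \<and> (x1, x2) \<in> Phi_domain \<and>
     (let X = sadic_words (Phi (x1, x2)) in
        (\<exists>\<mu>. unique_invariant_prob X \<mu> \<and>
             measurably_conjugate \<mu> word_shift torus2 (\<lambda>c. t + c)) \<and>
        (\<exists>R P \<tau>. natural_partition Z2 t R P \<tau> \<and>
             (\<forall>w\<in>X. \<exists>x\<in>R. coding_of P \<tau> x w))))"

text \<open>The translation is the barycentric combination of a unimodular lattice triangle with the
  frequencies as coefficients; the corner \<open>G3\<close> can be subtracted because the
  coefficients add up to one. \<open>(f1, f2)\<close> is the image under \<open>freq\<close> of the
  point \<open>(f1 / f3, f2 / f3)\<close> of \<open>Delta2\<close>.\<close>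

lemma brun_coded_sorted:
  fixes G1 G2 G3 :: "real \<times> real"
  assumes N: "\<forall>x. irr x \<and> freq x \<notin> N \<longrightarrow> (\<forall>m0. \<exists>m\<ge>m0. x \<notin> bad m)"
    and f: "0 < f1" "f1 < f2" "f2 < f3" "f1 + f2 + f3 = 1" "indep3 f1 f2 f3" "(f1, f2) \<notin> N"
    and G: "G1 \<in> Z2" "G2 \<in> Z2" "G3 \<in> Z2" "\<bar>det2 (G1 - G3) (G2 - G3)\<bar> = 1"
  shows "brun_coded (lattice_coset Z2 (f1 *\<^sub>R G1 + f2 *\<^sub>R G2 + f3 *\<^sub>R G3))"
proof -
  define x where "x = (f1 / f3, f2 / f3)"
  have f3: "0 < f3" using f by simp
  have irr: "irr x"
    unfolding irr_def
  proof (intro conjI allI impI)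
    show "x \<in> Delta2" using f f3 by (simp add: x_def Delta2_def divide_right_mono)
    fix a b c :: int assume "of_int a * fst x + of_int b * snd x + of_int c = 0"
    then have "f3 * (of_int a * (f1 / f3) + of_int b * (f2 / f3) + of_int c) = 0" by (simp add: x_def)
    then have "of_int a * f1 + of_int b * f2 + of_int c * f3 = 0" using f3 by (simp add: distrib_left mult.commute)
    then show "a = 0" "b = 0" "c = 0" using indep3D[OF f(5)] by blast+
  qed
  have sum: "f1 / f3 + f2 / f3 + 1 = 1 / f3" using f(4) f3 by (simp add: field_simps)
  have "freq x = (f1, f2)"
    using sum f3 by (simp add: freq_def chart_def base_def x_def)
  then have good: "\<forall>m0. \<exists>m\<ge>m0. x \<notin> bad m" using spec[OF N, of x] irr f(6) by simp
  interpret B: regular_brun_seq "digits x" "\<lambda>n. (acc_map ^^ n) x"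
  proof (rule regular_brun_seq.intro[OF brun_seq_digits[OF irr]], unfold_locales)
    fix m0
    obtain m where m: "m0 \<le> m" "x \<notin> bad m" using good by blast
    then show "\<exists>m\<ge>m0. \<exists>N. block (m\<^sup>2) (digits x) N \<and> regular_tail m (\<lambda>k. digits x (N + (3 + k)))"
      using not_bad[OF irr] by blast
  qed
  define g1 g2 where "g1 = G1 - G3" and "g2 = G2 - G3"
  have gZ: "g1 \<in> Z2" "g2 \<in> Z2" using G Z2_diff by (simp_all add: g1_def g2_def)
  define t0 where "t0 = f1 *\<^sub>R g1 + f2 *\<^sub>R g2"
  have t0: "(fst ((acc_map ^^ 0) x) + snd ((acc_map ^^ 0) x) + 1) *\<^sub>R t0 = fst ((acc_map ^^ 0) x) *\<^sub>R g1 + snd ((acc_map ^^ 0) x) *\<^sub>R g2"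
    using sum by (simp add: x_def t0_def scaleR_right_distrib)
  have "indep3 (fst t0) (snd t0) 1"
    unfolding indep3_def
  proof (intro allI impI)
    fix A B C :: int assume *: "of_int A * fst t0 + of_int B * snd t0 + of_int C * 1 = 0"
    obtain a1 b1 a2 b2 :: int where ab: "g1 = (of_int a1, of_int b1)" "g2 = (of_int a2, of_int b2)"
      using gZ by (cases g1; cases g2) (auto simp: Z2_def Ints_def)
    have "of_int (A * a1 + B * b1 + C) * f1 + of_int (A * a2 + B * b2 + C) * f2 + of_int C * f3
      = (of_int A * fst t0 + of_int B * snd t0) + of_int C * (f1 + f2 + f3)"
      by (simp add: t0_def ab algebra_simps)
    also have "\<dots> = 0" using * f(4) by simp
    finally have z: "A * a1 + B * b1 = 0" "A * a2 + B * b2 = 0" "C = 0" using indep3D[OF f(5)] by fastforce+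
    have "\<bar>real_of_int (a1 * b2 - b1 * a2)\<bar> = 1" using G(4) by (simp add: ab det2_def flip: g1_def g2_def)
    then have "real_of_int (a1 * b2 - b1 * a2) \<noteq> 0" by (metis abs_zero zero_neq_one)
    then have det: "a1 * b2 - b1 * a2 \<noteq> 0" by (simp only: of_int_eq_0_iff simp_thms)
    have "A * (a1 * b2 - b1 * a2) = b2 * (A * a1 + B * b1) - b1 * (A * a2 + B * b2)"
      "B * (a1 * b2 - b1 * a2) = a1 * (A * a2 + B * b2) - a2 * (A * a1 + B * b1)"
      by (simp_all add: algebra_simps)
    then have "A * (a1 * b2 - b1 * a2) = 0" "B * (a1 * b2 - b1 * a2) = 0"
      unfolding z by (simp_all only: mult_zero_right diff_0_right)
    then show "A = 0 \<and> B = 0 \<and> C = 0" using det z(3) by (simp only: mult_eq_0_iff simp_thms)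
  qed
  note dense = dense_orbit[OF this]
  note main = B.brun_natural_coding[OF gZ G(4)[folded g1_def g2_def] t0 dense]
  have "f1 *\<^sub>R G1 + f2 *\<^sub>R G2 + f3 *\<^sub>R G3 - t0 = (f1 + f2 + f3) *\<^sub>R G3"
    by (simp add: t0_def g1_def g2_def algebra_simps)
  then have "f1 *\<^sub>R G1 + f2 *\<^sub>R G2 + f3 *\<^sub>R G3 - t0 \<in> Z2" using f(4) G(3) by simp
  then have coset: "lattice_coset Z2 (f1 *\<^sub>R G1 + f2 *\<^sub>R G2 + f3 *\<^sub>R G3) = lattice_coset Z2 t0"
    by (simp add: lattice_coset_eq_iff)
  show ?thesis
    unfolding brun_coded_def coset Let_def
  proof (rule exI[of _ "fst x"], rule exI[of _ "snd x"], intro conjI)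
    show "(\<exists>\<mu>. unique_invariant_prob (sadic_words (Phi (fst x, snd x))) \<mu> \<and> measurably_conjugate \<mu> word_shift torus2 (\<lambda>c. lattice_coset Z2 t0 + c))"
      "(\<exists>R P \<tau>. natural_partition Z2 (lattice_coset Z2 t0) R P \<tau> \<and> (\<forall>w\<in>sadic_words (Phi (fst x, snd x)). \<exists>x\<in>R. coding_of P \<tau> x w))"
      using main unfolding prod.collapse sadic_words_Phi[OF irr] by blast+
    show "(fst x, snd x) \<in> Phi_domain" unfolding prod.collapse by (rule irr_Phi_domain[OF irr])
    show "(fst x, snd x) \<in> Delta2" unfolding prod.collapse using irr by (simp add: irr_def)
  qed
qed

text \<open>The corners of the triangle may be renamed so that the coefficients increase. As the
  order is not known beforehand, all ordered pairs of coefficients have to avoid the null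
  set.\<close>

lemma brun_coded_unsorted:
  fixes E1 E2 E3 :: "real \<times> real"
  assumes N: "\<forall>x. irr x \<and> freq x \<notin> N \<longrightarrow> (\<forall>m0. \<exists>m\<ge>m0. x \<notin> bad m)"
    and a: "0 < a1" "0 < a2" "0 < a3" "a1 + a2 + a3 = 1" "indep3 a1 a2 a3"
    and notin: "(a1, a2) \<notin> N" "(a2, a1) \<notin> N" "(a1, a3) \<notin> N" "(a3, a1) \<notin> N" "(a2, a3) \<notin> N" "(a3, a2) \<notin> N"
    and E: "E1 \<in> Z2" "E2 \<in> Z2" "E3 \<in> Z2" "\<bar>det2 (E1 - E3) (E2 - E3)\<bar> = 1"
  shows "brun_coded (lattice_coset Z2 (a1 *\<^sub>R E1 + a2 *\<^sub>R E2 + a3 *\<^sub>R E3))"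
proof -
  note S = brun_coded_sorted[OF N]
  have det: "\<bar>det2 (E2 - E3) (E1 - E3)\<bar> = 1" "\<bar>det2 (E1 - E2) (E3 - E2)\<bar> = 1" "\<bar>det2 (E3 - E2) (E1 - E2)\<bar> = 1"
    "\<bar>det2 (E2 - E1) (E3 - E1)\<bar> = 1" "\<bar>det2 (E3 - E1) (E2 - E1)\<bar> = 1"
    using E(4) unfolding det2_def fst_diff snd_diff by argo+
  note sw = indep3_swap(1)[OF a(5)] indep3_swap(2)[OF a(5)]
  have i: "indep3 a2 a1 a3" "indep3 a1 a3 a2" "indep3 a2 a3 a1" "indep3 a3 a1 a2" "indep3 a3 a2 a1"
    using sw indep3_swap by blast+
  have "a1 \<noteq> a2" "a2 \<noteq> a3" "a1 \<noteq> a3"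
    using indep3D[OF a(5), of 1 "-1" 0] indep3D[OF a(5), of 0 1 "-1"] indep3D[OF a(5), of 1 0 "-1"] by auto
  then consider "a1 < a2 \<and> a2 < a3" | "a2 < a1 \<and> a1 < a3" | "a1 < a3 \<and> a3 < a2"
    | "a3 < a1 \<and> a1 < a2" | "a2 < a3 \<and> a3 < a1" | "a3 < a2 \<and> a2 < a1" by linarith
  then show ?thesis
  proof cases
    case 1 then show ?thesis using S[where ?f1.0 = a1 and ?f2.0 = a2 and ?f3.0 = a3 and ?G1.0 = E1 and ?G2.0 = E2 and ?G3.0 = E3] a notin E det i by simp
  next
    case 2 then show ?thesis using S[where ?f1.0 = a2 and ?f2.0 = a1 and ?f3.0 = a3 and ?G1.0 = E2 and ?G2.0 = E1 and ?G3.0 = E3] a notin E det i by (simp add: add_ac)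
  next
    case 3 then show ?thesis using S[where ?f1.0 = a1 and ?f2.0 = a3 and ?f3.0 = a2 and ?G1.0 = E1 and ?G2.0 = E3 and ?G3.0 = E2] a notin E det i by (simp add: add_ac)
  next
    case 4 then show ?thesis using S[where ?f1.0 = a3 and ?f2.0 = a1 and ?f3.0 = a2 and ?G1.0 = E3 and ?G2.0 = E1 and ?G3.0 = E2] a notin E det i by (simp add: add_ac)
  next
    case 5 then show ?thesis using S[where ?f1.0 = a2 and ?f2.0 = a3 and ?f3.0 = a1 and ?G1.0 = E2 and ?G2.0 = E3 and ?G3.0 = E1] a notin E det i by (simp add: add_ac)
  next
    case 6 then show ?thesis using S[where ?f1.0 = a3 and ?f2.0 = a2 and ?f3.0 = a1 and ?G1.0 = E3 and ?G2.0 = E2 and ?G3.0 = E1] a notin E det i by (simp add: add_ac)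
  qed
qed

text \<open>Cramer's rule gives the inverse \<open>M\<close> of the linear part, and linear images
  of negligible sets are negligible.\<close>

lemma AE_affine_notin:
  fixes u v c :: "real \<times> real"
  assumes "N \<in> null_sets lborel" "det2 u v \<noteq> 0"
  shows "AE y in lborel. fst y *\<^sub>R u + snd y *\<^sub>R v + c \<notin> N"
proof -
  define D where "D = det2 u v"
  define M where "M w = (det2 w v / D, det2 u w / D)" for w :: "real \<times> real"
  have "linear M" by (rule linearI) (simp_all add: M_def det2_def add_divide_distrib[symmetric] algebra_simps)
  have M: "M (fst y *\<^sub>R u + snd y *\<^sub>R v) = y" for y
  proof -
    have "det2 (fst y *\<^sub>R u + snd y *\<^sub>R v) v = fst y * D" "det2 u (fst y *\<^sub>R u + snd y *\<^sub>R v) = snd y * D"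
      by (simp_all add: D_def det2_def algebra_simps)
    then show ?thesis using assms(2) by (simp add: M_def D_def)
  qed
  have "negligible N" using assms(1) by (simp add: negligible_iff_null_sets null_sets_completionI)
  then have "negligible ((+) (- c) ` N)" by (rule negligible_translation)
  then have "negligible (M ` ((+) (- c) ` N))"
    by (rule negligible_differentiable_image_negligible[OF order_refl _ linear_imp_differentiable_on[OF \<open>linear M\<close>]])
  then obtain N' where N': "N' \<in> null_sets lborel" "M ` ((+) (- c) ` N) \<subseteq> N'"
    unfolding negligible_iff_null_sets null_sets_completion_iff2 by blast
  have "{y \<in> space lborel. \<not> (fst y *\<^sub>R u + snd y *\<^sub>R v + c \<notin> N)} \<subseteq> N'"
  proof
    fix y assume "y \<in> {y \<in> space lborel. \<not> (fst y *\<^sub>R u + snd y *\<^sub>R v + c \<notin> N)}"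
    then have "fst y *\<^sub>R u + snd y *\<^sub>R v + c \<in> N" by simp
    then have "M (- c + (fst y *\<^sub>R u + snd y *\<^sub>R v + c)) \<in> M ` ((+) (- c) ` N)" by (intro imageI)
    then show "y \<in> N'" using N'(2) M[of y] by auto
  qed
  then show ?thesis using N'(1) by (intro AE_I')
qed

lemma AE_indep3: "AE y in lborel. indep3 (fst y) (snd y) 1"
proof -
  have *: "AE y in lborel. of_int A * fst y + of_int B * snd y + of_int C * 1 = (0::real) \<longrightarrow> A = 0 \<and> B = 0 \<and> C = 0"
    for A B C :: int
  proof (cases "A = 0 \<and> B = 0")
    case False
    then have "negligible {y. (of_int A :: real, of_int B :: real) \<bullet> y = of_int (- C)}"
      by (intro negligible_hyperplane) (auto simp: zero_prod_def)
    then obtain N where N: "N \<in> null_sets lborel" "{y. (of_int A :: real, of_int B :: real) \<bullet> y = of_int (- C)} \<subseteq> N"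
      unfolding negligible_iff_null_sets null_sets_completion_iff2 by blast
    have "{y \<in> space lborel. \<not> (of_int A * fst y + of_int B * snd y + of_int C * 1 = (0::real) \<longrightarrow> A = 0 \<and> B = 0 \<and> C = 0)} \<subseteq> N"
      using N(2) by (auto simp: inner_prod_def eq_neg_iff_add_eq_0)
    then show ?thesis using N(1) by (intro AE_I')
  qed simp
  then show ?thesis unfolding indep3_def AE_all_countable by blast
qed

lemma AE_brun_coded: "AE y in lborel. brun_coded (lattice_coset Z2 y)"
proof (rule AE_periodic)
  show "g \<in> Z2 \<Longrightarrow> brun_coded (lattice_coset Z2 (z + g)) = brun_coded (lattice_coset Z2 z)" for z g
    by (simp add: lattice_coset_period)
next
  obtain N where N0: "N \<in> null_sets lborel" and N: "\<forall>x. irr x \<and> freq x \<notin> N \<longrightarrow> (\<forall>m0. \<exists>m\<ge>m0. x \<notin> bad m)"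
    using exceptional_null_set by blast
  have L: "AE y in lborel. (p1 * fst y + q1 * snd y + r1, p2 * fst y + q2 * snd y + r2) \<notin> N"
    if "p1 * q2 - p2 * q1 \<noteq> 0" for p1 q1 r1 p2 q2 r2
    using AE_affine_notin[OF N0, of "(p1, p2)" "(q1, q2)" "(r1, r2)"] that by (simp add: det2_def mult.commute)
  have plus: "AE y in lborel. (fst y, snd y) \<notin> N \<and> (snd y, fst y) \<notin> N \<and> (fst y, 1 - fst y - snd y) \<notin> N
      \<and> (1 - fst y - snd y, fst y) \<notin> N \<and> (snd y, 1 - fst y - snd y) \<notin> N \<and> (1 - fst y - snd y, snd y) \<notin> N"
    using L[of 1 1 0 0 0 0] L[of 0 0 1 1 0 0] L[of 1 "-1" "-1" 0 0 1] L[of "-1" 0 1 "-1" 1 0] L[of 0 "-1" "-1" 1 0 1] L[of "-1" 1 0 "-1" 1 0]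
    by (simp add: algebra_simps)
  have minus: "AE y in lborel. (1 - fst y, 1 - snd y) \<notin> N \<and> (1 - snd y, 1 - fst y) \<notin> N \<and> (1 - fst y, fst y + snd y - 1) \<notin> N
      \<and> (fst y + snd y - 1, 1 - fst y) \<notin> N \<and> (1 - snd y, fst y + snd y - 1) \<notin> N \<and> (fst y + snd y - 1, 1 - snd y) \<notin> N"
    using L[of "-1" "-1" 0 0 1 1] L[of 0 0 "-1" "-1" 1 1] L[of "-1" 1 1 0 1 "-1"] L[of 1 0 "-1" 1 "-1" 1] L[of 0 1 1 "-1" 1 "-1"] L[of 1 "-1" 0 1 "-1" 1]
    by (simp add: algebra_simps)
  show "AE y in lborel. y \<in> unit_sq \<longrightarrow> brun_coded (lattice_coset Z2 y)"
    using plus minus AE_indep3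
  proof eventually_elim
    case (elim y)
    show ?case
    proof
    assume unit: "y \<in> unit_sq"
    obtain y1 y2 where y: "y = (y1, y2)" by (cases y)
    have ind: "indep3 y1 y2 1" using elim(3) by (simp add: y)
    have sq: "0 \<le> y1" "y1 < 1" "0 \<le> y2" "y2 < 1" using unit by (simp_all add: y)
    have ne: "y1 \<noteq> 0" "y2 \<noteq> 0" "y1 + y2 \<noteq> 1"
      using indep3D[OF ind, of 1 0 0] indep3D[OF ind, of 0 1 0] indep3D[OF ind, of 1 1 "-1"] by auto
    show "brun_coded (lattice_coset Z2 y)"
    \<comment> \<open>The diagonal cuts the square into two triangles. Below it the barycentric
      coordinates with respect to \<open>(1, 0)\<close>, \<open>(0, 1)\<close>,
      \<open>(0, 0)\<close> are positive; above it, those of \<open>y - (1, 1)\<close> with respect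
      to \<open>(-1, 0)\<close>, \<open>(0, -1)\<close>, \<open>(0, 0)\<close>.\<close>
    proof (cases "y1 + y2 < 1")
      case True
      have i: "indep3 y1 y2 (1 - y1 - y2)"
        unfolding indep3_def
      proof (intro allI impI)
        fix A B C :: int assume "of_int A * y1 + of_int B * y2 + of_int C * (1 - y1 - y2) = 0"
        then have "of_int (A - C) * y1 + of_int (B - C) * y2 + of_int C * 1 = 0" by (simp add: algebra_simps)
        then show "A = 0 \<and> B = 0 \<and> C = 0" using indep3D[OF ind] by fastforce
      qed
      have "brun_coded (lattice_coset Z2 (y1 *\<^sub>R (1, 0) + y2 *\<^sub>R (0, 1) + (1 - y1 - y2) *\<^sub>R (0, 0)))"
        by (rule brun_coded_unsorted[OF N _ _ _ _ i]) (use elim(1) sq ne True in \<open>simp_all add: y Z2_iff det2_def\<close>)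
      then show ?thesis by (simp add: y)
    next
      case False
      have i: "indep3 (1 - y1) (1 - y2) (y1 + y2 - 1)"
        unfolding indep3_def
      proof (intro allI impI)
        fix A B C :: int assume "of_int A * (1 - y1) + of_int B * (1 - y2) + of_int C * (y1 + y2 - 1) = 0"
        then have "of_int (C - A) * y1 + of_int (C - B) * y2 + of_int (A + B - C) * 1 = 0" by (simp add: algebra_simps)
        then show "A = 0 \<and> B = 0 \<and> C = 0" using indep3D[OF ind] by fastforce
      qed
      have "brun_coded (lattice_coset Z2 ((1 - y1) *\<^sub>R (-1, 0) + (1 - y2) *\<^sub>R (0, -1) + (y1 + y2 - 1) *\<^sub>R (0, 0)))"
        by (rule brun_coded_unsorted[OF N _ _ _ _ i]) (use elim(2) sq ne False in \<open>simp_all add: y Z2_iff det2_def\<close>)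
      then show ?thesis using lattice_coset_period[of "(-1, -1)" y] by (simp add: y Z2_iff)
    qed
    qed
  qed
qed

theorem corollary3p12:
  "AE t in torus2. \<exists>x1 x2. (x1, x2) \<in> Delta2 \<and> (x1, x2) \<in> Phi_domain \<and>
     (let X = sadic_words (Phi (x1, x2)) in
        (\<exists>\<mu>. unique_invariant_prob X \<mu> \<and>
             measurably_conjugate \<mu> word_shift torus2 (\<lambda>c. t + c)) \<and>
        (\<exists>R P \<tau>. natural_partition Z2 t R P \<tau> \<and>
             (\<forall>w\<in>X. \<exists>x\<in>R. coding_of P \<tau> x w)))"
  unfolding brun_coded_def[symmetric] by (rule AE_torus2I) (rule AE_brun_coded)

end
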